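(* Let $\omega=1$, $c_0=\frac{2\pi}{L}$, and let $(\theta_0,\rho_0)\in C^\infty([0,L])$ be an admissible initial datum describing a $k$-fold rotationally symmetric heterogeneous curve for some $k\ge2$. Then, as $t\to\infty$, the solution $(\theta,\rho)$ to the flow (F) with initial datum $(\theta_0,\rho_0)$ converges exponentially fast in $C^2([0,L])$ to some $(\theta_\infty,\rho_\infty)$ with $\partial_s\theta_\infty\equiv c_0$ and $\rho_\infty\equiv\nu$. In particular, the limit describes a circle with constant density.
   Context: Fixed parameters: $L>0$, $\nu\in\mathbb{R}$, $\mu>0$, $\omega\in\mathbb{Z}$, $c_0\in\mathbb{R}$, and $\beta\in C^\infty(\mathbb{R})$ with $\beta>0$. A function $\theta:[0,L]\to\mathbb{R}$ is the inclination angle of the arc-length parametrized planar curve $\gamma(s)=\gamma(0)+\int_0^s(\cos\theta,\sin\theta)\,\mathrm{d}r$, with curvature $\kappa=\partial_s\theta$; $\rho:[0,L]\to\mathbb{R}$ is a density. The flow (F) is the initial boundary value problem $$\partial_t\theta=\partial_s\big(\beta(\rho)(\partial_s\theta-c_0)\big)+\lambda_{\theta1}\sin\theta-\lambda_{\theta2}\cos\theta,\qquad \partial_t\rho=\mu\,\partial_s^2\rho-\tfrac12\beta'(\rho)(\partial_s\theta-c_0)^2-\lambda_\rho$$ on $(0,T)\times[0,L]$, with boundary conditions $\theta(\cdot,L)-\theta(\cdot,0)=2\pi\omega$, $\rho(\cdot,L)=\rho(\cdot,0)$, $\partial_s\theta(\cdot,L)=\partial_s\theta(\cdot,0)$, $\partial_s\rho(\cdot,L)=\partial_s\rho(\cdot,0)$,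 and initial condition $(\theta,\rho)(0,\cdot)=(\theta_0,\rho_0)$. The nonlocal multipliers are $$\begin{pmatrix}\lambda_{\theta1}\\ \lambda_{\theta2}\end{pmatrix}(t)=\Pi^{-1}(\theta)\int_0^L\begin{pmatrix}\cos\theta\\ \sin\theta\end{pmatrix}\partial_s\theta\,\beta(\rho)(\partial_s\theta-c_0)\,\mathrm{d}s,\quad \Pi(\theta)=\begin{pmatrix}\int_0^L\sin^2\theta\,\mathrm{d}s&-\int_0^L\cos\theta\sin\theta\,\mathrm{d}s\\-\int_0^L\cos\theta\sin\theta\,\mathrm{d}s&\int_0^L\cos^2\theta\,\mathrm{d}s\end{pmatrix},$$ $\lambda_\rho(t)=-\frac1{2L}\int_0^L\beta'(\rho)(\partial_s\theta-c_0)^2\,\mathrm{d}s$. An admissible initial datum is $(\theta_0,\rho_0)\in C^\infty([0,L])$ with $\int_0^L\rho_0\,\mathrm{d}s=\nu L$, $\int_0^L\sin\theta_0\,\mathrm{d}s=\int_0^L\cos\theta_0\,\mathrm{d}s=0$, $\theta_0(L)-\theta_0(0)=2\pi\omega$, $\rho_0(L)=\rho_0(0)$, and $\partial_s^j\theta_0(L)=\partial_s^j\theta_0(0)$, $\partial_s^j\rho_0(L)=\partial_s^j\rho_0(0)$ for $j=1,2$. By earlier work, for each admissible initial datum (F) has a unique global solution $(\theta,\rho)\in C^\infty((0,\infty)\times[0,L])\cap C^0([0,\infty);C^2([0,L]))$; for $t>0$ the functions $\partial_s\theta(t,\cdot)$ and $\rho(t,\cdot)$ extend to smooth $L$-periodic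 functions on $\mathbb{R}$; $\limsup_{t\to\infty}(\|\theta(t)\|_{W^{3,2}(0,L)}+\|\rho(t)\|_{W^{3,2}(0,L)})<\infty$; and the solution subconverges in $C^2([0,L])$ as $t\to\infty$ to a stationary solution of (F). Rotational symmetry: let $\omega=1$, $\phi(s)=2\pi s/L$ and $k\in\mathbb{N}$, $k\ge2$. The heterogeneous curve described by $(\theta,\rho)\in C^\infty([0,L])$ is $k$-fold rotationally symmetric if the $L$-periodic extension of $(\theta-\phi,\rho)$ to $\mathbb{R}$ is $\frac Lk$-periodic. *)

theory Defs
  imports "HOL-Analysis.Analysis" "HOL-Library.Real_Mod"
begin

section \<open>Function spaces on a compact interval\<close>

text \<open>Spatial derivatives on the interval from 0 to \<open>L\<close>, one-sided at the end points. Only the values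
  on the interval matter, so functions on the interval are total functions whose values elsewhere
  are irrelevant.\<close>

definition Ds :: "real \<Rightarrow> (real \<Rightarrow> real) \<Rightarrow> real \<Rightarrow> real" where
  "Ds L f = (\<lambda>s. vector_derivative f (at s within {0..L}))"

definition Ck_on :: "real \<Rightarrow> nat \<Rightarrow> (real \<Rightarrow> real) \<Rightarrow> bool" where
  "Ck_on L m f \<longleftrightarrow>
     (\<forall>j<m. \<forall>s\<in>{0..L}. (Ds L ^^ j) f differentiable (at s within {0..L})) \<and>
     (\<forall>j\<le>m. continuous_on {0..L} ((Ds L ^^ j) f))"

definition Cinf_on :: "real \<Rightarrow> (real \<Rightarrow> real) \<Rightarrow> bool" where
  "Cinf_on L f \<longleftrightarrow> (\<forall>m. Ck_on L m f)"

definition Ck_norm :: "real \<Rightarrow> nat \<Rightarrow> (real \<Rightarrow> real) \<Rightarrow> real" where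
  "Ck_norm L m f = (\<Sum>j\<le>m. SUP s\<in>{0..L}. \<bar>(Ds L ^^ j) f s\<bar>)"

text \<open>The norm of \<open>W\<^sup>m\<^sup>,\<^sup>2(0,L)\<close> for functions that are of class \<open>C\<^sup>m\<close> up to the boundary.\<close>

definition W2_norm :: "real \<Rightarrow> nat \<Rightarrow> (real \<Rightarrow> real) \<Rightarrow> real" where
  "W2_norm L m f = sqrt (\<Sum>j\<le>m. integral {0..L} (\<lambda>s. ((Ds L ^^ j) f s)\<^sup>2))"

definition Cinf_real :: "(real \<Rightarrow> real) \<Rightarrow> bool" where
  "Cinf_real f \<longleftrightarrow> (\<forall>m x. (deriv ^^ m) f field_differentiable at x)"

text \<open>Smoothness in \<open>(t,s)\<close> for \<open>t > 0\<close> and \<open>s\<close> in the closed interval, up to the boundary in \<open>s\<close>: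
  \<open>D i j\<close> is the partial derivative of order \<open>i\<close> in time and \<open>j\<close> in space.\<close>

definition Cinf_spacetime :: "real \<Rightarrow> (real \<Rightarrow> real \<Rightarrow> real) \<Rightarrow> bool" where
  "Cinf_spacetime L f \<longleftrightarrow> (\<exists>D :: nat \<Rightarrow> nat \<Rightarrow> real \<Rightarrow> real \<Rightarrow> real.
     (\<forall>t>0. \<forall>s\<in>{0..L}. D 0 0 t s = f t s) \<and>
     (\<forall>i j. \<forall>t>0. \<forall>s\<in>{0..L}.
        ((\<lambda>\<tau>. D i j \<tau> s) has_real_derivative D (Suc i) j t s) (at t) \<and>
        ((\<lambda>\<sigma>. D i j t \<sigma>) has_real_derivative D i (Suc j) t s) (at s within {0..L})) \<and>
     (\<forall>i j. continuous_on ({0<..} \<times> {0..L}) (\<lambda>(t, s). D i j t s)))"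

text \<open>Continuous maps from \<open>[0,\<infinity>)\<close> into the Banach space \<open>C\<^sup>m([0,L])\<close>.\<close>

definition C0_Ck :: "real \<Rightarrow> nat \<Rightarrow> (real \<Rightarrow> real \<Rightarrow> real) \<Rightarrow> bool" where
  "C0_Ck L m f \<longleftrightarrow>
     (\<forall>t\<ge>0. Ck_on L m (f t)) \<and>
     (\<forall>t\<^sub>0\<ge>0. ((\<lambda>t. Ck_norm L m (\<lambda>s. f t s - f t\<^sub>0 s)) \<longlongrightarrow> 0) (at t\<^sub>0 within {0..}))"

section \<open>The flow\<close>

definition Pi_mat :: "real \<Rightarrow> (real \<Rightarrow> real) \<Rightarrow> real^2^2" where
  "Pi_mat L \<theta> = vector
     [vector [integral {0..L} (\<lambda>s. (sin (\<theta> s))\<^sup>2), - integral {0..L} (\<lambda>s. cos (\<theta> s) * sin (\<theta> s))],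
      vector [- integral {0..L} (\<lambda>s. cos (\<theta> s) * sin (\<theta> s)), integral {0..L} (\<lambda>s. (cos (\<theta> s))\<^sup>2)]]"

definition lambda_theta ::
  "real \<Rightarrow> real \<Rightarrow> (real \<Rightarrow> real) \<Rightarrow> (real \<Rightarrow> real) \<Rightarrow> (real \<Rightarrow> real) \<Rightarrow> real^2" where
  "lambda_theta L c\<^sub>0 \<beta> \<theta> \<rho> = matrix_inv (Pi_mat L \<theta>) *v
     vector [integral {0..L} (\<lambda>s. cos (\<theta> s) * Ds L \<theta> s * \<beta> (\<rho> s) * (Ds L \<theta> s - c\<^sub>0)),
             integral {0..L} (\<lambda>s. sin (\<theta> s) * Ds L \<theta> s * \<beta> (\<rho> s) * (Ds L \<theta> s - c\<^sub>0))]"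

definition lambda_rho ::
  "real \<Rightarrow> real \<Rightarrow> (real \<Rightarrow> real) \<Rightarrow> (real \<Rightarrow> real) \<Rightarrow> (real \<Rightarrow> real) \<Rightarrow> real" where
  "lambda_rho L c\<^sub>0 \<beta> \<theta> \<rho> =
     - (1 / (2 * L)) * integral {0..L} (\<lambda>s. deriv \<beta> (\<rho> s) * (Ds L \<theta> s - c\<^sub>0)\<^sup>2)"

text \<open>Global solutions in the class \<open>C\<^sup>\<infinity>((0,\<infinity>) \<times> [0,L]) \<inter> C\<^sup>0([0,\<infinity>); C\<^sup>2([0,L]))\<close>. Invertibility of
  \<open>Pi_mat\<close> is what makes the multipliers meaningful: \<^const>\<open>matrix_inv\<close> of a singular matrix is
  an arbitrary value. (Along the flow it is automatic if the initial curve is closed.)\<close>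

definition flow_solution ::
  "real \<Rightarrow> real \<Rightarrow> int \<Rightarrow> real \<Rightarrow> (real \<Rightarrow> real) \<Rightarrow> (real \<Rightarrow> real) \<Rightarrow> (real \<Rightarrow> real) \<Rightarrow>
   (real \<Rightarrow> real \<Rightarrow> real) \<Rightarrow> (real \<Rightarrow> real \<Rightarrow> real) \<Rightarrow> bool" where
  "flow_solution L \<mu> \<omega> c\<^sub>0 \<beta> \<theta>\<^sub>0 \<rho>\<^sub>0 \<theta> \<rho> \<longleftrightarrow>
     Cinf_spacetime L \<theta> \<and> Cinf_spacetime L \<rho> \<and> C0_Ck L 2 \<theta> \<and> C0_Ck L 2 \<rho> \<and>
     (\<forall>t\<ge>0. invertible (Pi_mat L (\<theta> t))) \<and>
     (\<forall>t>0. \<forall>s\<in>{0..L}.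
        deriv (\<lambda>\<tau>. \<theta> \<tau> s) t =
          Ds L (\<lambda>\<sigma>. \<beta> (\<rho> t \<sigma>) * (Ds L (\<theta> t) \<sigma> - c\<^sub>0)) s
          + lambda_theta L c\<^sub>0 \<beta> (\<theta> t) (\<rho> t) $ 1 * sin (\<theta> t s)
          - lambda_theta L c\<^sub>0 \<beta> (\<theta> t) (\<rho> t) $ 2 * cos (\<theta> t s) \<and>
        deriv (\<lambda>\<tau>. \<rho> \<tau> s) t =
          \<mu> * (Ds L ^^ 2) (\<rho> t) s
          - (1/2) * deriv \<beta> (\<rho> t s) * (Ds L (\<theta> t) s - c\<^sub>0)\<^sup>2
          - lambda_rho L c\<^sub>0 \<beta> (\<theta> t) (\<rho> t)) \<and>
     (\<forall>t>0. \<theta> t L - \<theta> t 0 = 2 * pi * of_int \<omega> \<and> \<rho> t L = \<rho> t 0 \<and>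
            Ds L (\<theta> t) L = Ds L (\<theta> t) 0 \<and> Ds L (\<rho> t) L = Ds L (\<rho> t) 0) \<and>
     (\<forall>s\<in>{0..L}. \<theta> 0 s = \<theta>\<^sub>0 s \<and> \<rho> 0 s = \<rho>\<^sub>0 s)"

definition stationary_solution ::
  "real \<Rightarrow> real \<Rightarrow> int \<Rightarrow> real \<Rightarrow> (real \<Rightarrow> real) \<Rightarrow> (real \<Rightarrow> real) \<Rightarrow> (real \<Rightarrow> real) \<Rightarrow> bool" where
  "stationary_solution L \<mu> \<omega> c\<^sub>0 \<beta> \<theta> \<rho> \<longleftrightarrow>
     flow_solution L \<mu> \<omega> c\<^sub>0 \<beta> \<theta> \<rho> (\<lambda>_. \<theta>) (\<lambda>_. \<rho>)"

definition admissible ::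
  "real \<Rightarrow> real \<Rightarrow> int \<Rightarrow> (real \<Rightarrow> real) \<Rightarrow> (real \<Rightarrow> real) \<Rightarrow> bool" where
  "admissible L \<nu> \<omega> \<theta>\<^sub>0 \<rho>\<^sub>0 \<longleftrightarrow>
     Cinf_on L \<theta>\<^sub>0 \<and> Cinf_on L \<rho>\<^sub>0 \<and>
     integral {0..L} \<rho>\<^sub>0 = \<nu> * L \<and>
     integral {0..L} (\<lambda>s. sin (\<theta>\<^sub>0 s)) = 0 \<and> integral {0..L} (\<lambda>s. cos (\<theta>\<^sub>0 s)) = 0 \<and>
     \<theta>\<^sub>0 L - \<theta>\<^sub>0 0 = 2 * pi * of_int \<omega> \<and> \<rho>\<^sub>0 L = \<rho>\<^sub>0 0 \<and>
     (\<forall>j\<in>{1, 2}. (Ds L ^^ j) \<theta>\<^sub>0 L = (Ds L ^^ j) \<theta>\<^sub>0 0 \<and> (Ds L ^^ j) \<rho>\<^sub>0 L = (Ds L ^^ j) \<rho>\<^sub>0 0)"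

definition extends_smooth_periodic :: "real \<Rightarrow> (real \<Rightarrow> real) \<Rightarrow> bool" where
  "extends_smooth_periodic L f \<longleftrightarrow>
     (\<exists>g. Cinf_real g \<and> (\<forall>s. g (s + L) = g s) \<and> (\<forall>s\<in>{0..L}. g s = f s))"

text \<open>The known theory of the flow for one set of parameters: global existence, uniqueness,
  spatial periodicity, boundedness in \<open>W\<^sup>3\<^sup>,\<^sup>2\<close> and subconvergence (here in its weak form: along
  some sequence of times tending to infinity), for every admissible initial datum.\<close>

definition flow_theory :: "real \<Rightarrow> real \<Rightarrow> real \<Rightarrow> int \<Rightarrow> real \<Rightarrow> (real \<Rightarrow> real) \<Rightarrow> bool" where
  "flow_theory L \<nu> \<mu> \<omega> c\<^sub>0 \<beta> \<longleftrightarrow> (\<forall>\<theta>\<^sub>0 \<rho>\<^sub>0. admissible L \<nu> \<omega> \<theta>\<^sub>0 \<rho>\<^sub>0 \<longrightarrow>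
     (\<exists>\<theta> \<rho>. flow_solution L \<mu> \<omega> c\<^sub>0 \<beta> \<theta>\<^sub>0 \<rho>\<^sub>0 \<theta> \<rho>) \<and>
     (\<forall>\<theta> \<rho> \<theta>' \<rho>'.
        flow_solution L \<mu> \<omega> c\<^sub>0 \<beta> \<theta>\<^sub>0 \<rho>\<^sub>0 \<theta> \<rho> \<longrightarrow> flow_solution L \<mu> \<omega> c\<^sub>0 \<beta> \<theta>\<^sub>0 \<rho>\<^sub>0 \<theta>' \<rho>' \<longrightarrow>
        (\<forall>t\<ge>0. \<forall>s\<in>{0..L}. \<theta> t s = \<theta>' t s \<and> \<rho> t s = \<rho>' t s)) \<and>
     (\<forall>\<theta> \<rho>. flow_solution L \<mu> \<omega> c\<^sub>0 \<beta> \<theta>\<^sub>0 \<rho>\<^sub>0 \<theta> \<rho> \<longrightarrow>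
        (\<forall>t>0. extends_smooth_periodic L (Ds L (\<theta> t)) \<and> extends_smooth_periodic L (\<rho> t)) \<and>
        Limsup at_top (\<lambda>t. ereal (W2_norm L 3 (\<theta> t) + W2_norm L 3 (\<rho> t))) < \<infinity> \<and>
        (\<exists>\<theta>\<^sub>s \<rho>\<^sub>s (\<tau> :: nat \<Rightarrow> real).
           stationary_solution L \<mu> \<omega> c\<^sub>0 \<beta> \<theta>\<^sub>s \<rho>\<^sub>s \<and> filterlim \<tau> at_top sequentially \<and>
           (\<lambda>n. Ck_norm L 2 (\<lambda>s. \<theta> (\<tau> n) s - \<theta>\<^sub>s s) + Ck_norm L 2 (\<lambda>s. \<rho> (\<tau> n) s - \<rho>\<^sub>s s))
             \<longlonglongrightarrow> 0)))"

section \<open>Symmetry and geometry\<close>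

definition periodic_ext :: "real \<Rightarrow> (real \<Rightarrow> real) \<Rightarrow> real \<Rightarrow> real" where
  "periodic_ext L f s = f (s rmod L)"

definition rot_symmetric :: "real \<Rightarrow> nat \<Rightarrow> (real \<Rightarrow> real) \<Rightarrow> (real \<Rightarrow> real) \<Rightarrow> bool" where
  "rot_symmetric L k \<theta> \<rho> \<longleftrightarrow>
     (\<forall>s. periodic_ext L (\<lambda>\<sigma>. \<theta> \<sigma> - 2 * pi * \<sigma> / L) (s + L / real k) =
            periodic_ext L (\<lambda>\<sigma>. \<theta> \<sigma> - 2 * pi * \<sigma> / L) s \<and>
          periodic_ext L \<rho> (s + L / real k) = periodic_ext L \<rho> s)"

definition angle_curve :: "real \<times> real \<Rightarrow> (real \<Rightarrow> real) \<Rightarrow> real \<Rightarrow> real \<times> real" where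
  "angle_curve p \<theta> s = p + integral {0..s} (\<lambda>r. (cos (\<theta> r), sin (\<theta> r)))"

definition describes_circle :: "real \<Rightarrow> (real \<Rightarrow> real) \<Rightarrow> bool" where
  "describes_circle L \<theta> \<longleftrightarrow> (\<forall>p. \<exists>c r. r > 0 \<and> angle_curve p \<theta> ` {0..L} = sphere c r)"

end

theory Submission
  imports Defs
begin

text \<open>
  Shifting the arc length by \<open>L/k\<close> and rotating the curve by \<open>2\<pi>/k\<close> maps solutions of the flow to
  solutions, and the vector \<open>\<lambda>\<^sub>\<theta>\<close> rotates along. By uniqueness a symmetric solution is
  invariant, so \<open>\<lambda>\<^sub>\<theta>\<close> is fixed by a nontrivial rotation and vanishes. The equation for
  \<open>u = \<theta> - 2\<pi>s/L\<close> is then the linear diffusion \<open>\<partial>\<^sub>t u = \<partial>\<^sub>s(\<beta>(\<rho>) \<partial>\<^sub>s u)\<close> with a coefficient bounded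
  below, so \<open>u\<close> minus its conserved mean decays exponentially in \<open>L\<^sup>2\<close>. Interpolation against the
  \<open>W\<^sup>3\<^sup>,\<^sup>2\<close> bound upgrades this to \<open>C\<^sup>2\<close>. Finally \<open>\<rho> - \<nu>\<close> solves a heat equation
  whose forcing is quadratic in \<open>\<partial>\<^sub>s u\<close>, and the same argument applies.
\<close>

section \<open>Jets on an interval and interpolation\<close>

text \<open>The theory is given for functions on \<open>{0..L}\<close> with one-sided derivatives at
  the ends, so the shift is not a translation of the line but a cut-and-paste of the interval. It
  keeps smoothness only if all mixed derivatives match at the two ends. For t > 0 this comes from
  the periodic extensions; at t = 0 admissibility matches the orders up to 2, exactly those that
  \<open>C0_Ck L 2\<close> involves. The value \<open>c\<^sub>0 = 2 * pi / L\<close> makes \<theta>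
  - \<open>c\<^sub>0\<close> s periodic and turns the flux into \<beta>(\<rho>) times the derivative
  of this periodic function. As \<beta> is positive but may tend to 0 at infinity, the lower bound
  on the coefficient has to be earned: the conserved mean of \<rho> and the bound on its derivative
  confine \<rho> to a compact interval. In the density equation the multiplier is constant in s and
  disappears when tested against the mean-zero function \<rho> - \<nu>. The W^(3,2) bound is a
  limsup, so the estimates hold from some time T on; earlier times are absorbed by continuity in
  C^2.\<close>

definition jet :: "real \<Rightarrow> nat \<Rightarrow> (real \<Rightarrow> real) \<Rightarrow> (nat \<Rightarrow> real \<Rightarrow> real) \<Rightarrow> bool" where
  "jet L m f F \<longleftrightarrow> (\<forall>s\<in>{0..L}. F 0 s = f s) \<and>
     (\<forall>j<m. \<forall>s\<in>{0..L}. (F j has_real_derivative F (Suc j) s) (at s within {0..L})) \<and>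
     (\<forall>j\<le>m. continuous_on {0..L} (F j))"

lemma DERIV_transform_Icc:
  fixes f g :: "real \<Rightarrow> real"
  assumes "s \<in> {a..b}" "\<And>x. x \<in> {a..b} \<Longrightarrow> g x = f x"
    "(f has_real_derivative d) (at s within {a..b})"
  shows "(g has_real_derivative d) (at s within {a..b})"
  using assms has_vector_derivative_transform[of s "{a..b}" g f d]
  by (simp add: has_real_derivative_iff_has_vector_derivative)

lemma Ds_cong:
  assumes "\<And>x. x \<in> {0..L} \<Longrightarrow> f x = g x" "s \<in> {0..L}"
  shows "Ds L f s = Ds L g s"
  unfolding Ds_def by (rule vector_derivative_cong_eq) (use assms in \<open>auto intro: always_eventually\<close>)

text \<open>For \<open>L > 0\<close> no point of \<open>{0..L}\<close> is isolated, so a derivative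
  within the interval is unique, also at the two ends.\<close>

lemma Ds_eqI:
  assumes "L > 0" "s \<in> {0..L}" "(f has_real_derivative d) (at s within {0..L})"
  shows "Ds L f s = d"
  unfolding Ds_def using assms
  by (intro vector_derivative_within_closed_interval)
     (auto simp: has_real_derivative_iff_has_vector_derivative)

lemma Ds_works:
  assumes "f differentiable (at s within {0..L})"
  shows "(f has_real_derivative Ds L f s) (at s within {0..L})"
  using assms vector_derivative_works
  by (auto simp: Ds_def has_real_derivative_iff_has_vector_derivative)

text \<open>\<open>Ds\<close> reads a function only on \<open>{0..L}\<close>
  (\<open>Ds_cong\<close>), so each inductive step may replace the iterate by \<open>F j\<close>.
  This lets the proof compute with explicit derivative families instead of iterates of the total
  operator \<open>Ds\<close>.\<close>

lemma jet_Ds: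
  assumes "L > 0" "jet L m f F" "j \<le> m" "s \<in> {0..L}"
  shows "(Ds L ^^ j) f s = F j s"
  using assms(3,4)
proof (induction j arbitrary: s)
  case 0
  then show ?case using assms(2) by (simp add: jet_def)
next
  case (Suc j)
  have "(Ds L ^^ Suc j) f s = Ds L (F j) s"
    using Suc by (auto intro!: Ds_cong)
  also have "\<dots> = F (Suc j) s"
    using assms(1,2) Suc.prems by (intro Ds_eqI) (auto simp: jet_def)
  finally show ?case .
qed

lemma jet_Ck_on:
  assumes "L > 0" "jet L m f F"
  shows "Ck_on L m f"
  unfolding Ck_on_def
proof (intro conjI allI impI ballI)
  fix j s assume j: "j < m" and s: "s \<in> {0..L}"
  have "(F j has_real_derivative F (Suc j) s) (at s within {0..L})"
    using assms j s by (auto simp: jet_def)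
  then have "((Ds L ^^ j) f has_real_derivative F (Suc j) s) (at s within {0..L})"
    using s jet_Ds[OF assms, of j] j
    by (intro DERIV_transform_Icc[of s 0 L "(Ds L ^^ j) f" "F j"]) auto
  then show "(Ds L ^^ j) f differentiable (at s within {0..L})"
    using real_differentiable_def by blast
next
  fix j assume "j \<le> m"
  then show "continuous_on {0..L} ((Ds L ^^ j) f)"
    using assms jet_Ds[OF assms, of j] continuous_on_eq[of "{0..L}" "F j" "(Ds L ^^ j) f"] by (auto simp: jet_def)
qed

lemma Ck_on_jet: "Ck_on L m f \<Longrightarrow> jet L m f (\<lambda>j. (Ds L ^^ j) f)"
  unfolding Ck_on_def jet_def using Ds_works by fastforce

lemma jet_diff:
  assumes "jet L m f F" "jet L m g G"
  shows "jet L m (\<lambda>s. f s - g s) (\<lambda>j s. F j s - G j s)"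
  using assms unfolding jet_def by (auto intro!: continuous_on_diff DERIV_diff)

lemma Ck_norm_jet:
  assumes "L > 0" "jet L m f F"
  shows "Ck_norm L m f = (\<Sum>j\<le>m. SUP s\<in>{0..L}. \<bar>F j s\<bar>)"
  unfolding Ck_norm_def using jet_Ds[OF assms] by (intro sum.cong refl SUP_cong) auto

lemma bdd_above_abs_continuous_Icc:
  fixes f :: "real \<Rightarrow> real"
  assumes "continuous_on {a..b} f"
  shows "bdd_above ((\<lambda>s. \<bar>f s\<bar>) ` {a..b})"
  using assms by (intro compact_imp_bounded[THEN bounded_imp_bdd_above] compact_continuous_image continuous_intros) auto

lemma jet_le_SUP:
  assumes "jet L m f F" "j \<le> m" "s \<in> {0..L}"
  shows "\<bar>F j s\<bar> \<le> (SUP s\<in>{0..L}. \<bar>F j s\<bar>)"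
  using assms by (intro cSUP_upper bdd_above_abs_continuous_Icc) (auto simp: jet_def)

lemma Ck_norm_le:
  assumes "L > 0" "jet L m f F" "\<And>j s. j \<le> m \<Longrightarrow> s \<in> {0..L} \<Longrightarrow> \<bar>F j s\<bar> \<le> B j"
  shows "Ck_norm L m f \<le> (\<Sum>j\<le>m. B j)"
  unfolding Ck_norm_jet[OF assms(1,2)] using assms by (intro sum_mono cSUP_least) auto

lemma Ck_norm_nonneg:
  assumes "L > 0" "Ck_on L m f"
  shows "Ck_norm L m f \<ge> 0"
proof -
  have "0 \<le> (SUP s\<in>{0..L}. \<bar>(Ds L ^^ j) f s\<bar>)" if "j \<le> m" for j
    using jet_le_SUP[OF Ck_on_jet[OF assms(2)] that, of 0] assms(1) by (auto intro: order_trans)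
  then show ?thesis unfolding Ck_norm_def by (intro sum_nonneg) auto
qed

lemma abs_le_Ck_norm:
  assumes "L > 0" "jet L m f F" "j \<le> m" "s \<in> {0..L}"
  shows "\<bar>F j s\<bar> \<le> Ck_norm L m f"
proof -
  have "0 \<le> (SUP s\<in>{0..L}. \<bar>F j s\<bar>)" if "j \<le> m" for j
    using jet_le_SUP[OF assms(2) that, of 0] assms(1) by (auto intro: order_trans)
  then have "(SUP s\<in>{0..L}. \<bar>F j s\<bar>) \<le> (\<Sum>j\<le>m. SUP s\<in>{0..L}. \<bar>F j s\<bar>)"
    using assms(3) by (intro member_le_sum) auto
  then show ?thesis using jet_le_SUP[OF assms(2-4)] Ck_norm_jet[OF assms(1,2)] by linarith
qed

lemma Ck_norm_triangle:
  assumes "L > 0" "Ck_on L m f" "Ck_on L m g" "Ck_on L m h"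
  shows "Ck_norm L m (\<lambda>s. f s - h s) \<le> Ck_norm L m (\<lambda>s. f s - g s) + Ck_norm L m (\<lambda>s. g s - h s)"
proof -
  let ?D = "\<lambda>f j. (Ds L ^^ j) f"
  note J = assms(2-4)[THEN Ck_on_jet]
  note fg = jet_diff[OF J(1) J(2)] and gh = jet_diff[OF J(2) J(3)] and fh = jet_diff[OF J(1) J(3)]
  have "Ck_norm L m (\<lambda>s. f s - h s) \<le> (\<Sum>j\<le>m. (SUP s\<in>{0..L}. \<bar>?D f j s - ?D g j s\<bar>) + (SUP s\<in>{0..L}. \<bar>?D g j s - ?D h j s\<bar>))"
  proof (rule Ck_norm_le[OF assms(1) fh])
    fix j s assume js: "j \<le> m" "s \<in> {0..L}"
    show "\<bar>?D f j s - ?D h j s\<bar> \<le> (SUP s\<in>{0..L}. \<bar>?D f j s - ?D g j s\<bar>) + (SUP s\<in>{0..L}. \<bar>?D g j s - ?D h j s\<bar>)"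
      using jet_le_SUP[OF fg js] jet_le_SUP[OF gh js] by linarith
  qed
  then show ?thesis
    by (simp add: Ck_norm_jet[OF assms(1) fg] Ck_norm_jet[OF assms(1) gh] sum.distrib)
qed

lemma Ck_norm_minus_commute:
  assumes "L > 0" "Ck_on L m f" "Ck_on L m g"
  shows "Ck_norm L m (\<lambda>s. f s - g s) = Ck_norm L m (\<lambda>s. g s - f s)"
  by (simp add: Ck_norm_jet[OF assms(1) jet_diff[OF assms(2,3)[THEN Ck_on_jet]]] abs_minus_commute
     Ck_norm_jet[OF assms(1) jet_diff[OF assms(3,2)[THEN Ck_on_jet]]])

text \<open>The reverse triangle inequality makes the norm continuous in time, hence bounded on a
  compact time interval. This covers the times before the decay estimates start.\<close>

lemma C0_Ck_bounded:
  assumes "L > 0" "C0_Ck L m f" "Ck_on L m g"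
  shows "\<exists>B. \<forall>t\<in>{0..T}. Ck_norm L m (\<lambda>s. f t s - g s) \<le> B"
proof -
  define N where "N = (\<lambda>t. Ck_norm L m (\<lambda>s. f t s - g s))"
  have ck: "Ck_on L m (f t)" if "t \<ge> 0" for t using that assms(2) by (auto simp: C0_Ck_def)
  have "continuous_on {0..} N"
    unfolding continuous_on_def
  proof
    fix t\<^sub>0 :: real assume t0: "t\<^sub>0 \<in> {0..}"
    have d: "((\<lambda>t. Ck_norm L m (\<lambda>s. f t s - f t\<^sub>0 s)) \<longlongrightarrow> 0) (at t\<^sub>0 within {0..})"
      using assms(2) t0 by (auto simp: C0_Ck_def)
    have "((\<lambda>t. N t - N t\<^sub>0) \<longlongrightarrow> 0) (at t\<^sub>0 within {0..})"
    proof (rule Lim_null_comparison[OF _ d])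
      show "\<forall>\<^sub>F t in at t\<^sub>0 within {0..}. norm (N t - N t\<^sub>0) \<le> Ck_norm L m (\<lambda>s. f t s - f t\<^sub>0 s)"
        unfolding eventually_at_filter
      proof (intro always_eventually allI impI)
        fix t :: real assume t: "t \<in> {0..}"
        have "N t \<le> Ck_norm L m (\<lambda>s. f t s - f t\<^sub>0 s) + N t\<^sub>0"
          unfolding N_def using assms t t0 ck by (intro Ck_norm_triangle) auto
        moreover have "N t\<^sub>0 \<le> Ck_norm L m (\<lambda>s. f t\<^sub>0 s - f t s) + N t"
          unfolding N_def using assms t t0 ck by (intro Ck_norm_triangle) auto
        moreover have "Ck_norm L m (\<lambda>s. f t\<^sub>0 s - f t s) = Ck_norm L m (\<lambda>s. f t s - f t\<^sub>0 s)"
          using assms t t0 ck by (intro Ck_norm_minus_commute) auto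
        ultimately show "norm (N t - N t\<^sub>0) \<le> Ck_norm L m (\<lambda>s. f t s - f t\<^sub>0 s)" by auto
      qed
    qed
    then show "(N \<longlongrightarrow> N t\<^sub>0) (at t\<^sub>0 within {0..})" by (simp add: LIM_zero_iff)
  qed
  then have "continuous_on {0..T} N" by (rule continuous_on_subset) auto
  then obtain B where "\<forall>t\<in>{0..T}. \<bar>N t\<bar> \<le> B"
    using bdd_above_abs_continuous_Icc[of 0 T N] unfolding bdd_above_def by auto
  then show ?thesis unfolding N_def by (meson abs_le_D1)
qed

section \<open>Integral inequalities in L2 on an interval\<close>

definition l2 :: "real \<Rightarrow> real \<Rightarrow> (real \<Rightarrow> real) \<Rightarrow> real" where
  "l2 a b f = sqrt (integral {a..b} (\<lambda>s. (f s)\<^sup>2))"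

text \<open>A non-integrable square makes \<open>integral\<close> take its default value 0, which is
  still nonnegative.\<close>

lemma l2_nonneg: "l2 a b f \<ge> 0"
  unfolding l2_def
  by (cases "(\<lambda>s. (f s)\<^sup>2) integrable_on {a..b}")
     (auto intro: integral_nonneg simp: not_integrable_integral)

lemma l2_power2: "(l2 a b f)\<^sup>2 = integral {a..b} (\<lambda>s. (f s)\<^sup>2)"
proof -
  have "integral {a..b} (\<lambda>s. (f s)\<^sup>2) \<ge> 0"
    by (cases "(\<lambda>s. (f s)\<^sup>2) integrable_on {a..b}")
       (auto intro: integral_nonneg simp: not_integrable_integral)
  then show ?thesis by (simp add: l2_def)
qed

text \<open>Cauchy-Schwarz from the discriminant: the integral of
  \<open>(x * f s + y * g s)\<^sup>2\<close> is a nonnegative quadratic form in \<open>x\<close> and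
  \<open>y\<close>.\<close>

lemma abs_integral_mult_le_l2:
  assumes [continuous_intros]: "continuous_on {a..b} f" "continuous_on {a..b} g"
  shows "\<bar>integral {a..b} (\<lambda>s. f s * g s)\<bar> \<le> l2 a b f * l2 a b g"
proof -
  define A B C where "A = integral {a..b} (\<lambda>s. (f s)\<^sup>2)"
    and "B = integral {a..b} (\<lambda>s. f s * g s)" and "C = integral {a..b} (\<lambda>s. (g s)\<^sup>2)"
  have q: "0 \<le> x\<^sup>2 * A + 2 * x * y * B + y\<^sup>2 * C" for x y
  proof -
    have i: "(\<lambda>s. (f s)\<^sup>2) integrable_on {a..b}" "(\<lambda>s. f s * g s) integrable_on {a..b}"
      "(\<lambda>s. (g s)\<^sup>2) integrable_on {a..b}"
      by (intro integrable_continuous_interval continuous_intros)+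
    have "0 \<le> integral {a..b} (\<lambda>s. (x * f s + y * g s)\<^sup>2)"
      by (intro integral_nonneg integrable_continuous_interval continuous_intros) auto
    also have "(\<lambda>s. (x * f s + y * g s)\<^sup>2) = (\<lambda>s. x\<^sup>2 * (f s)\<^sup>2 + 2 * x * y * (f s * g s) + y\<^sup>2 * (g s)\<^sup>2)"
      by (simp add: power2_eq_square algebra_simps)
    also have "integral {a..b} \<dots> = x\<^sup>2 * A + 2 * x * y * B + y\<^sup>2 * C"
      unfolding A_def B_def C_def
      by (intro integral_unique has_integral_add has_integral_mult_right integrable_integral i)
    finally show ?thesis .
  qed
  have "B\<^sup>2 \<le> A * C"
  proof (cases "A = 0")
    case True
    have "B = 0"
    proof (rule ccontr)
      assume "B \<noteq> 0"
      \<comment> \<open>With \<open>A = 0\<close> and \<open>y = 1\<close> the form is affine in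
        \<open>x\<close>; at this \<open>x\<close> it equals -1.\<close>
      then show False using q[of "- (C + 1) / (2 * B)" 1] True by (simp add: field_simps)
    qed
    then show ?thesis using True by simp
  next
    case False
    then have "A > 0" using q[of 1 0] by simp
    \<comment> \<open>The value of the form at \<open>x = -B\<close>, \<open>y = A\<close>.\<close>
    then have "0 \<le> A * (A * C - B\<^sup>2)"
      using q[of "-B" A] by (simp add: power2_eq_square algebra_simps)
    with \<open>A > 0\<close> show ?thesis by (simp add: zero_le_mult_iff)
  qed
  then have "sqrt (B\<^sup>2) \<le> sqrt (A * C)" by (rule real_sqrt_le_mono)
  then show ?thesis by (simp add: real_sqrt_mult l2_def A_def B_def C_def)
qed

text \<open>The boundary term is \<open>f b * g b - f a * g a\<close>, so it is the product that has
  to agree at the ends; in the energy estimate one factor is the flux.\<close>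

lemma integral_by_parts_periodic:
  fixes f g f' g' :: "real \<Rightarrow> real"
  assumes "a \<le> b"
    and f: "\<And>s. s \<in> {a..b} \<Longrightarrow> (f has_real_derivative f' s) (at s within {a..b})"
    and g: "\<And>s. s \<in> {a..b} \<Longrightarrow> (g has_real_derivative g' s) (at s within {a..b})"
    and c: "continuous_on {a..b} f'" "continuous_on {a..b} g'"
    and per: "f b * g b = f a * g a"
  shows "integral {a..b} (\<lambda>s. f s * g' s) = - integral {a..b} (\<lambda>s. f' s * g s)"
proof -
  have cf: "continuous_on {a..b} f" "continuous_on {a..b} g"
    using f g by (blast intro: DERIV_continuous_on)+
  have "((\<lambda>s. f' s * g s + f s * g' s) has_integral f b * g b - f a * g a) {a..b}"
    using assms(1) f g by (intro fundamental_theorem_of_calculus)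
      (auto simp: has_real_derivative_iff_has_vector_derivative[symmetric] mult.commute add.commute intro!: DERIV_mult')
  then have "integral {a..b} (\<lambda>s. f' s * g s + f s * g' s) = 0"
    using per by (simp add: integral_unique)
  moreover have "integral {a..b} (\<lambda>s. f' s * g s + f s * g' s)
      = integral {a..b} (\<lambda>s. f' s * g s) + integral {a..b} (\<lambda>s. f s * g' s)"
    using c cf by (intro integral_add integrable_continuous_interval continuous_intros)
  ultimately show ?thesis by linarith
qed

text \<open>Integration by parts turns the integral of the square of \<open>f'\<close> into minus
  that of \<open>f * f''\<close>; Cauchy-Schwarz does the rest.\<close>

lemma l2_derivative_interpolation:
  fixes f f' f'' :: "real \<Rightarrow> real"
  assumes "a \<le> b"
    and "\<And>s. s \<in> {a..b} \<Longrightarrow> (f has_real_derivative f' s) (at s within {a..b})"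
    and "\<And>s. s \<in> {a..b} \<Longrightarrow> (f' has_real_derivative f'' s) (at s within {a..b})"
    and "continuous_on {a..b} f''" "f b = f a" "f' b = f' a"
  shows "(l2 a b f')\<^sup>2 \<le> l2 a b f * l2 a b f''"
proof -
  have c: "continuous_on {a..b} f" "continuous_on {a..b} f'"
    using assms by (blast intro: DERIV_continuous_on)+
  have "integral {a..b} (\<lambda>s. f s * f'' s) = - integral {a..b} (\<lambda>s. f' s * f' s)"
    using assms c by (intro integral_by_parts_periodic) auto
  then show ?thesis
    using abs_integral_mult_le_l2[OF c(1) assms(4)] unfolding l2_power2 by (simp add: power2_eq_square)
qed

text \<open>A one-dimensional Agmon inequality: a mean-zero function has a zero \<open>z\<close>,
  and \<open>(g s)\<^sup>2\<close> is the integral of \<open>2 * g * g'\<close> from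
  \<open>z\<close> to \<open>s\<close>, which Cauchy-Schwarz bounds.\<close>

lemma power2_le_l2_mult:
  fixes g g' :: "real \<Rightarrow> real"
  assumes ab: "a < b"
    and g: "\<And>s. s \<in> {a..b} \<Longrightarrow> (g has_real_derivative g' s) (at s within {a..b})"
    and c: "continuous_on {a..b} g'" and mean: "integral {a..b} g = 0"
    and s: "s \<in> {a..b}"
  shows "(g s)\<^sup>2 \<le> 2 * l2 a b g * l2 a b g'"
proof -
  have cg: "continuous_on {a..b} g" using g by (blast intro: DERIV_continuous_on)+
  \<comment> \<open>The mean value theorem for the primitive of \<open>g\<close>, which takes the
    value 0 at both ends, produces the zero.\<close>
  have "\<exists>z\<in>{a<..<b}. integral {a..b} g - integral {a..a} g = g z * (b - a)"
    using ab integral_has_real_derivative[OF cg]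
    by (intro mvt_simple[of a b "\<lambda>x. integral {a..x} g" "\<lambda>z y. g z * y"]) (auto simp: has_field_derivative_def)
  then obtain z where "z \<in> {a<..<b}" "g z = 0" using ab mean by auto
  then have z: "z \<in> {a..b}" "g z = 0" by auto
  define h where "h = (\<lambda>s. 2 * \<bar>g s\<bar> * \<bar>g' s\<bar>)"
  have hc: "continuous_on {a..b} h" unfolding h_def by (intro continuous_intros cg c)
  \<comment> \<open>The bound is by the integral over the whole interval, so that \<open>z\<close>
    may lie on either side of \<open>s\<close>.\<close>
  have key: "\<bar>(g y)\<^sup>2 - (g x)\<^sup>2\<bar> \<le> integral {a..b} h" if "x \<in> {a..b}" "y \<in> {a..b}" "x \<le> y" for x y
  proof -
    have sub: "{x..y} \<subseteq> {a..b}" using that by auto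
    have "((\<lambda>s. 2 * g s * g' s) has_integral (g y)\<^sup>2 - (g x)\<^sup>2) {x..y}"
    proof (intro fundamental_theorem_of_calculus that(3))
      fix s assume s: "s \<in> {x..y}"
      then have "(g has_real_derivative g' s) (at s within {x..y})"
        using sub by (intro DERIV_subset[OF g]) auto
      then show "((\<lambda>s. (g s)\<^sup>2) has_vector_derivative 2 * g s * g' s) (at s within {x..y})"
        unfolding has_real_derivative_iff_has_vector_derivative[symmetric]
        by (auto intro!: derivative_eq_intros)
    qed
    then have "(g y)\<^sup>2 - (g x)\<^sup>2 = integral {x..y} (\<lambda>s. 2 * g s * g' s)" by (simp add: integral_unique)
    also have "\<bar>\<dots>\<bar> \<le> integral {x..y} h"
      unfolding real_norm_def[symmetric]
      using continuous_on_subset[OF cg sub] continuous_on_subset[OF c sub] continuous_on_subset[OF hc sub]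
      by (intro integral_norm_bound_integral integrable_continuous_interval continuous_intros)
         (auto simp: h_def abs_mult)
    also have "\<dots> \<le> integral {a..b} h"
      using sub hc continuous_on_subset[OF hc sub]
      by (intro integral_subset_le integrable_continuous_interval) (auto simp: h_def)
    finally show ?thesis .
  qed
  have "(g s)\<^sup>2 \<le> integral {a..b} h"
    using key[of z s] key[of s z] z s by (cases "z \<le> s") auto
  also have "\<dots> = 2 * integral {a..b} (\<lambda>s. \<bar>g s\<bar> * \<bar>g' s\<bar>)"
    by (simp add: h_def mult.assoc)
  also have "\<dots> \<le> 2 * (l2 a b (\<lambda>s. \<bar>g s\<bar>) * l2 a b (\<lambda>s. \<bar>g' s\<bar>))"
    using abs_integral_mult_le_l2[OF cg[THEN continuous_on_rabs] c[THEN continuous_on_rabs]] by simp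
  finally show ?thesis by (simp add: l2_def)
qed

text \<open>Integrating the pointwise bound gives \<open>2 * (b - a)\<close> times the product of
  both norms, and one factor \<open>l2 a b g\<close> cancels. The constant is not sharp, which only
  affects the decay rate.\<close>

lemma Poincare_l2:
  fixes g g' :: "real \<Rightarrow> real"
  assumes ab: "a < b"
    and g: "\<And>s. s \<in> {a..b} \<Longrightarrow> (g has_real_derivative g' s) (at s within {a..b})"
    and c: "continuous_on {a..b} g'" and mean: "integral {a..b} g = 0"
  shows "l2 a b g \<le> 2 * (b - a) * l2 a b g'"
proof -
  have cg: "continuous_on {a..b} g" using g by (blast intro: DERIV_continuous_on)+
  have "(l2 a b g)\<^sup>2 \<le> integral {a..b} (\<lambda>s. 2 * l2 a b g * l2 a b g')"
    unfolding l2_power2 using power2_le_l2_mult[OF assms] cg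
    by (intro integral_le integrable_continuous_interval continuous_intros) auto
  then have *: "l2 a b g * l2 a b g \<le> l2 a b g * (2 * (b - a) * l2 a b g')"
    using ab by (simp add: power2_eq_square algebra_simps)
  show ?thesis
  proof (cases "l2 a b g = 0")
    case True then show ?thesis using ab l2_nonneg[of a b g'] by simp
  next
    case False
    then have "l2 a b g > 0" using l2_nonneg[of a b g] by simp
    then show ?thesis using * by simp
  qed
qed

section \<open>Exponential decay for diffusion equations\<close>

text \<open>Constant and rate are existential, so that the rate may change in sums, products and
  square roots without bookkeeping.\<close>

definition exp_decay :: "real \<Rightarrow> (real \<Rightarrow> real) \<Rightarrow> bool" where
  "exp_decay T f \<longleftrightarrow> (\<exists>C\<ge>0. \<exists>\<delta>>0. \<forall>t\<ge>T. \<bar>f t\<bar> \<le> C * exp (- \<delta> * t))"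

lemma exp_decay_mono:
  assumes "exp_decay T g" "\<And>t. t \<ge> T \<Longrightarrow> \<bar>f t\<bar> \<le> g t"
  shows "exp_decay T f"
  using assms unfolding exp_decay_def by (meson abs_ge_self order_trans)

lemma exp_decay_zero: "exp_decay T (\<lambda>t. 0)"
  unfolding exp_decay_def by (rule exI[of _ 0], simp, rule exI[of _ 1], simp)

lemma exp_decay_cmult: "exp_decay T f \<Longrightarrow> exp_decay T (\<lambda>t. c * f t)"
proof -
  assume "exp_decay T f"
  then obtain C \<delta> where C: "C \<ge> 0" "\<delta> > 0" "\<And>t. t \<ge> T \<Longrightarrow> \<bar>f t\<bar> \<le> C * exp (- \<delta> * t)"
    unfolding exp_decay_def by blast
  have "\<bar>c * f t\<bar> \<le> (\<bar>c\<bar> * C) * exp (- \<delta> * t)" if "t \<ge> T" for t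
    using mult_left_mono[OF C(3)[OF that], of "\<bar>c\<bar>"] by (simp add: abs_mult mult.assoc)
  moreover have "0 \<le> \<bar>c\<bar> * C" using C(1) by simp
  ultimately show ?thesis unfolding exp_decay_def using C(2) by blast
qed

lemma exp_decay_mult:
  assumes "exp_decay T f" "exp_decay T g"
  shows "exp_decay T (\<lambda>t. f t * g t)"
proof -
  obtain C \<delta> where C: "C \<ge> 0" "\<delta> > 0" "\<And>t. t \<ge> T \<Longrightarrow> \<bar>f t\<bar> \<le> C * exp (- \<delta> * t)"
    using assms(1) unfolding exp_decay_def by blast
  obtain D \<epsilon> where D: "D \<ge> 0" "\<epsilon> > 0" "\<And>t. t \<ge> T \<Longrightarrow> \<bar>g t\<bar> \<le> D * exp (- \<epsilon> * t)"
    using assms(2) unfolding exp_decay_def by blast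
  have "\<bar>f t * g t\<bar> \<le> (C * D) * exp (- (\<delta> + \<epsilon>) * t)" if "t \<ge> T" for t
  proof -
    have "\<bar>f t * g t\<bar> \<le> (C * exp (- \<delta> * t)) * (D * exp (- \<epsilon> * t))"
      unfolding abs_mult using C D that by (intro mult_mono) auto
    also have "\<dots> = (C * D) * exp (- (\<delta> + \<epsilon>) * t)"
      by (simp add: exp_add[symmetric] algebra_simps)
    finally show ?thesis .
  qed
  moreover have "C * D \<ge> 0" "\<delta> + \<epsilon> > 0" using C D by auto
  ultimately show ?thesis unfolding exp_decay_def by blast
qed

lemma exp_decay_sqrt:
  assumes "exp_decay T f"
  shows "exp_decay T (\<lambda>t. sqrt (f t))"
proof -
  obtain C \<delta> where C: "C \<ge> 0" "\<delta> > 0" "\<And>t. t \<ge> T \<Longrightarrow> \<bar>f t\<bar> \<le> C * exp (- \<delta> * t)"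
    using assms unfolding exp_decay_def by blast
  have "\<bar>sqrt (f t)\<bar> \<le> sqrt C * exp (- (\<delta> / 2) * t)" if "t \<ge> T" for t
  proof -
    \<comment> \<open>Real \<open>sqrt\<close> is an odd function, so a negative \<open>f t\<close>
      is harmless.\<close>
    have "\<bar>sqrt (f t)\<bar> = sqrt \<bar>f t\<bar>" by (cases "f t \<ge> 0") (auto simp: abs_if real_sqrt_minus)
    also have "\<dots> \<le> sqrt (C * exp (- \<delta> * t))" using C(3)[OF that] by simp
    also have "exp (- \<delta> * t) = (exp (- (\<delta> / 2) * t))\<^sup>2"
      by (simp add: power2_eq_square exp_add[symmetric])
    finally show ?thesis by (simp add: real_sqrt_mult)
  qed
  moreover have "sqrt C \<ge> 0" "\<delta> / 2 > 0" using C by auto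
  ultimately show ?thesis unfolding exp_decay_def by blast
qed

text \<open>The slower of the two rates serves for both. Comparing the exponentials needs
  \<open>t \<ge> 0\<close>, whence \<open>T \<ge> 0\<close>.\<close>

lemma exp_decay_add:
  assumes "exp_decay T f" "exp_decay T g" "T \<ge> 0"
  shows "exp_decay T (\<lambda>t. f t + g t)"
proof -
  obtain C \<delta> where C: "C \<ge> 0" "\<delta> > 0" "\<And>t. t \<ge> T \<Longrightarrow> \<bar>f t\<bar> \<le> C * exp (- \<delta> * t)"
    using assms(1) unfolding exp_decay_def by blast
  obtain D \<epsilon> where D: "D \<ge> 0" "\<epsilon> > 0" "\<And>t. t \<ge> T \<Longrightarrow> \<bar>g t\<bar> \<le> D * exp (- \<epsilon> * t)"
    using assms(2) unfolding exp_decay_def by blast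
  define \<eta> where "\<eta> = min \<delta> \<epsilon>"
  have "\<bar>f t + g t\<bar> \<le> (C + D) * exp (- \<eta> * t)" if t: "t \<ge> T" for t
  proof -
    have "exp (- \<delta> * t) \<le> exp (- \<eta> * t)" "exp (- \<epsilon> * t) \<le> exp (- \<eta> * t)"
      using t assms(3) by (auto simp: \<eta>_def intro!: mult_right_mono)
    then have "C * exp (- \<delta> * t) \<le> C * exp (- \<eta> * t)" "D * exp (- \<epsilon> * t) \<le> D * exp (- \<eta> * t)"
      using C D by (auto intro!: mult_left_mono)
    then show ?thesis using C(3)[OF t] D(3)[OF t] by (simp add: distrib_right)
  qed
  moreover have "C + D \<ge> 0" "\<eta> > 0" using C D by (auto simp: \<eta>_def)
  ultimately show ?thesis unfolding exp_decay_def by blast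
qed

text \<open>Multiplying by the integrating factor \<open>exp (a * t)\<close> leaves a forcing of
  order \<open>exp ((a - \<eta>) * t)\<close>; subtracting a primitive of this majorant gives the
  nonincreasing function \<open>z\<close>.\<close>

lemma Gronwall_exp_decay:
  assumes "T \<ge> 0" "a > 0"
    and y: "\<And>t. t \<ge> T \<Longrightarrow> (y has_real_derivative y' t) (at t)"
    and le: "\<And>t. t \<ge> T \<Longrightarrow> y' t \<le> - a * y t + g t"
    and g: "exp_decay T g" and nonneg: "\<And>t. t \<ge> T \<Longrightarrow> y t \<ge> 0"
  shows "exp_decay T y"
proof -
  obtain C \<delta> where C: "C \<ge> 0" "\<delta> > 0" "\<And>t. t \<ge> T \<Longrightarrow> \<bar>g t\<bar> \<le> C * exp (- \<delta> * t)"
    using g unfolding exp_decay_def by blast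
  \<comment> \<open>The rate stays strictly below \<open>a\<close>, so that division by
    \<open>a - \<eta>\<close> is possible and no resonance term \<open>t * exp (- a * t)\<close>
    arises when the forcing decays at rate \<open>a\<close>.\<close>
  define \<eta> where "\<eta> = min \<delta> (a / 2)"
  have eta: "\<eta> > 0" "\<eta> \<le> \<delta>" "a - \<eta> > 0" using C assms(2) by (auto simp: \<eta>_def)
  define K where "K = C / (a - \<eta>)"
  have K: "K \<ge> 0" "K * (a - \<eta>) = C" using C eta by (auto simp: K_def)
  define z where "z = (\<lambda>t. exp (a * t) * y t - K * exp ((a - \<eta>) * t))"
  define z' where "z' = (\<lambda>t. a * exp (a * t) * y t + exp (a * t) * y' t - C * exp ((a - \<eta>) * t))"
  have dz: "(z has_real_derivative z' t) (at t)" if "t \<ge> T" for t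
    unfolding z_def z'_def K(2)[symmetric] using y[OF that] by (auto intro!: derivative_eq_intros)
  have z'_le: "z' t \<le> 0" if t: "t \<ge> T" for t
  proof -
    have "g t \<le> C * exp (- \<eta> * t)"
    proof -
      have "exp (- \<delta> * t) \<le> exp (- \<eta> * t)" using t assms(1) eta by (auto intro!: mult_right_mono)
      then show ?thesis using C(1) C(3)[OF t] mult_left_mono[of "exp (- \<delta> * t)" "exp (- \<eta> * t)" C] by linarith
    qed
    then have "a * y t + y' t \<le> C * exp (- \<eta> * t)" using le[OF t] by linarith
    then have "exp (a * t) * (a * y t + y' t) \<le> exp (a * t) * (C * exp (- \<eta> * t))" by simp
    also have "\<dots> = C * exp ((a - \<eta>) * t)" by (simp add: exp_add[symmetric] algebra_simps)
    finally show ?thesis by (simp add: z'_def algebra_simps)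
  qed
  have "\<bar>y t\<bar> \<le> (\<bar>z T\<bar> + K) * exp (- \<eta> * t)" if t: "t \<ge> T" for t
  proof -
    have "z t \<le> z T"
      using t dz z'_le by (intro DERIV_nonpos_imp_nonincreasing[of T t z]) auto
    then have "exp (a * t) * y t \<le> \<bar>z T\<bar> + K * exp ((a - \<eta>) * t)" by (simp add: z_def)
    then have "exp (- a * t) * (exp (a * t) * y t) \<le> exp (- a * t) * (\<bar>z T\<bar> + K * exp ((a - \<eta>) * t))" by simp
    also have "exp (- a * t) * (exp (a * t) * y t) = y t"
      by (simp add: mult.assoc[symmetric] exp_add[symmetric])
    also have "exp (- a * t) * (\<bar>z T\<bar> + K * exp ((a - \<eta>) * t)) = \<bar>z T\<bar> * exp (- a * t) + K * exp (- \<eta> * t)"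
      by (simp add: exp_add[symmetric] algebra_simps)
    also have "\<dots> \<le> \<bar>z T\<bar> * exp (- \<eta> * t) + K * exp (- \<eta> * t)"
      using eta t assms(1) by (intro add_right_mono mult_left_mono) (auto intro!: mult_right_mono)
    finally show ?thesis using nonneg[OF t] by (simp add: algebra_simps)
  qed
  moreover have "\<bar>z T\<bar> + K \<ge> 0" using K by simp
  ultimately show ?thesis unfolding exp_decay_def using eta(1) by blast
qed

section \<open>Energy estimate and interpolation for diffusion equations\<close>

lemma has_real_derivative_integral_Icc:
  fixes f g :: "real \<Rightarrow> real \<Rightarrow> real"
  assumes f: "\<And>t s. t > 0 \<Longrightarrow> s \<in> {a..b} \<Longrightarrow> ((\<lambda>\<tau>. f \<tau> s) has_real_derivative g t s) (at t)"
    and cf: "\<And>t. t > 0 \<Longrightarrow> continuous_on {a..b} (f t)"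
    and cg: "continuous_on ({0<..} \<times> {a..b}) (\<lambda>(t, s). g t s)"
    and t: "t > 0"
  shows "((\<lambda>\<tau>. integral {a..b} (f \<tau>)) has_real_derivative integral {a..b} (g t)) (at t)"
proof -
  have "((\<lambda>\<tau>. integral (cbox a b) (f \<tau>)) has_real_derivative integral (cbox a b) (g t)) (at t within {0<..})"
    using t f cf cg
    by (intro leibniz_rule_field_derivative)
       (auto intro!: integrable_continuous_interval intro: has_field_derivative_at_within)
  then show ?thesis using t by (simp add: at_within_open[of t "{0<..}"])
qed

lemma continuous_on_slice:
  assumes "continuous_on (A \<times> B) (\<lambda>(t, s). f t s)" "t \<in> A"
  shows "continuous_on B (f t)"
proof -
  have "continuous_on B (\<lambda>s. (t, s))" by (intro continuous_intros)
  then show ?thesis using continuous_on_compose2[OF assms(1)] assms(2) by fastforce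
qed

text \<open>Energy method: the time derivative of the squared norm is at most \<open>- 2 * b\<close>
  times the squared norm of \<open>ux\<close>, plus \<open>g\<close>, and the Poincare inequality
  closes the estimate. Coefficient \<open>k\<close> and source \<open>h\<close> are general to serve
  both the angle (\<open>k\<close> is \<beta>(\<rho>), \<open>h\<close> is 0) and the density
  (\<open>k\<close> is \<mu>). The source enters through its pairing with the mean-zero
  \<open>u\<close>, where a part constant in space drops out.\<close>

lemma diffusion_exp_decay:
  fixes u ux k qx h :: "real \<Rightarrow> real \<Rightarrow> real"
  assumes "L > 0" "T > 0" "b > 0"
    and ut: "\<And>t s. t > 0 \<Longrightarrow> s \<in> {0..L} \<Longrightarrow> ((\<lambda>\<tau>. u \<tau> s) has_real_derivative qx t s + h t s) (at t)"
    and cu: "continuous_on ({0<..} \<times> {0..L}) (\<lambda>(t, s). u t s)"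
    and cut: "continuous_on ({0<..} \<times> {0..L}) (\<lambda>(t, s). qx t s + h t s)"
    and ux: "\<And>t s. t > 0 \<Longrightarrow> s \<in> {0..L} \<Longrightarrow> (u t has_real_derivative ux t s) (at s within {0..L})"
    and qx: "\<And>t s. t > 0 \<Longrightarrow> s \<in> {0..L} \<Longrightarrow>
      ((\<lambda>s. k t s * ux t s) has_real_derivative qx t s) (at s within {0..L})"
    and c: "\<And>t. t > 0 \<Longrightarrow> continuous_on {0..L} (ux t)" "\<And>t. t > 0 \<Longrightarrow> continuous_on {0..L} (qx t)"
      "\<And>t. t > 0 \<Longrightarrow> continuous_on {0..L} (k t)" "\<And>t. t > 0 \<Longrightarrow> continuous_on {0..L} (h t)"
    and per: "\<And>t. t > 0 \<Longrightarrow> u t L * (k t L * ux t L) = u t 0 * (k t 0 * ux t 0)"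
    and k: "\<And>t s. t \<ge> T \<Longrightarrow> s \<in> {0..L} \<Longrightarrow> k t s \<ge> b"
    and mean: "\<And>t. t > 0 \<Longrightarrow> integral {0..L} (u t) = 0"
    and h: "\<And>t. t \<ge> T \<Longrightarrow> 2 * integral {0..L} (\<lambda>s. u t s * h t s) \<le> g t"
    and g: "exp_decay T g"
  shows "exp_decay T (\<lambda>t. l2 0 L (u t))"
proof -
  define y where "y = (\<lambda>t. integral {0..L} (\<lambda>s. (u t s)\<^sup>2))"
  define y' where "y' = (\<lambda>t. integral {0..L} (\<lambda>s. 2 * u t s * (qx t s + h t s)))"
  have cu': "continuous_on {0..L} (u t)" if "t > 0" for t
    using that by (intro continuous_on_slice[OF cu]) auto
  have y: "(y has_real_derivative y' t) (at t)" if "t \<ge> T" for t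
    unfolding y_def y'_def
  proof (rule has_real_derivative_integral_Icc)
    show "continuous_on ({0<..} \<times> {0..L}) (\<lambda>(t, s). 2 * u t s * (qx t s + h t s))"
      using cu cut by (auto simp: split_beta intro!: continuous_intros)
  qed (use that assms(2) ut cu' in \<open>auto intro!: derivative_eq_intros continuous_intros\<close>)
  \<comment> \<open>The rate is \<open>2 * b / (2 * L)\<^sup>2\<close>, from the Poincare constant
    \<open>2 * L\<close>.\<close>
  have "y' t \<le> - (b / (2 * L\<^sup>2)) * y t + g t" if tT: "t \<ge> T" for t
  proof -
    have t: "t > 0" using tT assms(2) by simp
    note [continuous_intros] = c[OF t] cu'[OF t]
    have "y' t = integral {0..L} (\<lambda>s. 2 * (u t s * qx t s) + 2 * (u t s * h t s))"
      by (simp add: y'_def algebra_simps)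
    also have "\<dots> = integral {0..L} (\<lambda>s. 2 * (u t s * qx t s)) + integral {0..L} (\<lambda>s. 2 * (u t s * h t s))"
      by (intro integral_add integrable_continuous_interval continuous_intros)
    also have "\<dots> = 2 * integral {0..L} (\<lambda>s. u t s * qx t s) + 2 * integral {0..L} (\<lambda>s. u t s * h t s)"
      by simp
    also have "integral {0..L} (\<lambda>s. u t s * qx t s) = - integral {0..L} (\<lambda>s. ux t s * (k t s * ux t s))"
      using assms(1) ux qx t c per by (intro integral_by_parts_periodic) auto
    also have "2 * integral {0..L} (\<lambda>s. u t s * h t s) \<le> g t" by (rule h[OF tT])
    finally have 1: "y' t \<le> - 2 * integral {0..L} (\<lambda>s. ux t s * (k t s * ux t s)) + g t" by simp
    have 2: "b * (l2 0 L (ux t))\<^sup>2 \<le> integral {0..L} (\<lambda>s. ux t s * (k t s * ux t s))"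
    proof -
      have "integral {0..L} (\<lambda>s. b * (ux t s)\<^sup>2) \<le> integral {0..L} (\<lambda>s. ux t s * (k t s * ux t s))"
      proof (intro integral_le integrable_continuous_interval continuous_intros)
        fix s assume "s \<in> {0..L}"
        then have "b * (ux t s)\<^sup>2 \<le> k t s * (ux t s)\<^sup>2" using k[OF tT] by (intro mult_right_mono) auto
        then show "b * (ux t s)\<^sup>2 \<le> ux t s * (k t s * ux t s)" by (simp add: power2_eq_square algebra_simps)
      qed
      then show ?thesis by (simp add: l2_power2)
    qed
    have "l2 0 L (u t) \<le> 2 * (L - 0) * l2 0 L (ux t)"
      using assms(1) ux c mean t by (intro Poincare_l2) auto
    then have "(l2 0 L (u t))\<^sup>2 \<le> (2 * L * l2 0 L (ux t))\<^sup>2"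
      using l2_nonneg by (intro power_mono) auto
    then have "b / (2 * L\<^sup>2) * y t \<le> b / (2 * L\<^sup>2) * (4 * L\<^sup>2 * (l2 0 L (ux t))\<^sup>2)"
      unfolding y_def l2_power2[symmetric] using assms(1,3)
      by (intro mult_left_mono) (auto simp: power2_eq_square algebra_simps)
    also have "\<dots> = 2 * (b * (l2 0 L (ux t))\<^sup>2)" using assms(1) by (simp add: field_simps)
    finally show ?thesis using 1 2 by linarith
  qed
  moreover have "y t \<ge> 0" for t unfolding y_def l2_power2[symmetric] by simp
  ultimately have "exp_decay T y"
    using assms(1-3) y g by (intro Gronwall_exp_decay[of T "b / (2 * L\<^sup>2)" y y' g]) auto
  then show ?thesis using exp_decay_sqrt unfolding l2_def y_def by blast
qed

text \<open>Decay climbs by log-convexity: the squared norm of order j + 1 is at most the product of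
  the norms of orders j and j + 2, and the latter is bounded by \<open>M\<close>. Three derivatives
  are the price of supremum bounds up to order 2, because the supremum at order j is controlled by
  the L2 norms of orders j and j + 1.\<close>

lemma interpolated_exp_decay:
  fixes f :: "nat \<Rightarrow> real \<Rightarrow> real \<Rightarrow> real"
  assumes "L > 0"
    and d: "\<And>t j s. t \<ge> T \<Longrightarrow> j < 3 \<Longrightarrow> s \<in> {0..L} \<Longrightarrow>
      (f j t has_real_derivative f (Suc j) t s) (at s within {0..L})"
    and c: "\<And>t. t \<ge> T \<Longrightarrow> continuous_on {0..L} (f 3 t)"
    and per: "\<And>t j. t \<ge> T \<Longrightarrow> j < 3 \<Longrightarrow> f j t L = f j t 0"
    and mean: "\<And>t. t \<ge> T \<Longrightarrow> integral {0..L} (f 0 t) = 0"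
    and M: "\<And>t. t \<ge> T \<Longrightarrow> l2 0 L (f 2 t) \<le> M" "\<And>t. t \<ge> T \<Longrightarrow> l2 0 L (f 3 t) \<le> M"
    and decay: "exp_decay T (\<lambda>t. l2 0 L (f 0 t))"
  shows "exp_decay T (\<lambda>t. l2 0 L (f 1 t))"
    and "\<And>j. j \<le> 2 \<Longrightarrow> \<exists>g. exp_decay T g \<and> (\<forall>t\<ge>T. \<forall>s\<in>{0..L}. \<bar>f j t s\<bar> \<le> g t)"
proof -
  define a where "a = (\<lambda>j t. l2 0 L (f j t))"
  have a0: "a j t \<ge> 0" for j t by (simp add: a_def l2_nonneg)
  have cont: "continuous_on {0..L} (f j t)" if "t \<ge> T" "j \<le> 3" for j t
  proof (cases "j = 3")
    case False
    then show ?thesis using d[OF that(1), of j] that(2)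
      by (intro DERIV_continuous_on[of _ _ "f (Suc j) t"]) auto
  qed (use c that in simp)
  have interp: "(a (Suc j) t)\<^sup>2 \<le> a j t * a (Suc (Suc j)) t" if "t \<ge> T" "j < 2" for j t
    unfolding a_def using assms(1) d cont per that by (intro l2_derivative_interpolation) auto
  have M': "a 2 t \<le> M" "a 3 t \<le> M" if "t \<ge> T" for t using M that by (auto simp: a_def)
  have d0: "exp_decay T (a 0)" using decay by (simp add: a_def)
  have d1: "exp_decay T (a 1)"
  proof (rule exp_decay_mono[OF exp_decay_sqrt[OF exp_decay_cmult[OF d0, of M]]])
    fix t assume t: "t \<ge> T"
    have "(a 1 t)\<^sup>2 \<le> M * a 0 t"
      using interp[OF t, of 0] mult_left_mono[OF M'(1)[OF t] a0[of 0 t]] by (simp add: mult.commute numeral_2_eq_2)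
    then show "\<bar>a 1 t\<bar> \<le> sqrt (M * a 0 t)" using a0 by (simp add: real_le_rsqrt)
  qed
  then show "exp_decay T (\<lambda>t. l2 0 L (f 1 t))" by (simp add: a_def)
  have d2: "exp_decay T (a 2)"
  proof (rule exp_decay_mono[OF exp_decay_sqrt[OF exp_decay_cmult[OF d1, of M]]])
    fix t assume t: "t \<ge> T"
    have "(a 2 t)\<^sup>2 \<le> M * a 1 t"
      using interp[OF t, of 1] mult_left_mono[OF M'(2)[OF t] a0[of 1 t]]
      by (simp add: mult.commute numeral_2_eq_2 numeral_3_eq_3)
    then show "\<bar>a 2 t\<bar> \<le> sqrt (M * a 1 t)" using a0 by (simp add: real_le_rsqrt)
  qed
  fix j :: nat assume j: "j \<le> 2"
  \<comment> \<open>At order 2 the next norm, of order 3, is merely bounded; orders 0 and 1 have a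
    neighbour that decays as well.\<close>
  define B where "B = (\<lambda>t. if j = 2 then M else a (Suc j) t)"
  have "exp_decay T (\<lambda>t. a j t * B t)"
  proof (cases "j = 2")
    case True
    then show ?thesis using exp_decay_cmult[OF d2, of M] by (simp add: B_def mult.commute)
  next
    case False
    then have "j = 0 \<or> j = 1" using j by auto
    then show ?thesis using d0 d1 d2 by (auto simp: B_def numeral_2_eq_2 intro!: exp_decay_mult)
  qed
  then have "exp_decay T (\<lambda>t. sqrt (2 * (a j t * B t)))" by (intro exp_decay_sqrt exp_decay_cmult)
  moreover have "\<bar>f j t s\<bar> \<le> sqrt (2 * (a j t * B t))" if t: "t \<ge> T" and s: "s \<in> {0..L}" for t s
  proof -
    \<comment> \<open>Each derivative has mean zero because the function below it takes equal values
      at the ends; so the pointwise inequality applies at every order.\<close>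
    have "integral {0..L} (f j t) = 0"
    proof (cases j)
      case (Suc i)
      have "(f j t has_integral f i t L - f i t 0) {0..L}"
        using assms(1) d[OF t, of i] Suc j
        by (intro fundamental_theorem_of_calculus)
           (auto simp: has_real_derivative_iff_has_vector_derivative[symmetric])
      then show ?thesis using per[OF t, of i] Suc j by (simp add: integral_unique)
    qed (use mean t in simp)
    then have "(f j t s)\<^sup>2 \<le> 2 * a j t * a (Suc j) t"
      unfolding a_def using assms(1) d[OF t, of j] cont[OF t] j s by (intro power2_le_l2_mult) auto
    also have "\<dots> \<le> 2 * a j t * B t"
      using M'(2)[OF t] a0 j by (intro mult_left_mono) (auto simp: B_def numeral_3_eq_3 numeral_2_eq_2)
    finally show ?thesis by (simp add: real_le_rsqrt mult.assoc)
  qed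
  ultimately show "\<exists>g. exp_decay T g \<and> (\<forall>t\<ge>T. \<forall>s\<in>{0..L}. \<bar>f j t s\<bar> \<le> g t)" by blast
qed

section \<open>Space-time smoothness and periodicity\<close>

text \<open>The body of \<open>Cinf_spacetime\<close> with the family of partial derivatives as an
  argument, so that one family can be fixed and calculated with.\<close>

definition spacetime_jet :: "real \<Rightarrow> (real \<Rightarrow> real \<Rightarrow> real) \<Rightarrow> (nat \<Rightarrow> nat \<Rightarrow> real \<Rightarrow> real \<Rightarrow> real) \<Rightarrow> bool" where
  "spacetime_jet L f D \<longleftrightarrow>
     (\<forall>t>0. \<forall>s\<in>{0..L}. D 0 0 t s = f t s) \<and>
     (\<forall>i j. \<forall>t>0. \<forall>s\<in>{0..L}.
        ((\<lambda>\<tau>. D i j \<tau> s) has_real_derivative D (Suc i) j t s) (at t) \<and>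
        ((\<lambda>\<sigma>. D i j t \<sigma>) has_real_derivative D i (Suc j) t s) (at s within {0..L})) \<and>
     (\<forall>i j. continuous_on ({0<..} \<times> {0..L}) (\<lambda>(t, s). D i j t s))"

lemma Cinf_spacetime_iff: "Cinf_spacetime L f \<longleftrightarrow> (\<exists>D. spacetime_jet L f D)"
  by (simp add: Cinf_spacetime_def spacetime_jet_def)

text \<open>\<open>D 0 0\<close> is tied to \<open>f\<close> at positive times; these form an open
  set, so the time derivatives agree there.\<close>

lemma spacetime_jet_time_derivative:
  assumes "spacetime_jet L f D" "t > 0" "s \<in> {0..L}"
  shows "((\<lambda>\<tau>. f \<tau> s) has_real_derivative D 1 0 t s) (at t)"
proof -
  have "((\<lambda>\<tau>. D 0 0 \<tau> s) has_real_derivative D 1 0 t s) (at t)"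
    using assms by (simp add: spacetime_jet_def)
  then show ?thesis
    by (rule has_field_derivative_transform_within_open[of _ _ _ "{0<..}"]) (use assms in \<open>auto simp: spacetime_jet_def\<close>)
qed

lemma spacetime_jet_jet:
  assumes "spacetime_jet L f D" "t > 0"
  shows "jet L m (f t) (\<lambda>j. D 0 j t)"
proof -
  have "continuous_on {0..L} (D 0 j t)" for j
    using assms by (intro continuous_on_slice[of "{0<..}" _ "D 0 j"]) (simp_all add: spacetime_jet_def)
  then show ?thesis using assms unfolding jet_def spacetime_jet_def by simp
qed

lemma Ds_pow_cong:
  assumes "\<And>x. x \<in> {0..L} \<Longrightarrow> f x = g x" "s \<in> {0..L}"
  shows "(Ds L ^^ j) f s = (Ds L ^^ j) g s"
  using assms(2)
proof (induction j arbitrary: s)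
  case (Suc j)
  then show ?case by (auto intro!: Ds_cong)
qed (use assms in simp)

section \<open>Matching of all derivatives at the two ends\<close>

lemma deriv_periodic:
  fixes g :: "real \<Rightarrow> real"
  assumes "\<And>s. g (s + L) = g s"
  shows "deriv g (s + L) = deriv g s"
proof -
  have "(g has_real_derivative d) (at (s + L)) \<longleftrightarrow> (g has_real_derivative d) (at s)" for d
    using DERIV_shift[of g d s L] assms by simp
  then show ?thesis by (simp add: deriv_def)
qed

lemma deriv_funpow_periodic:
  fixes g :: "real \<Rightarrow> real"
  assumes "\<And>s. g (s + L) = g s"
  shows "(deriv ^^ j) g (s + L) = (deriv ^^ j) g s"
  by (induction j arbitrary: s) (auto simp: assms deriv_periodic)

lemma Cinf_real_deriv_funpow:
  assumes "Cinf_real g"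
  shows "((deriv ^^ j) g has_real_derivative (deriv ^^ Suc j) g x) (at x)"
  using assms by (simp add: Cinf_real_def field_differentiable_derivI)

text \<open>On the line all derivatives of the extension are periodic, and on the interval they
  coincide with \<open>F j\<close> by uniqueness of one-sided derivatives. Comparing at 0 and
  \<open>L\<close> gives the claim.\<close>

lemma extends_smooth_periodic_derivatives:
  assumes L: "L > 0" and g: "extends_smooth_periodic L (F 0)"
    and F: "\<And>j s. s \<in> {0..L} \<Longrightarrow> (F j has_real_derivative F (Suc j) s) (at s within {0..L})"
  shows "F j L = F j 0"
proof -
  obtain g where g: "Cinf_real g" "\<And>s. g (s + L) = g s" "\<And>s. s \<in> {0..L} \<Longrightarrow> g s = F 0 s"
    using assms(2) unfolding extends_smooth_periodic_def by auto
  have eq: "(deriv ^^ j) g s = F j s" if "s \<in> {0..L}" for j s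
    using that
  proof (induction j arbitrary: s)
    case (Suc j)
    have "(deriv ^^ Suc j) g s = Ds L ((deriv ^^ j) g) s"
      using L Suc.prems Cinf_real_deriv_funpow[OF g(1)]
      by (intro Ds_eqI[symmetric]) (auto intro: has_field_derivative_at_within)
    also have "\<dots> = Ds L (F j) s" using Suc by (intro Ds_cong) auto
    also have "\<dots> = F (Suc j) s" using L Suc.prems F by (intro Ds_eqI) auto
    finally show ?case .
  qed (use g in simp)
  show ?thesis
    using deriv_funpow_periodic[of g L j 0] g(2) eq[of 0 j] eq[of L j] L by simp
qed

text \<open>The derivative of the extension extends the derivative. This brings the density into the
  form that \<open>spacetime_jet_periodic\<close> asks for.\<close>

lemma extends_smooth_periodic_derivative:
  assumes L: "L > 0" and g: "extends_smooth_periodic L f"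
    and f: "\<And>s. s \<in> {0..L} \<Longrightarrow> (f has_real_derivative f' s) (at s within {0..L})"
  shows "extends_smooth_periodic L f'"
proof -
  obtain g where g: "Cinf_real g" "\<And>s. g (s + L) = g s" "\<And>s. s \<in> {0..L} \<Longrightarrow> g s = f s"
    using assms(2) unfolding extends_smooth_periodic_def by auto
  have "Cinf_real (deriv g)"
    unfolding Cinf_real_def
  proof (intro allI)
    fix m x
    have "(deriv ^^ Suc m) g field_differentiable at x" using g(1) unfolding Cinf_real_def by blast
    then show "(deriv ^^ m) (deriv g) field_differentiable at x" by (simp add: funpow_swap1)
  qed
  moreover have "deriv g s = f' s" if "s \<in> {0..L}" for s
  proof -
    have "deriv g s = Ds L g s"
      using L that Cinf_real_deriv_funpow[OF g(1), of 0]
      by (intro Ds_eqI[symmetric]) (auto intro: has_field_derivative_at_within)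
    also have "\<dots> = Ds L f s" using that g by (intro Ds_cong) auto
    also have "\<dots> = f' s" using L that f by (intro Ds_eqI) auto
    finally show ?thesis .
  qed
  ultimately show ?thesis
    unfolding extends_smooth_periodic_def using deriv_periodic[of g L, OF g(2)] by blast
qed

text \<open>Periodicity is assumed of the spatial derivative because the angle itself jumps by a
  multiple of 2 pi. Spatial orders come from the extension; time orders follow by differentiating
  the matching identity in t, which removes the constant jump \<open>c\<close>.\<close>

lemma spacetime_jet_periodic:
  assumes L: "L > 0" and D: "spacetime_jet L f D"
    and jump: "\<And>t. t > 0 \<Longrightarrow> f t L = f t 0 + c"
    and per: "\<And>t. t > 0 \<Longrightarrow> extends_smooth_periodic L (Ds L (f t))"
    and t: "t > 0"
  shows "D i j t L = D i j t 0 + (if i = 0 \<and> j = 0 then c else 0)"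
proof -
  have zero: "D 0 j t L = D 0 j t 0 + (if j = 0 then c else 0)" if t: "t > 0" for t
  proof (cases j)
    case 0
    then show ?thesis using jump[OF t] D L t by (simp add: spacetime_jet_def)
  next
    case (Suc i)
    have "Ds L (f t) s = D 0 1 t s" if "s \<in> {0..L}" for s
      using jet_Ds[OF L spacetime_jet_jet[OF D t, of 1], of 1 s] that by simp
    then have "extends_smooth_periodic L (D 0 (Suc 0) t)"
      using per[OF t] unfolding extends_smooth_periodic_def by simp
    then have "D 0 (Suc i) t L = D 0 (Suc i) t 0"
      using D t by (intro extends_smooth_periodic_derivatives[OF L, of "\<lambda>j. D 0 (Suc j) t"])
        (auto simp: spacetime_jet_def)
    then show ?thesis using Suc by simp
  qed
  show ?thesis
    using t
  proof (induction i arbitrary: t)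
    case 0
    then show ?case using zero by simp
  next
    case (Suc i)
    have "((\<lambda>\<tau>. D i j \<tau> L - D i j \<tau> 0) has_real_derivative D (Suc i) j t L - D (Suc i) j t 0) (at t)"
      using D L Suc.prems by (intro DERIV_diff) (auto simp: spacetime_jet_def)
    then have "((\<lambda>\<tau>. if i = 0 \<and> j = 0 then c else 0) has_real_derivative D (Suc i) j t L - D (Suc i) j t 0) (at t)"
      by (rule has_field_derivative_transform_within_open[of _ _ _ "{0<..}"]) (use Suc in auto)
    moreover have "((\<lambda>\<tau>. if i = 0 \<and> j = 0 then c else 0) has_real_derivative 0) (at t)" by simp
    ultimately show ?case using DERIV_unique by fastforce
  qed
qed

section \<open>Cyclic shifts\<close>

text \<open>The cyclic shift of the interval by \<open>a\<close>. Adding different constants on the two branches makes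
  the shift of a function with a jump of \<open>q - p\<close> between the end points a continuous function.\<close>

definition cshift :: "real \<Rightarrow> real \<Rightarrow> real \<Rightarrow> real \<Rightarrow> (real \<Rightarrow> real) \<Rightarrow> real \<Rightarrow> real" where
  "cshift L a p q f s = (if s + a \<le> L then f (s + a) + p else f (s + a - L) + q)"

text \<open>At the seam \<open>s + a = L\<close> the point read is \<open>L\<close>, not 0, in
  agreement with the first branch of \<open>cshift\<close>; so \<open>cshift_00\<close> is exact
  there too.\<close>

definition cpoint :: "real \<Rightarrow> real \<Rightarrow> real \<Rightarrow> real" where
  "cpoint L a s = (if s + a \<le> L then s + a else s + a - L)"

lemma cpoint_in: "\<lbrakk>0 < a; a < L; s \<in> {0..L}\<rbrakk> \<Longrightarrow> cpoint L a s \<in> {0..L}"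
  by (auto simp: cpoint_def)

lemma cshift_00: "cshift L a 0 0 f s = f (cpoint L a s)"
  by (simp add: cshift_def cpoint_def)

text \<open>Both branches are translates of \<open>f\<close>, and they join differentiably because
  values (with the constants) and derivatives match at the seam. The constants vanish in the
  derivative.\<close>

lemma DERIV_cshift:
  assumes a: "0 < a" "a < L"
    and f: "\<And>s. s \<in> {0..L} \<Longrightarrow> (f has_real_derivative f' s) (at s within {0..L})"
    and m: "f L + p = f 0 + q" "f' L = f' 0" and s: "s \<in> {0..L}"
  shows "(cshift L a p q f has_real_derivative cshift L a 0 0 f' s) (at s within {0..L})"
proof -
  have left: "((\<lambda>s. f (s + a) + p) has_real_derivative f' (s + a)) (at s within {0..L - a})"
    if "s \<in> {0..L - a}" for s
  proof -
    have "(f has_real_derivative f' (s + a)) (at (s + a) within (\<lambda>s. s + a) ` {0..L - a})"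
      by (rule DERIV_subset[OF f]) (use a that in auto)
    moreover have "((\<lambda>s. s + a) has_real_derivative 1) (at s within {0..L - a})"
      by (auto intro!: derivative_eq_intros)
    ultimately show ?thesis
      using DERIV_image_chain[of f _ "\<lambda>s. s + a" s "{0..L - a}" 1]
      by (auto simp: o_def intro!: derivative_eq_intros)
  qed
  have right: "((\<lambda>s. f (s + a - L) + q) has_real_derivative f' (s + a - L)) (at s within {L - a..L})"
    if "s \<in> {L - a..L}" for s
  proof -
    have "(f has_real_derivative f' (s + a - L)) (at (s + a - L) within (\<lambda>s. s + a - L) ` {L - a..L})"
      by (rule DERIV_subset[OF f]) (use a that in auto)
    moreover have "((\<lambda>s. s + a - L) has_real_derivative 1) (at s within {L - a..L})"
      by (auto intro!: derivative_eq_intros)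
    ultimately show ?thesis
      using DERIV_image_chain[of f _ "\<lambda>s. s + a - L" s "{L - a..L}" 1]
      by (auto simp: o_def intro!: derivative_eq_intros)
  qed
  \<comment> \<open>The gluing rule asks for compatibility where the closures of the two pieces
    meet, which is the single point \<open>L - a\<close>.\<close>
  have cl: "closure {0..L - a} = {0..L - a}" "closure {L - a<..L} = {L - a..L}"
    using a by auto
  have un: "{0..L - a} \<union> ({0..L - a} \<inter> {L - a..L}) = {0..L - a}"
    "{L - a<..L} \<union> ({0..L - a} \<inter> {L - a..L}) = {L - a..L}" "{0..L - a} \<union> {L - a<..L} = {0..L}"
    using a by auto
  have "((\<lambda>s. if s \<in> {0..L - a} then f (s + a) + p else f (s + a - L) + q) has_derivative
      (if s \<in> {0..L - a} then (\<lambda>s y. f' (s + a) * y) s else (\<lambda>s y. f' (s + a - L) * y) s))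
      (at s within {0..L - a} \<union> {L - a<..L})"
    by (rule has_derivative_If_within_closures; unfold cl un;
        use left right m s a in \<open>auto simp: has_field_derivative_def\<close>)
  then have "((\<lambda>s. if s \<in> {0..L - a} then f (s + a) + p else f (s + a - L) + q)
      has_real_derivative cshift L a 0 0 f' s) (at s within {0..L})"
    using s a unfolding has_field_derivative_def un(3) cshift_def
    by (cases "s + a \<le> L") (simp_all add: le_diff_eq mult_commute_abs)
  then show ?thesis
    by (rule DERIV_transform_Icc[OF s, rotated]) (auto simp: cshift_def)
qed

lemma continuous_on_cshift_joint:
  assumes a: "0 < a" "a < L"
    and f: "continuous_on (A \<times> {0..L}) (\<lambda>(t, s). f t s)"
    and m: "\<And>t. t \<in> A \<Longrightarrow> f t L + p = f t 0 + q"
  shows "continuous_on (A \<times> {0..L}) (\<lambda>(t, s). cshift L a p q (f t) s)"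
proof -
  have "continuous_on (A \<times> {0..L})
    (\<lambda>x. if snd x + a \<le> L then f (fst x) (snd x + a) + p else f (fst x) (snd x + a - L) + q)"
  proof (rule continuous_on_cases_le)
    show "continuous_on {x \<in> A \<times> {0..L}. snd x + a \<le> L} (\<lambda>x. f (fst x) (snd x + a) + p)"
      using a by (intro continuous_intros continuous_on_compose2[OF f, where f = "\<lambda>x. (fst x, snd x + a)", simplified]) auto
    show "continuous_on {x \<in> A \<times> {0..L}. L \<le> snd x + a} (\<lambda>x. f (fst x) (snd x + a - L) + q)"
      using a by (intro continuous_intros continuous_on_compose2[OF f, where f = "\<lambda>x. (fst x, snd x + a - L)", simplified]) auto
  qed (use m in \<open>auto intro!: continuous_intros\<close>)
  then show ?thesis by (simp add: cshift_def split_beta)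
qed

lemma continuous_on_cshift:
  assumes a: "0 < a" "a < L" and f: "continuous_on {0..L} f" and m: "f L + p = f 0 + q"
  shows "continuous_on {0..L} (cshift L a p q f)"
proof -
  have "continuous_on ({0::real} \<times> {0..L}) (\<lambda>(t, s). f s)"
    unfolding split_beta by (rule continuous_on_compose2[OF f]) (auto intro!: continuous_intros)
  from continuous_on_slice[OF continuous_on_cshift_joint[OF a this m], of 0] show ?thesis by simp
qed

text \<open>Cutting at \<open>L - a\<close> and translating the two pieces gives the integrals over
  \<open>{a..L}\<close> and \<open>{0..a}\<close>.\<close>

lemma integral_cshift:
  fixes f :: "real \<Rightarrow> real"
  assumes a: "0 < a" "a < L" and f: "continuous_on {0..L} f" and m: "f L = f 0"
  shows "integral {0..L} (\<lambda>s. f (cpoint L a s)) = integral {0..L} f"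
proof -
  have c: "continuous_on {0..L} (\<lambda>s. f (cpoint L a s))"
    using continuous_on_cshift[OF a(1) a(2) f, where p = 0 and q = 0] m by (simp add: cshift_00)
  have 1: "integral {0..L - a} (f \<circ> (\<lambda>x. x + a)) = integral {0 + a..L - a + a} f"
    using f a by (intro integral_shift continuous_on_subset[OF f]) auto
  have 2: "integral {L - a..L} (f \<circ> (\<lambda>x. x + (a - L))) = integral {L - a + (a - L)..L + (a - L)} f"
    using f a by (intro integral_shift continuous_on_subset[OF f]) auto
  have "integral {0..L} (\<lambda>s. f (cpoint L a s))
      = integral {0..L - a} (\<lambda>s. f (cpoint L a s)) + integral {L - a..L} (\<lambda>s. f (cpoint L a s))"
    using a c by (intro Henstock_Kurzweil_Integration.integral_combine[symmetric] integrable_continuous_interval) auto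
  also have "integral {0..L - a} (\<lambda>s. f (cpoint L a s)) = integral {0..L - a} (f \<circ> (\<lambda>x. x + a))"
    by (intro Henstock_Kurzweil_Integration.integral_cong) (auto simp: cpoint_def)
  also have "\<dots> = integral {a..L} f" using 1 by simp
  also have "integral {L - a..L} (\<lambda>s. f (cpoint L a s)) = integral {L - a..L} (f \<circ> (\<lambda>x. x + (a - L)))"
  proof (rule Henstock_Kurzweil_Integration.integral_cong)
    fix s assume "s \<in> {L - a..L}"
    \<comment> \<open>At \<open>s = L - a\<close> the left side reads \<open>f L\<close> and the
      right side \<open>f 0\<close>.\<close>
    then show "f (cpoint L a s) = (f \<circ> (\<lambda>x. x + (a - L))) s"
      using m by (cases "s + a = L") (auto simp: cpoint_def add_diff_eq)
  qed
  also have "\<dots> = integral {0..a} f" using 2 by simp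
  also have "integral {a..L} f + integral {0..a} f = integral {0..L} f"
    using a f Henstock_Kurzweil_Integration.integral_combine[of 0 a L f] by (simp add: integrable_continuous_interval)
  finally show ?thesis .
qed

text \<open>The constants belong to order 0 only; from order 1 on the ends must match without a
  jump. The case distinction in the family reflects this.\<close>

lemma jet_cshift:
  assumes a: "0 < a" "a < L" and F: "jet L m f F" and m: "F 0 L + p = F 0 0 + q"
    and per: "\<And>j. 1 \<le> j \<Longrightarrow> j \<le> m \<Longrightarrow> F j L = F j 0"
  shows "jet L m (cshift L a p q f) (\<lambda>j. if j = 0 then cshift L a p q (F 0) else cshift L a 0 0 (F j))"
  unfolding jet_def
proof (intro conjI ballI allI impI)
  fix s assume "s \<in> {0..L}"
  then show "(if (0::nat) = 0 then cshift L a p q (F 0) else cshift L a 0 0 (F 0)) s = cshift L a p q f s"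
    using F a by (auto simp: jet_def cshift_def)
next
  fix j s assume "j < m" "s \<in> {0..L}"
  then have "((if j = 0 then cshift L a p q (F j) else cshift L a 0 0 (F j)) has_real_derivative cshift L a 0 0 (F (Suc j)) s) (at s within {0..L})"
    using F per[of j] per[of "Suc j"] m by (auto simp: jet_def intro!: DERIV_cshift[OF a])
  then show "((if j = 0 then cshift L a p q (F 0) else cshift L a 0 0 (F j)) has_real_derivative
     (if Suc j = 0 then cshift L a p q (F 0) else cshift L a 0 0 (F (Suc j))) s) (at s within {0..L})"
    by (simp cong: if_cong split: if_splits)
next
  fix j assume "j \<le> m"
  then show "continuous_on {0..L} (if j = 0 then cshift L a p q (F 0) else cshift L a 0 0 (F j))"
    using F per[of j] m by (auto simp: jet_def intro!: continuous_on_cshift[OF a])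
qed

lemma Cinf_spacetime_cshift:
  assumes a: "0 < a" "a < L" and D: "spacetime_jet L f D"
    and per: "\<And>i j t. t > 0 \<Longrightarrow> D i j t L = D i j t 0 + (if i = 0 \<and> j = 0 then q - p else 0)"
  shows "Cinf_spacetime L (\<lambda>t. cshift L a p q (f t))"
proof -
  define P Q where "P = (\<lambda>(i :: nat) (j :: nat). if i = 0 \<and> j = 0 then p else 0 :: real)"
    and "Q = (\<lambda>(i :: nat) (j :: nat). if i = 0 \<and> j = 0 then q else 0 :: real)"
  have m: "D i j t L + P i j = D i j t 0 + Q i j" if "t > 0" for i j t
    using per[OF that, of i j] by (auto simp: P_def Q_def)
  have "spacetime_jet L (\<lambda>t. cshift L a p q (f t)) (\<lambda>i j t. cshift L a (P i j) (Q i j) (D i j t))"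
    unfolding spacetime_jet_def
  proof (intro conjI allI impI ballI)
    fix t s :: real assume "t > 0" "s \<in> {0..L}"
    then show "cshift L a (P 0 0) (Q 0 0) (D 0 0 t) s = cshift L a p q (f t) s"
      using D a by (auto simp: P_def Q_def cshift_def spacetime_jet_def)
  next
    fix i j :: nat and t s :: real assume ts: "t > 0" "s \<in> {0..L}"
    have z: "P (Suc i) j = 0" "Q (Suc i) j = 0" "P i (Suc j) = 0" "Q i (Suc j) = 0"
      by (auto simp: P_def Q_def)
    show "((\<lambda>\<tau>. cshift L a (P i j) (Q i j) (D i j \<tau>) s) has_real_derivative
        cshift L a (P (Suc i) j) (Q (Suc i) j) (D (Suc i) j t) s) (at t)"
      using D a ts unfolding z by (auto simp: cshift_def spacetime_jet_def intro!: derivative_eq_intros)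
    show "(cshift L a (P i j) (Q i j) (D i j t) has_real_derivative
        cshift L a (P i (Suc j)) (Q i (Suc j)) (D i (Suc j) t) s) (at s within {0..L})"
      unfolding z using D ts m[OF ts(1)] per[OF ts(1), of i "Suc j"]
      by (intro DERIV_cshift[OF a]) (auto simp: spacetime_jet_def)
  next
    fix i j
    show "continuous_on ({0<..} \<times> {0..L}) (\<lambda>(t, s). cshift L a (P i j) (Q i j) (D i j t) s)"
      using D m by (intro continuous_on_cshift_joint[OF a]) (auto simp: spacetime_jet_def)
  qed
  then show ?thesis using Cinf_spacetime_iff by blast
qed

text \<open>Derivatives of the shift are the old derivatives read at \<open>cpoint\<close>, so no
  supremum grows.\<close>

lemma Ck_norm_cshift_le:
  assumes a: "0 < a" "a < L" and F: "jet L m f F" and per: "\<And>j. j \<le> m \<Longrightarrow> F j L = F j 0"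
  shows "Ck_norm L m (cshift L a 0 0 f) \<le> Ck_norm L m f"
proof -
  have L: "L > 0" using a by simp
  have J: "jet L m (cshift L a 0 0 f) (\<lambda>j. if j = 0 then cshift L a 0 0 (F 0) else cshift L a 0 0 (F j))"
    using per by (intro jet_cshift[OF a F]) auto
  show ?thesis
    unfolding Ck_norm_jet[OF L F]
  proof (rule Ck_norm_le[OF L J])
    fix j s assume js: "j \<le> m" "s \<in> {0..L}"
    then have "\<bar>F j (cpoint L a s)\<bar> \<le> (SUP s\<in>{0..L}. \<bar>F j s\<bar>)"
      by (intro jet_le_SUP[OF F] cpoint_in a)
    then show "\<bar>(if j = 0 then cshift L a 0 0 (F 0) else cshift L a 0 0 (F j)) s\<bar> \<le> (SUP s\<in>{0..L}. \<bar>F j s\<bar>)"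
      by (cases "j = 0") (auto simp: cshift_00)
  qed
qed

text \<open>The jump constants cancel in the difference of two times, and the plain shift of that
  difference has no larger norm. Time 0 belongs to the claim, so matching ends are assumed for all
  \<open>t \<ge> 0\<close>.\<close>

lemma C0_Ck_cshift:
  assumes a: "0 < a" "a < L" and f: "C0_Ck L m f"
    and jump: "\<And>t. t \<ge> 0 \<Longrightarrow> f t L + p = f t 0 + q"
    and per: "\<And>t j. t \<ge> 0 \<Longrightarrow> 1 \<le> j \<Longrightarrow> j \<le> m \<Longrightarrow> (Ds L ^^ j) (f t) L = (Ds L ^^ j) (f t) 0"
  shows "C0_Ck L m (\<lambda>t. cshift L a p q (f t))"
proof -
  have L: "L > 0" using a by simp
  have J: "jet L m (f t) (\<lambda>j. (Ds L ^^ j) (f t))" if "t \<ge> 0" for t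
    using f that by (auto simp: C0_Ck_def intro: Ck_on_jet)
  have ck: "Ck_on L m (cshift L a p q (f t))" if t: "t \<ge> 0" for t
    using jet_Ck_on[OF L jet_cshift[OF a J[OF t]]] jump[OF t] per[OF t] by simp
  have "((\<lambda>t. Ck_norm L m (\<lambda>s. cshift L a p q (f t) s - cshift L a p q (f t0) s)) \<longlongrightarrow> 0) (at t0 within {0..})"
    if t0: "t0 \<ge> 0" for t0
  proof (rule Lim_null_comparison)
    show "((\<lambda>t. Ck_norm L m (\<lambda>s. f t s - f t0 s)) \<longlongrightarrow> 0) (at t0 within {0..})"
      using f t0 by (auto simp: C0_Ck_def)
    show "\<forall>\<^sub>F t in at t0 within {0..}. norm (Ck_norm L m (\<lambda>s. cshift L a p q (f t) s - cshift L a p q (f t0) s))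
        \<le> Ck_norm L m (\<lambda>s. f t s - f t0 s)"
      unfolding eventually_at_filter
    proof (intro always_eventually allI impI)
      fix t :: real assume "t \<in> {0..}"
      then have t: "t \<ge> 0" by simp
      have eq: "(\<lambda>s. cshift L a p q (f t) s - cshift L a p q (f t0) s) = cshift L a 0 0 (\<lambda>s. f t s - f t0 s)"
        by (auto simp: cshift_def)
      have "(Ds L ^^ j) (f t) L - (Ds L ^^ j) (f t0) L = (Ds L ^^ j) (f t) 0 - (Ds L ^^ j) (f t0) 0" if "j \<le> m" for j
        using jump[OF t] jump[OF t0] per[OF t, of j] per[OF t0, of j] that by (cases "j = 0") auto
      then have "Ck_norm L m (cshift L a 0 0 (\<lambda>s. f t s - f t0 s)) \<le> Ck_norm L m (\<lambda>s. f t s - f t0 s)"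
        by (intro Ck_norm_cshift_le[OF a jet_diff[OF J[OF t] J[OF t0]]])
      moreover have "Ck_norm L m (\<lambda>s. cshift L a p q (f t) s - cshift L a p q (f t0) s) \<ge> 0"
        by (intro Ck_norm_nonneg[OF L] jet_Ck_on[OF L jet_diff[OF Ck_on_jet[OF ck[OF t]] Ck_on_jet[OF ck[OF t0]]]])
      ultimately show "norm (Ck_norm L m (\<lambda>s. cshift L a p q (f t) s - cshift L a p q (f t0) s))
        \<le> Ck_norm L m (\<lambda>s. f t s - f t0 s)" unfolding eq by simp
    qed
  qed
  then show ?thesis using ck by (simp add: C0_Ck_def)
qed

section \<open>Rotational equivariance of the flow\<close>

lemma lambda_theta_cong:
  assumes "\<And>s. s \<in> {0..L} \<Longrightarrow> \<theta> s = \<theta>' s" "\<And>s. s \<in> {0..L} \<Longrightarrow> \<rho> s = \<rho>' s"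
  shows "lambda_theta L c\<^sub>0 \<beta> \<theta> \<rho> = lambda_theta L c\<^sub>0 \<beta> \<theta>' \<rho>'"
proof -
  have D: "Ds L \<theta> s = Ds L \<theta>' s" if "s \<in> {0..L}" for s
    using assms that by (intro Ds_cong) auto
  \<comment> \<open>\<open>H\<close> stands for any integrand built from angle, curvature and
    density; the five integrals in the multiplier are instances.\<close>
  have c: "integral {0..L} (\<lambda>s. H (\<theta> s) (Ds L \<theta> s) (\<rho> s)) = integral {0..L} (\<lambda>s. H (\<theta>' s) (Ds L \<theta>' s) (\<rho>' s))"
    for H :: "real \<Rightarrow> real \<Rightarrow> real \<Rightarrow> real"
    by (intro Henstock_Kurzweil_Integration.integral_cong) (simp add: assms D)
  show ?thesis
    unfolding lambda_theta_def Pi_mat_def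
      c[of "\<lambda>x d r. (sin x)\<^sup>2"] c[of "\<lambda>x d r. (cos x)\<^sup>2"] c[of "\<lambda>x d r. cos x * sin x"]
      c[of "\<lambda>x d r. cos x * d * \<beta> r * (d - c\<^sub>0)"] c[of "\<lambda>x d r. sin x * d * \<beta> r * (d - c\<^sub>0)"] ..
qed

section \<open>Plane rotations\<close>

lemma matrix_inv_invertible:
  assumes "invertible A"
  shows "A ** matrix_inv A = mat 1" "matrix_inv A ** A = mat 1"
  using someI_ex[of "\<lambda>A'. A ** A' = mat 1 \<and> A' ** A = mat 1"] assms
  unfolding invertible_def matrix_inv_def by auto

text \<open>Rotation by -\<alpha>: it takes \<open>(cos x, sin x)\<close> to the same vector at
  \<open>x - \<alpha>\<close>, in line with the constant \<open>- \<alpha>\<close> in the shifted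
  angle.\<close>

definition rotation2 :: "real \<Rightarrow> real^2^2" where
  "rotation2 \<alpha> = vector [vector [cos \<alpha>, sin \<alpha>], vector [- sin \<alpha>, cos \<alpha>]]"

lemma rotation2_orthogonal:
  "transpose (rotation2 \<alpha>) ** rotation2 \<alpha> = mat 1" "rotation2 \<alpha> ** transpose (rotation2 \<alpha>) = mat 1"
  using sin_cos_squared_add[of \<alpha>] sin_cos_squared_add2[of \<alpha>]
  by (auto simp: vec_eq_iff forall_2 matrix_matrix_mult_def sum_2 transpose_def rotation2_def mat_def power2_eq_square)

lemma invertible_rotation2: "invertible (rotation2 \<alpha>)" "invertible (transpose (rotation2 \<alpha>))"
  using rotation2_orthogonal[of \<alpha>] unfolding invertible_def by blast+

text \<open>The wrapped branch of the shift carries the extra angle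
  \<open>2 * pi * \<omega>\<close>, which sine and cosine do not see since \<omega> is an
  integer.\<close>

lemma sin_jump: "sin (x + (2 * pi * of_int \<omega> - \<alpha>)) = sin (x - \<alpha>)"
  and cos_jump: "cos (x + (2 * pi * of_int \<omega> - \<alpha>)) = cos (x - \<alpha>)"
proof -
  have "x + (2 * pi * of_int \<omega> - \<alpha>) = (x - \<alpha>) + 2 * pi * of_int \<omega>" by simp
  then show "sin (x + (2 * pi * of_int \<omega> - \<alpha>)) = sin (x - \<alpha>)"
    "cos (x + (2 * pi * of_int \<omega> - \<alpha>)) = cos (x - \<alpha>)"
    using sin_int_2pin[of \<omega>] cos_int_2pin[of \<omega>] by (simp_all only: sin_add cos_add)
qed

lemma sin_cshift: "sin (cshift L a (- \<alpha>) (2 * pi * of_int \<omega> - \<alpha>) f s) = sin (f (cpoint L a s) - \<alpha>)"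
  and cos_cshift: "cos (cshift L a (- \<alpha>) (2 * pi * of_int \<omega> - \<alpha>) f s) = cos (f (cpoint L a s) - \<alpha>)"
  by (auto simp: cshift_def cpoint_def sin_jump cos_jump)

section \<open>Transformation of the matrix and the multipliers under shift and rotation\<close>

context
  fixes L a \<alpha> :: real and \<omega> :: int and \<theta> \<rho> :: "real \<Rightarrow> real" and F G :: "nat \<Rightarrow> real \<Rightarrow> real"
  assumes a: "0 < a" "a < L"
    and F: "jet L 1 \<theta> F" and G: "jet L 1 \<rho> G"
    and F0: "F 0 L = F 0 0 + 2 * pi * of_int \<omega>" and F1: "F 1 L = F 1 0" and G0: "G 0 L = G 0 0"
begin

private abbreviation "\<theta>' \<equiv> cshift L a (- \<alpha>) (2 * pi * of_int \<omega> - \<alpha>) \<theta>"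
private abbreviation "\<rho>' \<equiv> cshift L a 0 0 \<rho>"

private lemma L: "L > 0" using a by simp

private lemma cont: "continuous_on {0..L} \<theta>" "continuous_on {0..L} \<rho>" "continuous_on {0..L} (Ds L \<theta>)"
proof -
  have c: "continuous_on {0..L} ((Ds L ^^ j) \<theta>)" "continuous_on {0..L} ((Ds L ^^ j) \<rho>)" if "j \<le> 1" for j
    using jet_Ck_on[OF L F] jet_Ck_on[OF L G] that unfolding Ck_on_def by auto
  show "continuous_on {0..L} \<theta>" "continuous_on {0..L} \<rho>" "continuous_on {0..L} (Ds L \<theta>)"
    using c(1)[of 0] c(2)[of 0] c(1)[of 1] by simp_all
qed

private lemma bdry: "\<theta> L = \<theta> 0 + 2 * pi * of_int \<omega>" "\<rho> L = \<rho> 0" "Ds L \<theta> L = Ds L \<theta> 0"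
  using F0 F1 G0 L jet_Ds[OF L F, of 1] F G by (auto simp: jet_def)

private lemma sin_cos_bdry: "sin (\<theta> L) = sin (\<theta> 0)" "cos (\<theta> L) = cos (\<theta> 0)"
  using sin_jump[of "\<theta> 0" \<omega> 0] cos_jump[of "\<theta> 0" \<omega> 0] by (simp_all add: bdry)

lemma Ds_cshift: "s \<in> {0..L} \<Longrightarrow> Ds L \<theta>' s = Ds L \<theta> (cpoint L a s)"
proof -
  assume s: "s \<in> {0..L}"
  have "jet L 1 \<theta>' (\<lambda>j. if j = 0 then cshift L a (- \<alpha>) (2 * pi * of_int \<omega> - \<alpha>) (F 0) else cshift L a 0 0 (F j))"
    using F0 F1 by (intro jet_cshift[OF a F]) (auto simp: le_Suc_eq)
  from jet_Ds[OF L this, of 1 s] jet_Ds[OF L F, of 1 "cpoint L a s"] s cpoint_in[OF a s]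
  show ?thesis by (simp add: cshift_00)
qed

text \<open>\<open>Pi_mat\<close> is the integral of \<open>n n^T\<close> for the normal
  \<open>n = (sin x, - cos x)\<close> at \<open>x = \<theta> s\<close>. The normal rotates with the
  angle, so the matrix is conjugated; the proof verifies this through the three integrals
  \<open>A\<close>, \<open>B\<close>, \<open>C\<close>.\<close>

lemma Pi_mat_cshift: "Pi_mat L \<theta>' = rotation2 \<alpha> ** Pi_mat L \<theta> ** transpose (rotation2 \<alpha>)"
proof -
  define A B C where "A = integral {0..L} (\<lambda>s. (sin (\<theta> s))\<^sup>2)"
    and "B = integral {0..L} (\<lambda>s. cos (\<theta> s) * sin (\<theta> s))" and "C = integral {0..L} (\<lambda>s. (cos (\<theta> s))\<^sup>2)"
  note [continuous_intros] = cont
  have i: "((\<lambda>s. (sin (\<theta> s))\<^sup>2) has_integral A) {0..L}" "((\<lambda>s. cos (\<theta> s) * sin (\<theta> s)) has_integral B) {0..L}"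
    "((\<lambda>s. (cos (\<theta> s))\<^sup>2) has_integral C) {0..L}"
    unfolding A_def B_def C_def by (intro integrable_integral integrable_continuous_interval continuous_intros)+
  have comb: "integral {0..L} (\<lambda>s. x * (sin (\<theta> s))\<^sup>2 + y * (cos (\<theta> s) * sin (\<theta> s)) + z * (cos (\<theta> s))\<^sup>2) = x * A + y * B + z * C" for x y z
    by (intro integral_unique has_integral_add has_integral_mult_right i)
  have "integral {0..L} (\<lambda>s. (sin (\<theta>' s))\<^sup>2) = integral {0..L} (\<lambda>s. (sin (\<theta> s - \<alpha>))\<^sup>2)"
    unfolding sin_cshift by (intro integral_cshift[OF a] continuous_intros) (simp add: sin_diff sin_cos_bdry)
  also have "\<dots> = integral {0..L} (\<lambda>s. (cos \<alpha>)\<^sup>2 * (sin (\<theta> s))\<^sup>2 + (- 2 * cos \<alpha> * sin \<alpha>) * (cos (\<theta> s) * sin (\<theta> s)) + (sin \<alpha>)\<^sup>2 * (cos (\<theta> s))\<^sup>2)"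
    by (simp add: sin_diff power2_eq_square algebra_simps)
  also note comb
  finally have A': "integral {0..L} (\<lambda>s. (sin (\<theta>' s))\<^sup>2) = (cos \<alpha>)\<^sup>2 * A + (- 2 * cos \<alpha> * sin \<alpha>) * B + (sin \<alpha>)\<^sup>2 * C" .
  have "integral {0..L} (\<lambda>s. cos (\<theta>' s) * sin (\<theta>' s)) = integral {0..L} (\<lambda>s. cos (\<theta> s - \<alpha>) * sin (\<theta> s - \<alpha>))"
    unfolding sin_cshift cos_cshift
    by (intro integral_cshift[OF a, where f = "\<lambda>s. cos (\<theta> s - \<alpha>) * sin (\<theta> s - \<alpha>)"] continuous_intros) (simp add: sin_diff cos_diff sin_cos_bdry)
  also have "\<dots> = integral {0..L} (\<lambda>s. (cos \<alpha> * sin \<alpha>) * (sin (\<theta> s))\<^sup>2 + ((cos \<alpha>)\<^sup>2 - (sin \<alpha>)\<^sup>2) * (cos (\<theta> s) * sin (\<theta> s)) + (- cos \<alpha> * sin \<alpha>) * (cos (\<theta> s))\<^sup>2)"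
    by (simp add: sin_diff cos_diff power2_eq_square algebra_simps)
  also note comb
  finally have B': "integral {0..L} (\<lambda>s. cos (\<theta>' s) * sin (\<theta>' s)) = (cos \<alpha> * sin \<alpha>) * A + ((cos \<alpha>)\<^sup>2 - (sin \<alpha>)\<^sup>2) * B + (- cos \<alpha> * sin \<alpha>) * C" .
  have "integral {0..L} (\<lambda>s. (cos (\<theta>' s))\<^sup>2) = integral {0..L} (\<lambda>s. (cos (\<theta> s - \<alpha>))\<^sup>2)"
    unfolding cos_cshift by (intro integral_cshift[OF a] continuous_intros) (simp add: cos_diff sin_cos_bdry)
  also have "\<dots> = integral {0..L} (\<lambda>s. (sin \<alpha>)\<^sup>2 * (sin (\<theta> s))\<^sup>2 + (2 * cos \<alpha> * sin \<alpha>) * (cos (\<theta> s) * sin (\<theta> s)) + (cos \<alpha>)\<^sup>2 * (cos (\<theta> s))\<^sup>2)"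
    by (simp add: cos_diff power2_eq_square algebra_simps)
  also note comb
  finally have C': "integral {0..L} (\<lambda>s. (cos (\<theta>' s))\<^sup>2) = (sin \<alpha>)\<^sup>2 * A + (2 * cos \<alpha> * sin \<alpha>) * B + (cos \<alpha>)\<^sup>2 * C" .
  show ?thesis
    unfolding Pi_mat_def A' B' C' A_def[symmetric] B_def[symmetric] C_def[symmetric]
    by (simp add: vec_eq_iff forall_2 matrix_matrix_mult_def sum_2 transpose_def rotation2_def power2_eq_square algebra_simps)
qed

lemma invertible_Pi_mat_cshift: "invertible (Pi_mat L \<theta>) \<Longrightarrow> invertible (Pi_mat L \<theta>')"
  unfolding Pi_mat_cshift by (intro invertible_mult invertible_rotation2)

text \<open>The moment vector rotates with the tangent, and the rotated old multiplier solves the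
  linear system with the conjugated matrix and the rotated right-hand side; invertibility makes it
  the new multiplier.\<close>

lemma lambda_theta_cshift:
  assumes \<beta>: "continuous_on UNIV \<beta>" and inv: "invertible (Pi_mat L \<theta>)"
  shows "lambda_theta L c\<^sub>0 \<beta> \<theta>' \<rho>' = rotation2 \<alpha> *v lambda_theta L c\<^sub>0 \<beta> \<theta> \<rho>"
proof -
  \<comment> \<open>The factor common to both moments. It takes equal values at the ends, and the
    rotation acts on the trigonometric factors only.\<close>
  define g where "g = (\<lambda>s. Ds L \<theta> s * \<beta> (\<rho> s) * (Ds L \<theta> s - c\<^sub>0))"
  define I J where "I = integral {0..L} (\<lambda>s. cos (\<theta> s) * g s)" and "J = integral {0..L} (\<lambda>s. sin (\<theta> s) * g s)"
  have cb: "continuous_on {0..L} (\<lambda>s. \<beta> (\<rho> s))"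
    by (rule continuous_on_compose2[OF \<beta> cont(2)]) auto
  note [continuous_intros] = cont cb
  have gc[continuous_intros]: "continuous_on {0..L} g" unfolding g_def by (intro continuous_intros)
  have gb: "g L = g 0" by (simp add: g_def bdry)
  have i: "((\<lambda>s. cos (\<theta> s) * g s) has_integral I) {0..L}" "((\<lambda>s. sin (\<theta> s) * g s) has_integral J) {0..L}"
    unfolding I_def J_def by (intro integrable_integral integrable_continuous_interval continuous_intros)+
  have comb: "integral {0..L} (\<lambda>s. x * (cos (\<theta> s) * g s) + y * (sin (\<theta> s) * g s)) = x * I + y * J" for x y
    by (intro integral_unique has_integral_add has_integral_mult_right i)
  have g': "Ds L \<theta>' s * \<beta> (\<rho>' s) * (Ds L \<theta>' s - c\<^sub>0) = g (cpoint L a s)" if "s \<in> {0..L}" for s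
    using that by (simp add: Ds_cshift cshift_00 g_def)
  have "integral {0..L} (\<lambda>s. cos (\<theta>' s) * Ds L \<theta>' s * \<beta> (\<rho>' s) * (Ds L \<theta>' s - c\<^sub>0))
      = integral {0..L} (\<lambda>s. cos (\<theta> (cpoint L a s) - \<alpha>) * g (cpoint L a s))"
  proof (rule Henstock_Kurzweil_Integration.integral_cong)
    fix s assume "s \<in> {0..L}"
    from g'[OF this] show "cos (\<theta>' s) * Ds L \<theta>' s * \<beta> (\<rho>' s) * (Ds L \<theta>' s - c\<^sub>0)
        = cos (\<theta> (cpoint L a s) - \<alpha>) * g (cpoint L a s)"
      unfolding cos_cshift by (simp add: mult.assoc)
  qed
  also have "\<dots> = integral {0..L} (\<lambda>s. cos (\<theta> s - \<alpha>) * g s)"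
    by (intro integral_cshift[OF a, where f = "\<lambda>s. cos (\<theta> s - \<alpha>) * g s"] continuous_intros) (simp add: gb cos_diff sin_cos_bdry)
  also have "\<dots> = integral {0..L} (\<lambda>s. cos \<alpha> * (cos (\<theta> s) * g s) + sin \<alpha> * (sin (\<theta> s) * g s))"
    by (simp add: cos_diff algebra_simps)
  also note comb
  finally have I': "integral {0..L} (\<lambda>s. cos (\<theta>' s) * Ds L \<theta>' s * \<beta> (\<rho>' s) * (Ds L \<theta>' s - c\<^sub>0)) = cos \<alpha> * I + sin \<alpha> * J" .
  have "integral {0..L} (\<lambda>s. sin (\<theta>' s) * Ds L \<theta>' s * \<beta> (\<rho>' s) * (Ds L \<theta>' s - c\<^sub>0))
      = integral {0..L} (\<lambda>s. sin (\<theta> (cpoint L a s) - \<alpha>) * g (cpoint L a s))"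
  proof (rule Henstock_Kurzweil_Integration.integral_cong)
    fix s assume "s \<in> {0..L}"
    from g'[OF this] show "sin (\<theta>' s) * Ds L \<theta>' s * \<beta> (\<rho>' s) * (Ds L \<theta>' s - c\<^sub>0)
        = sin (\<theta> (cpoint L a s) - \<alpha>) * g (cpoint L a s)"
      unfolding sin_cshift by (simp add: mult.assoc)
  qed
  also have "\<dots> = integral {0..L} (\<lambda>s. sin (\<theta> s - \<alpha>) * g s)"
    by (intro integral_cshift[OF a, where f = "\<lambda>s. sin (\<theta> s - \<alpha>) * g s"] continuous_intros) (simp add: gb sin_diff sin_cos_bdry)
  also have "\<dots> = integral {0..L} (\<lambda>s. (- sin \<alpha>) * (cos (\<theta> s) * g s) + cos \<alpha> * (sin (\<theta> s) * g s))"
    by (simp add: sin_diff algebra_simps)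
  also note comb
  finally have J': "integral {0..L} (\<lambda>s. sin (\<theta>' s) * Ds L \<theta>' s * \<beta> (\<rho>' s) * (Ds L \<theta>' s - c\<^sub>0)) = (- sin \<alpha>) * I + cos \<alpha> * J" .
  define v where "v = (vector [I, J] :: real^2)"
  have v': "vector [cos \<alpha> * I + sin \<alpha> * J, (- sin \<alpha>) * I + cos \<alpha> * J] = rotation2 \<alpha> *v v"
    by (simp add: vec_eq_iff forall_2 matrix_vector_mult_def sum_2 rotation2_def v_def)
  define P where "P = Pi_mat L \<theta>"
  have lam: "lambda_theta L c\<^sub>0 \<beta> \<theta> \<rho> = matrix_inv P *v v"
    by (simp add: lambda_theta_def P_def v_def I_def J_def g_def mult.assoc)
  have inv': "invertible (rotation2 \<alpha> ** P ** transpose (rotation2 \<alpha>))"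
    using invertible_Pi_mat_cshift[OF inv] by (simp add: Pi_mat_cshift P_def)
  have "(rotation2 \<alpha> ** P ** transpose (rotation2 \<alpha>)) ** (rotation2 \<alpha> ** matrix_inv P)
      = rotation2 \<alpha> ** P ** (transpose (rotation2 \<alpha>) ** rotation2 \<alpha>) ** matrix_inv P"
    by (simp add: matrix_mul_assoc)
  also have "\<dots> = rotation2 \<alpha> ** (P ** matrix_inv P)"
    by (simp add: rotation2_orthogonal matrix_mul_assoc)
  also have "\<dots> = rotation2 \<alpha>" using inv by (simp add: P_def matrix_inv_invertible)
  finally have "(rotation2 \<alpha> ** P ** transpose (rotation2 \<alpha>)) *v (rotation2 \<alpha> *v (matrix_inv P *v v)) = rotation2 \<alpha> *v v"
    by (simp add: matrix_vector_mul_assoc)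
  then have "matrix_inv (rotation2 \<alpha> ** P ** transpose (rotation2 \<alpha>)) *v (rotation2 \<alpha> *v v) = rotation2 \<alpha> *v (matrix_inv P *v v)"
    using matrix_inv_invertible(2)[OF inv'] by (metis matrix_vector_mul_assoc matrix_vector_mul_lid)
  then show ?thesis
    unfolding lam lambda_theta_def[of L c\<^sub>0 \<beta> \<theta>' \<rho>'] I' J' v' Pi_mat_cshift P_def .
qed

text \<open>Only curvature and density enter the integrand, and neither sees the rotation.\<close>

lemma lambda_rho_cshift:
  assumes \<beta>: "continuous_on UNIV (deriv \<beta>)"
  shows "lambda_rho L c\<^sub>0 \<beta> \<theta>' \<rho>' = lambda_rho L c\<^sub>0 \<beta> \<theta> \<rho>"
proof -
  have cb: "continuous_on {0..L} (\<lambda>s. deriv \<beta> (\<rho> s))"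
    by (rule continuous_on_compose2[OF \<beta> cont(2)]) auto
  note [continuous_intros] = cont cb
  have "integral {0..L} (\<lambda>s. deriv \<beta> (\<rho>' s) * (Ds L \<theta>' s - c\<^sub>0)\<^sup>2)
      = integral {0..L} (\<lambda>s. deriv \<beta> (\<rho> (cpoint L a s)) * (Ds L \<theta> (cpoint L a s) - c\<^sub>0)\<^sup>2)"
    by (intro Henstock_Kurzweil_Integration.integral_cong) (simp add: Ds_cshift cshift_00)
  also have "\<dots> = integral {0..L} (\<lambda>s. deriv \<beta> (\<rho> s) * (Ds L \<theta> s - c\<^sub>0)\<^sup>2)"
    by (intro integral_cshift[OF a, where f = "\<lambda>s. deriv \<beta> (\<rho> s) * (Ds L \<theta> s - c\<^sub>0)\<^sup>2"] continuous_intros) (simp add: bdry)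
  finally show ?thesis by (simp add: lambda_rho_def)
qed

end

section \<open>Invariance of the flow equations\<close>

lemma Cinf_real_DERIV:
  assumes "Cinf_real \<beta>"
  shows "(\<beta> has_real_derivative deriv \<beta> x) (at x)" "continuous_on UNIV \<beta>" "continuous_on UNIV (deriv \<beta>)"
proof -
  show "(\<beta> has_real_derivative deriv \<beta> x) (at x)" for x
    using Cinf_real_deriv_funpow[OF assms, of 0] by simp
  then show "continuous_on UNIV \<beta>" by (intro DERIV_continuous_on)
  show "continuous_on UNIV (deriv \<beta>)"
    using Cinf_real_deriv_funpow[OF assms, of 1] by (intro DERIV_continuous_on) simp
qed

lemma Ds_flux:
  assumes L: "L > 0" and \<beta>: "Cinf_real \<beta>" and F: "jet L 2 \<theta> F" and G: "jet L 1 \<rho> G" and s: "s \<in> {0..L}"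
  shows "Ds L (\<lambda>\<sigma>. \<beta> (\<rho> \<sigma>) * (Ds L \<theta> \<sigma> - c\<^sub>0)) s
    = deriv \<beta> (G 0 s) * G 1 s * (F 1 s - c\<^sub>0) + \<beta> (G 0 s) * F 2 s"
proof -
  have "Ds L \<theta> \<sigma> = F 1 \<sigma>" if "\<sigma> \<in> {0..L}" for \<sigma>
    using jet_Ds[OF L F, of 1 \<sigma>] that by simp
  then have "Ds L (\<lambda>\<sigma>. \<beta> (\<rho> \<sigma>) * (Ds L \<theta> \<sigma> - c\<^sub>0)) s = Ds L (\<lambda>\<sigma>. \<beta> (G 0 \<sigma>) * (F 1 \<sigma> - c\<^sub>0)) s"
    using G s by (intro Ds_cong) (auto simp: jet_def)
  also have "\<dots> = deriv \<beta> (G 0 s) * G 1 s * (F 1 s - c\<^sub>0) + \<beta> (G 0 s) * F 2 s"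
  proof (rule Ds_eqI[OF L s])
    have f: "(F 1 has_real_derivative F 2 s) (at s within {0..L})"
      using F s by (auto simp: jet_def numeral_2_eq_2)
    have g: "(G 0 has_real_derivative G 1 s) (at s within {0..L})"
      using G s by (auto simp: jet_def)
    have "((\<lambda>\<sigma>. \<beta> (G 0 \<sigma>)) has_real_derivative deriv \<beta> (G 0 s) * G 1 s) (at s within {0..L})"
      by (rule DERIV_chain2[OF Cinf_real_DERIV(1)[OF \<beta>] g])
    then show "((\<lambda>\<sigma>. \<beta> (G 0 \<sigma>) * (F 1 \<sigma> - c\<^sub>0)) has_real_derivative
        deriv \<beta> (G 0 s) * G 1 s * (F 1 s - c\<^sub>0) + \<beta> (G 0 s) * F 2 s) (at s within {0..L})"
      using f by (auto intro!: derivative_eq_intros)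
  qed
  finally show ?thesis .
qed

text \<open>The left side pairs the rotated \<open>v\<close> with the rotated normal, and rotations
  preserve the inner product.\<close>

lemma rotation2_normal:
  "(rotation2 \<alpha> *v v) $ 1 * sin (x - \<alpha>) - (rotation2 \<alpha> *v v) $ 2 * cos (x - \<alpha>) = v $ 1 * sin x - v $ 2 * cos x"
proof -
  have "(rotation2 \<alpha> *v v) $ 1 * sin (x - \<alpha>) - (rotation2 \<alpha> *v v) $ 2 * cos (x - \<alpha>)
      = (v $ 1 * sin x - v $ 2 * cos x) * ((sin \<alpha>)\<^sup>2 + (cos \<alpha>)\<^sup>2)"
    by (simp add: rotation2_def matrix_vector_mult_def sum_2 sin_diff cos_diff power2_eq_square algebra_simps
      del: sin_cos_squared_add sin_cos_squared_add2 sin_cos_squared_add3)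
  then show ?thesis by simp
qed

text \<open>A plane rotation has eigenvalue 1 only if it is the identity: the determinant of
  \<open>rotation2 \<alpha>\<close> minus the identity is
  \<open>2 * (1 - cos \<alpha>)\<close>.\<close>

lemma rotation2_fixed:
  assumes "rotation2 \<alpha> *v v = v" "cos \<alpha> \<noteq> 1"
  shows "v = 0"
proof -
  define x y where "x = v $ 1" and "y = v $ 2"
  have 1: "cos \<alpha> * x + sin \<alpha> * y = x" "- sin \<alpha> * x + cos \<alpha> * y = y"
    using arg_cong[OF assms(1), of "\<lambda>v. v $ 1"] arg_cong[OF assms(1), of "\<lambda>v. v $ 2"]
    by (simp_all add: rotation2_def matrix_vector_mult_def sum_2 x_def y_def)
  have t: "(sin \<alpha>)\<^sup>2 + (cos \<alpha>)\<^sup>2 = 1" by simp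
  \<comment> \<open>Elimination for one coordinate, based on
    \<open>(1 - c)\<^sup>2 + d\<^sup>2 = 2 * (1 - c)\<close>. The other coordinate follows by
    exchanging \<open>x\<close> and \<open>y\<close> and the sign of the sine.\<close>
  have z: "2 * (1 - c) * x = 0" if e: "d * y = x - c * x" "d * x = c * y - y" and t: "d\<^sup>2 + c\<^sup>2 = 1"
    for c d x y :: real
  proof -
    have "2 * (1 - c) * x = (1 - c) * (x - c * x) + d * (d * x) + (1 - (d\<^sup>2 + c\<^sup>2)) * x"
      by (simp add: power2_eq_square algebra_simps)
    also have "\<dots> = (1 - c) * (d * y) + d * (c * y - y)" by (simp only: e t) simp
    also have "\<dots> = 0" by (simp add: algebra_simps)
    finally show ?thesis .
  qed
  have "2 * (1 - cos \<alpha>) * x = 0" by (rule z[of "sin \<alpha>" y]) (use 1 t in auto)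
  moreover have "2 * (1 - cos \<alpha>) * y = 0" by (rule z[of "- sin \<alpha>" x]) (use 1 t in auto)
  ultimately show ?thesis using assms(2) by (simp add: vec_eq_iff forall_2 x_def y_def)
qed

lemma jet_mono: "\<lbrakk>jet L m f F; n \<le> m\<rbrakk> \<Longrightarrow> jet L n f F"
  by (auto simp: jet_def)

text \<open>The equations single out no starting point on the curve and no direction in the plane,
  so the shift \<open>a\<close> and the angle \<alpha> are independent here; only the symmetry of
  the datum will relate them.\<close>

lemma flow_solution_cshift:
  assumes a: "0 < a" "a < L" and \<beta>: "Cinf_real \<beta>"
    and adm: "admissible L \<nu> \<omega> \<theta>\<^sub>0 \<rho>\<^sub>0"
    and sol: "flow_solution L \<mu> \<omega> c\<^sub>0 \<beta> \<theta>\<^sub>0 \<rho>\<^sub>0 \<theta> \<rho>"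
    and per: "\<And>t. t > 0 \<Longrightarrow> extends_smooth_periodic L (Ds L (\<theta> t))"
      "\<And>t. t > 0 \<Longrightarrow> extends_smooth_periodic L (\<rho> t)"
  shows "flow_solution L \<mu> \<omega> c\<^sub>0 \<beta>
    (cshift L a (- \<alpha>) (2 * pi * of_int \<omega> - \<alpha>) \<theta>\<^sub>0) (cshift L a 0 0 \<rho>\<^sub>0)
    (\<lambda>t. cshift L a (- \<alpha>) (2 * pi * of_int \<omega> - \<alpha>) (\<theta> t)) (\<lambda>t. cshift L a 0 0 (\<rho> t))"
proof -
  have L: "L > 0" using a by simp
  define q where "q = 2 * pi * of_int \<omega> - \<alpha>"
  obtain D where D: "spacetime_jet L \<theta> D" using sol by (auto simp: flow_solution_def Cinf_spacetime_iff)
  obtain R where R: "spacetime_jet L \<rho> R" using sol by (auto simp: flow_solution_def Cinf_spacetime_iff)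
  have C0: "C0_Ck L 2 \<theta>" "C0_Ck L 2 \<rho>" using sol by (auto simp: flow_solution_def)
  have inv: "invertible (Pi_mat L (\<theta> t))" if "t \<ge> 0" for t using sol that by (auto simp: flow_solution_def)
  have pde: "deriv (\<lambda>\<tau>. \<theta> \<tau> s) t =
          Ds L (\<lambda>\<sigma>. \<beta> (\<rho> t \<sigma>) * (Ds L (\<theta> t) \<sigma> - c\<^sub>0)) s
          + lambda_theta L c\<^sub>0 \<beta> (\<theta> t) (\<rho> t) $ 1 * sin (\<theta> t s)
          - lambda_theta L c\<^sub>0 \<beta> (\<theta> t) (\<rho> t) $ 2 * cos (\<theta> t s)"
       "deriv (\<lambda>\<tau>. \<rho> \<tau> s) t =
          \<mu> * (Ds L ^^ 2) (\<rho> t) s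
          - (1/2) * deriv \<beta> (\<rho> t s) * (Ds L (\<theta> t) s - c\<^sub>0)\<^sup>2
          - lambda_rho L c\<^sub>0 \<beta> (\<theta> t) (\<rho> t)" if "t > 0" "s \<in> {0..L}" for t s
    using sol that by (auto simp: flow_solution_def)
  have bc: "\<theta> t L = \<theta> t 0 + 2 * pi * of_int \<omega>" "\<rho> t L = \<rho> t 0 + 0" if "t > 0" for t
    using sol that by (auto simp: flow_solution_def algebra_simps)
  have init: "\<theta> 0 s = \<theta>\<^sub>0 s" "\<rho> 0 s = \<rho>\<^sub>0 s" if "s \<in> {0..L}" for s
    using sol that by (auto simp: flow_solution_def)
  \<comment> \<open>For \<rho> the extension is known for the function itself; passing to its
    derivative lets both unknowns use the same matching lemma.\<close>
  have per': "extends_smooth_periodic L (Ds L (\<rho> t))" if t: "t > 0" for t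
  proof -
    have "jet L 2 (\<rho> t) (\<lambda>j. (Ds L ^^ j) (\<rho> t))"
      using C0(2) t by (auto simp: C0_Ck_def intro!: Ck_on_jet)
    then have d: "(\<rho> t has_real_derivative Ds L (\<rho> t) s) (at s within {0..L})" if "s \<in> {0..L}" for s
      using that unfolding jet_def by force
    show ?thesis by (rule extends_smooth_periodic_derivative[OF L per(2)[OF t] d])
  qed
  have mD: "D i j t L = D i j t 0 + (if i = 0 \<and> j = 0 then 2 * pi * of_int \<omega> else 0)" if "t > 0" for i j t
    by (rule spacetime_jet_periodic[OF L D _ _ that]) (fact bc(1), fact per(1))
  have mR: "R i j t L = R i j t 0 + (if i = 0 \<and> j = 0 then 0 else 0)" if "t > 0" for i j t
    by (rule spacetime_jet_periodic[OF L R _ _ that]) (fact bc(2), fact per')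
  note JD = spacetime_jet_jet[OF D] and JR = spacetime_jet_jet[OF R]
  have "\<theta> t L = \<theta> t 0 + 2 * pi * of_int \<omega> \<and> \<rho> t L = \<rho> t 0" if "t \<ge> 0" for t
  proof (cases "t = 0")
    case True
    then show ?thesis using init L adm by (auto simp: admissible_def)
  qed (use bc[of t] that in auto)
  then have match: "\<theta> t L = \<theta> t 0 + 2 * pi * of_int \<omega>" "\<rho> t L = \<rho> t 0" if "t \<ge> 0" for t
    using that by auto
  \<comment> \<open>The periodic extensions are given for positive times; at time 0 the orders 1 and
    2 are supplied by \<open>admissible\<close>.\<close>
  have match': "(Ds L ^^ j) (\<theta> t) L = (Ds L ^^ j) (\<theta> t) 0 \<and> (Ds L ^^ j) (\<rho> t) L = (Ds L ^^ j) (\<rho> t) 0"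
    if t: "t \<ge> 0" and j: "1 \<le> j" "j \<le> 2" for t j
  proof (cases "t = 0")
    case True
    have "j = 1 \<or> j = 2" using j by auto
    moreover have "(Ds L ^^ j) (\<theta> t) s = (Ds L ^^ j) \<theta>\<^sub>0 s" "(Ds L ^^ j) (\<rho> t) s = (Ds L ^^ j) \<rho>\<^sub>0 s" if "s \<in> {0..L}" for s
      using True init that by (auto intro!: Ds_pow_cong)
    ultimately show ?thesis using adm L by (auto simp: admissible_def)
  next
    case False
    then have t: "t > 0" using t by simp
    show ?thesis
      using mD[OF t, of 0 j] mR[OF t, of 0 j] j L
        jet_Ds[OF L JD[OF t] j(2), of 0] jet_Ds[OF L JD[OF t] j(2), of L]
        jet_Ds[OF L JR[OF t] j(2), of 0] jet_Ds[OF L JR[OF t] j(2), of L] by auto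
  qed
  have ck: "Ck_on L 2 (\<theta> t)" "Ck_on L 2 (\<rho> t)" if "t \<ge> 0" for t using C0 that by (auto simp: C0_Ck_def)
  have Ck1: "jet L 1 (\<theta> t) (\<lambda>j. (Ds L ^^ j) (\<theta> t))" "jet L 1 (\<rho> t) (\<lambda>j. (Ds L ^^ j) (\<rho> t))"
    if "t \<ge> 0" for t
    using jet_mono[OF ck(1)[OF that, THEN Ck_on_jet], of 1] jet_mono[OF ck(2)[OF that, THEN Ck_on_jet], of 1] by auto
  let ?\<theta> = "\<lambda>t. cshift L a (- \<alpha>) (2 * pi * of_int \<omega> - \<alpha>) (\<theta> t)" and ?\<rho> = "\<lambda>t. cshift L a 0 0 (\<rho> t)"
  show ?thesis
    unfolding flow_solution_def
  proof (intro conjI allI impI ballI)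
    show "Cinf_spacetime L ?\<theta>" using mD by (intro Cinf_spacetime_cshift[OF a D]) simp
    show "Cinf_spacetime L ?\<rho>" using mR by (intro Cinf_spacetime_cshift[OF a R]) simp
    show "C0_Ck L 2 ?\<theta>" using match match' by (intro C0_Ck_cshift[OF a C0(1)]) auto
    show "C0_Ck L 2 ?\<rho>" using match match' by (intro C0_Ck_cshift[OF a C0(2)]) auto
  next
    fix t :: real assume t: "t \<ge> 0"
    show "invertible (Pi_mat L (?\<theta> t))"
      using match[OF t] match'[OF t, of 1]
      by (intro invertible_Pi_mat_cshift[OF a Ck1[OF t] _ _ _ inv[OF t]]) auto
  next
    fix t s :: real assume t: "t > 0" and s: "s \<in> {0..L}"
    define \<sigma> where "\<sigma> = cpoint L a s"
    have \<sigma>: "\<sigma> \<in> {0..L}" unfolding \<sigma>_def by (rule cpoint_in[OF a s])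
    have J\<theta>: "jet L 2 (?\<theta> t) (\<lambda>j. if j = 0 then cshift L a (- \<alpha>) (2 * pi * of_int \<omega> - \<alpha>) (D 0 0 t) else cshift L a 0 0 (D 0 j t))"
      using mD[OF t] by (intro jet_cshift[OF a JD[OF t]]) auto
    have J\<rho>: "jet L m (?\<rho> t) (\<lambda>j. if j = 0 then cshift L a 0 0 (R 0 0 t) else cshift L a 0 0 (R 0 j t))" for m
      using mR[OF t] by (intro jet_cshift[OF a JR[OF t]]) auto
    have t0: "t \<ge> 0" using t by simp
    have lam: "lambda_theta L c\<^sub>0 \<beta> (?\<theta> t) (?\<rho> t) = rotation2 \<alpha> *v lambda_theta L c\<^sub>0 \<beta> (\<theta> t) (\<rho> t)"
      by (rule lambda_theta_cshift[OF a Ck1[OF t0] _ _ _ Cinf_real_DERIV(2)[OF \<beta>] inv[OF t0]])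
        (use match[OF t0] match'[OF t0, of 1] in auto)
    have lamr: "lambda_rho L c\<^sub>0 \<beta> (?\<theta> t) (?\<rho> t) = lambda_rho L c\<^sub>0 \<beta> (\<theta> t) (\<rho> t)"
      by (rule lambda_rho_cshift[OF a Ck1[OF t0] _ _ _ Cinf_real_DERIV(3)[OF \<beta>]])
        (use match[OF t0] match'[OF t0, of 1] in auto)
    have dt: "deriv (\<lambda>\<tau>. ?\<theta> \<tau> s) t = deriv (\<lambda>\<tau>. \<theta> \<tau> \<sigma>) t" "deriv (\<lambda>\<tau>. ?\<rho> \<tau> s) t = deriv (\<lambda>\<tau>. \<rho> \<tau> \<sigma>) t"
    proof -
      note d\<theta> = spacetime_jet_time_derivative[OF D t \<sigma>] and d\<rho> = spacetime_jet_time_derivative[OF R t \<sigma>]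
      have "((\<lambda>\<tau>. ?\<theta> \<tau> s) has_real_derivative D 1 0 t \<sigma>) (at t)"
        using d\<theta> unfolding \<sigma>_def cshift_def cpoint_def by (auto intro!: derivative_eq_intros split: if_splits)
      with d\<theta> show "deriv (\<lambda>\<tau>. ?\<theta> \<tau> s) t = deriv (\<lambda>\<tau>. \<theta> \<tau> \<sigma>) t"
        by (metis DERIV_imp_deriv)
      show "deriv (\<lambda>\<tau>. ?\<rho> \<tau> s) t = deriv (\<lambda>\<tau>. \<rho> \<tau> \<sigma>) t" by (simp add: cshift_00 \<sigma>_def)
    qed
    have flux: "Ds L (\<lambda>\<sigma>. \<beta> (?\<rho> t \<sigma>) * (Ds L (?\<theta> t) \<sigma> - c\<^sub>0)) s = Ds L (\<lambda>\<sigma>. \<beta> (\<rho> t \<sigma>) * (Ds L (\<theta> t) \<sigma> - c\<^sub>0)) \<sigma>"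
      unfolding Ds_flux[OF L \<beta> J\<theta> J\<rho> s] Ds_flux[OF L \<beta> JD[OF t] JR[OF t] \<sigma>]
      by (simp add: cshift_00 \<sigma>_def)
    \<comment> \<open>The multiplier rotates together with the normal, so their pairing is the one
      at the shifted point.\<close>
    show "deriv (\<lambda>\<tau>. ?\<theta> \<tau> s) t =
          Ds L (\<lambda>\<sigma>. \<beta> (?\<rho> t \<sigma>) * (Ds L (?\<theta> t) \<sigma> - c\<^sub>0)) s
          + lambda_theta L c\<^sub>0 \<beta> (?\<theta> t) (?\<rho> t) $ 1 * sin (?\<theta> t s)
          - lambda_theta L c\<^sub>0 \<beta> (?\<theta> t) (?\<rho> t) $ 2 * cos (?\<theta> t s)"
      using rotation2_normal[of \<alpha> "lambda_theta L c\<^sub>0 \<beta> (\<theta> t) (\<rho> t)" "\<theta> t \<sigma>"]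
      unfolding dt flux lam sin_cshift cos_cshift \<sigma>_def[symmetric] pde(1)[OF t \<sigma>] by linarith
    have "(Ds L ^^ 2) (?\<rho> t) s = (Ds L ^^ 2) (\<rho> t) \<sigma>"
      using jet_Ds[OF L J\<rho>[of 2], of 2 s] jet_Ds[OF L JR[OF t], of 2 2 \<sigma>] s \<sigma> by (simp add: cshift_00 \<sigma>_def)
    moreover have "Ds L (?\<theta> t) s = Ds L (\<theta> t) \<sigma>"
      using jet_Ds[OF L J\<theta>, of 1 s] jet_Ds[OF L JD[OF t], of 1 2 \<sigma>] s \<sigma> by (simp add: cshift_00 \<sigma>_def)
    ultimately show "deriv (\<lambda>\<tau>. ?\<rho> \<tau> s) t =
          \<mu> * (Ds L ^^ 2) (?\<rho> t) s
          - (1/2) * deriv \<beta> (?\<rho> t s) * (Ds L (?\<theta> t) s - c\<^sub>0)\<^sup>2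
          - lambda_rho L c\<^sub>0 \<beta> (?\<theta> t) (?\<rho> t)"
      unfolding dt lamr pde(2)[OF t \<sigma>] by (simp add: cshift_00 \<sigma>_def)
  next
    fix t :: real assume t: "t > 0"
    have L0: "0 \<in> {0..L}" "L \<in> {0..L}" using L by auto
    have J\<theta>: "jet L 1 (?\<theta> t) (\<lambda>j. if j = 0 then cshift L a (- \<alpha>) (2 * pi * of_int \<omega> - \<alpha>) (D 0 0 t) else cshift L a 0 0 (D 0 j t))"
      using mD[OF t] by (intro jet_cshift[OF a JD[OF t]]) auto
    have J\<rho>: "jet L 1 (?\<rho> t) (\<lambda>j. if j = 0 then cshift L a 0 0 (R 0 0 t) else cshift L a 0 0 (R 0 j t))"
      using mR[OF t] by (intro jet_cshift[OF a JR[OF t]]) auto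
    show "?\<theta> t L - ?\<theta> t 0 = 2 * pi * of_int \<omega>" "?\<rho> t L = ?\<rho> t 0"
      using a by (simp_all add: cshift_def)
    show "Ds L (?\<theta> t) L = Ds L (?\<theta> t) 0" "Ds L (?\<rho> t) L = Ds L (?\<rho> t) 0"
      using jet_Ds[OF L J\<theta>, of 1, OF _ L0(1)] jet_Ds[OF L J\<theta>, of 1, OF _ L0(2)]
        jet_Ds[OF L J\<rho>, of 1, OF _ L0(1)] jet_Ds[OF L J\<rho>, of 1, OF _ L0(2)] a
      by (simp_all add: cshift_def)
  next
    fix s assume s: "s \<in> {0..L}"
    show "?\<theta> 0 s = cshift L a (- \<alpha>) (2 * pi * of_int \<omega> - \<alpha>) \<theta>\<^sub>0 s" "?\<rho> 0 s = cshift L a 0 0 \<rho>\<^sub>0 s"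
      using init s a by (auto simp: cshift_def)
  qed
qed

section \<open>Vanishing of the multiplier for symmetric data\<close>

lemma rmod_period:
  assumes "L > 0" "0 \<le> x" "x < 2 * L"
  shows "x rmod L = (if x < L then x else x - L)"
  using assms rmod_unique[of "x - L" L x 1] by auto

text \<open>Advancing by \<open>L / k\<close> adds \<open>2 * pi / k\<close> to the linear part
  \<open>2 * pi * s / L\<close>, and wrapping around subtracts \<open>2 * pi\<close>; this is the
  origin of the two constants of the shift.\<close>

lemma rot_symmetric_cshift:
  assumes L: "L > 0" and k: "k \<ge> 2" and sym: "rot_symmetric L k \<theta> \<rho>"
    and bc: "\<theta> L = \<theta> 0 + 2 * pi" "\<rho> L = \<rho> 0" and s: "s \<in> {0..L}"
  shows "cshift L (L / k) (- (2 * pi / k)) (2 * pi - 2 * pi / k) \<theta> s = \<theta> s"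
    and "cshift L (L / k) 0 0 \<rho> s = \<rho> s"
proof -
  define a where "a = L / k"
  have a: "0 < a" "a < L" using L k by (auto simp: a_def field_simps)
  have pa: "2 * pi * a / L = 2 * pi / k" using L by (simp add: a_def)
  have e: "cshift L a (- (2 * pi / k)) (2 * pi - 2 * pi / k) \<theta> s = \<theta> s \<and> cshift L a 0 0 \<rho> s = \<rho> s"
    if s: "0 \<le> s" "s < L" for s
  proof -
    have r: "s rmod L = s" "(s + a) rmod L = (if s + a < L then s + a else s + a - L)"
      using rmod_period[OF L, of s] rmod_period[OF L, of "s + a"] s a by auto
    have th: "\<theta> ((s + a) rmod L) - 2 * pi * ((s + a) rmod L) / L = \<theta> s - 2 * pi * s / L"
      "\<rho> ((s + a) rmod L) = \<rho> s"
      using sym r(1) unfolding rot_symmetric_def periodic_ext_def a_def by auto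
    have lin: "2 * pi * (s + a) / L = 2 * pi * s / L + 2 * pi / k"
      "2 * pi * (s + a - L) / L = 2 * pi * s / L + 2 * pi / k - 2 * pi"
      using L pa by (simp_all add: add_divide_distrib diff_divide_distrib ring_distribs)
    consider "s + a < L" | "s + a = L" | "s + a > L" by linarith
    then show ?thesis
    proof cases
      \<comment> \<open>Here \<open>rmod\<close> gives 0 while the shift reads \<open>L\<close>; the
        boundary conditions reconcile the two.\<close>
      case 2
      then have "s + a - L = 0" by simp
      then show ?thesis using 2 th bc lin(2) r(2) unfolding cshift_def by simp
    qed (use th lin r(2) in \<open>simp_all add: cshift_def\<close>)
  qed
  have "cshift L a (- (2 * pi / k)) (2 * pi - 2 * pi / k) \<theta> s = \<theta> s \<and> cshift L a 0 0 \<rho> s = \<rho> s"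
  proof (cases "s = L")
    \<comment> \<open>\<open>rmod\<close> maps \<open>L\<close> to 0, so the symmetry condition says
      nothing about the value at \<open>L\<close>; it is recovered from the one at 0.\<close>
    case True
    then show ?thesis using e[of 0] L bc a by (auto simp: cshift_def)
  qed (use e s in auto)
  then show "cshift L (L / k) (- (2 * pi / k)) (2 * pi - 2 * pi / k) \<theta> s = \<theta> s"
    "cshift L (L / k) 0 0 \<rho> s = \<rho> s" by (auto simp: a_def)
qed

lemma lambda_theta_eq_0_of_symmetric:
  assumes L: "L > 0" and \<beta>: "Cinf_real \<beta>" and th: "flow_theory L \<nu> \<mu> 1 c\<^sub>0 \<beta>"
    and adm: "admissible L \<nu> 1 \<theta>\<^sub>0 \<rho>\<^sub>0" and k: "k \<ge> 2" and sym: "rot_symmetric L k \<theta>\<^sub>0 \<rho>\<^sub>0"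
    and sol: "flow_solution L \<mu> 1 c\<^sub>0 \<beta> \<theta>\<^sub>0 \<rho>\<^sub>0 \<theta> \<rho>" and t: "t > 0"
  shows "lambda_theta L c\<^sub>0 \<beta> (\<theta> t) (\<rho> t) = 0"
proof -
  define a \<alpha> where "a = L / k" and "\<alpha> = 2 * pi / k"
  have a: "0 < a" "a < L" using L k by (auto simp: a_def field_simps)
  have per: "extends_smooth_periodic L (Ds L (\<theta> t))" "extends_smooth_periodic L (\<rho> t)" if "t > 0" for t
    using th adm sol that unfolding flow_theory_def by blast+
  let ?\<theta> = "\<lambda>t. cshift L a (- \<alpha>) (2 * pi * of_int 1 - \<alpha>) (\<theta> t)" and ?\<rho> = "\<lambda>t. cshift L a 0 0 (\<rho> t)"
  have bc0: "\<theta>\<^sub>0 L = \<theta>\<^sub>0 0 + 2 * pi" "\<rho>\<^sub>0 L = \<rho>\<^sub>0 0" using adm by (auto simp: admissible_def)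
  have "cshift L a (- \<alpha>) (2 * pi * of_int 1 - \<alpha>) \<theta>\<^sub>0 s = \<theta>\<^sub>0 s" "cshift L a 0 0 \<rho>\<^sub>0 s = \<rho>\<^sub>0 s" if "s \<in> {0..L}" for s
    using rot_symmetric_cshift[OF L k sym bc0 that] by (auto simp: a_def \<alpha>_def)
  \<comment> \<open>The shifted solution has the original initial values on \<open>{0..L}\<close>,
    which is all that \<open>flow_solution\<close> sees of the datum.\<close>
  then have "flow_solution L \<mu> 1 c\<^sub>0 \<beta> \<theta>\<^sub>0 \<rho>\<^sub>0 ?\<theta> ?\<rho>"
    using flow_solution_cshift[OF a \<beta> adm sol per, of \<alpha>] unfolding flow_solution_def by auto
  then have eq: "\<theta> t s = ?\<theta> t s" "\<rho> t s = ?\<rho> t s" if "s \<in> {0..L}" for s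
    using th adm sol t that unfolding flow_theory_def by (meson less_imp_le)+
  have ck: "Ck_on L 2 (\<theta> t)" "Ck_on L 2 (\<rho> t)" and inv: "invertible (Pi_mat L (\<theta> t))"
    using sol t by (auto simp: C0_Ck_def flow_solution_def)
  have Ck1: "jet L 1 (\<theta> t) (\<lambda>j. (Ds L ^^ j) (\<theta> t))" "jet L 1 (\<rho> t) (\<lambda>j. (Ds L ^^ j) (\<rho> t))"
    using jet_mono[OF ck(1)[THEN Ck_on_jet], of 1] jet_mono[OF ck(2)[THEN Ck_on_jet], of 1] by auto
  have "lambda_theta L c\<^sub>0 \<beta> (\<theta> t) (\<rho> t) = lambda_theta L c\<^sub>0 \<beta> (?\<theta> t) (?\<rho> t)"
    by (rule lambda_theta_cong) (use eq in auto)
  also have "\<dots> = rotation2 \<alpha> *v lambda_theta L c\<^sub>0 \<beta> (\<theta> t) (\<rho> t)"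
    using sol t by (intro lambda_theta_cshift[OF a Ck1 _ _ _ Cinf_real_DERIV(2)[OF \<beta>] inv]) (auto simp: flow_solution_def algebra_simps)
  finally have "rotation2 \<alpha> *v lambda_theta L c\<^sub>0 \<beta> (\<theta> t) (\<rho> t) = lambda_theta L c\<^sub>0 \<beta> (\<theta> t) (\<rho> t)" by simp
  \<comment> \<open>\<open>k \<ge> 2\<close> gives 0 < \<alpha> \<le> pi, where cosine is strictly
    decreasing; so the rotation is nontrivial.\<close>
  moreover have "cos \<alpha> < cos 0"
    using k by (intro cos_monotone_0_pi) (auto simp: \<alpha>_def field_simps)
  ultimately show ?thesis by (intro rotation2_fixed[of \<alpha>]) auto
qed

section \<open>Convergence of the reduced flow\<close>

lemma continuous_on_compose_UNIV:
  fixes \<beta> :: "real \<Rightarrow> real"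
  assumes "continuous_on UNIV \<beta>" "continuous_on S f"
  shows "continuous_on S (\<lambda>x. \<beta> (f x))"
  by (rule continuous_on_compose2[OF assms]) auto

lemma integral_Icc_derivative_periodic:
  fixes f :: "real \<Rightarrow> real"
  assumes "a \<le> b" "\<And>s. s \<in> {a..b} \<Longrightarrow> (f has_real_derivative f' s) (at s within {a..b})" "f b = f a"
  shows "integral {a..b} f' = 0"
proof -
  have "(f' has_integral f b - f a) {a..b}"
    using assms(1,2) by (intro fundamental_theorem_of_calculus)
      (auto simp: has_real_derivative_iff_has_vector_derivative[symmetric])
  then show ?thesis using assms(3) by (simp add: integral_unique)
qed

lemma constant_on_positive:
  fixes y :: "real \<Rightarrow> real"
  assumes "\<And>t. t > 0 \<Longrightarrow> (y has_real_derivative 0) (at t)" "t > 0" "t' > 0"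
  shows "y t = y t'"
proof -
  have "\<exists>c. \<forall>x\<in>{0<..}. y x = c"
    using assms(1) by (intro has_field_derivative_zero_constant) (auto intro: has_field_derivative_at_within)
  then show ?thesis using assms(2,3) by auto
qed

text \<open>The system once the angle multiplier is gone, phrased in derivative families;
  \<open>\<Lambda>\<close> may be any function of time. The angle is treated before the density
  because its decay controls the forcing there.\<close>

lemma reduced_flow_exp_decay:
  fixes D R :: "nat \<Rightarrow> nat \<Rightarrow> real \<Rightarrow> real \<Rightarrow> real"
  assumes L: "L > 0" and mu: "\<mu> > 0" and \<beta>: "Cinf_real \<beta>" and pos: "\<And>x. \<beta> x > 0"
    and D: "spacetime_jet L \<theta> D" and R: "spacetime_jet L \<rho> R"
    and pdeD: "\<And>t s. t > 0 \<Longrightarrow> s \<in> {0..L} \<Longrightarrow> D 1 0 t s =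
      deriv \<beta> (R 0 0 t s) * R 0 1 t s * (D 0 1 t s - c\<^sub>0) + \<beta> (R 0 0 t s) * D 0 2 t s"
    and pdeR: "\<And>t s. t > 0 \<Longrightarrow> s \<in> {0..L} \<Longrightarrow> R 1 0 t s =
      \<mu> * R 0 2 t s - (1/2) * deriv \<beta> (R 0 0 t s) * (D 0 1 t s - c\<^sub>0)\<^sup>2 - \<Lambda> t"
    and perD: "\<And>t j. t > 0 \<Longrightarrow> D 0 j t L = D 0 j t 0 + (if j = 0 then c\<^sub>0 * L else 0)"
    and perR: "\<And>t j. t > 0 \<Longrightarrow> R 0 j t L = R 0 j t 0"
    and mean: "\<And>t. t > 0 \<Longrightarrow> integral {0..L} (R 0 0 t) = \<nu> * L"
    and T: "T > 0" and MD: "\<And>t j. t \<ge> T \<Longrightarrow> j \<in> {1..3} \<Longrightarrow> l2 0 L (D 0 j t) \<le> M"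
    and MR: "\<And>t j. t \<ge> T \<Longrightarrow> j \<in> {1..3} \<Longrightarrow> l2 0 L (R 0 j t) \<le> M"
  shows "\<exists>m. \<forall>j\<le>2. \<exists>g. exp_decay T g \<and> (\<forall>t\<ge>T. \<forall>s\<in>{0..L}.
      \<bar>D 0 j t s - (if j = 0 then c\<^sub>0 * s + m else if j = 1 then c\<^sub>0 else 0)\<bar> \<le> g t)"
    and "\<forall>j\<le>2. \<exists>g. exp_decay T g \<and> (\<forall>t\<ge>T. \<forall>s\<in>{0..L}. \<bar>R 0 j t s - (if j = 0 then \<nu> else 0)\<bar> \<le> g t)"
proof -
  \<comment> \<open>The mean of \<open>\<theta> - c\<^sub>0 s\<close> is conserved for positive
    times, so it may be read off at any of them; 1 is arbitrary.\<close>
  define m where "m = integral {0..L} (\<lambda>s. D 0 0 1 s - c\<^sub>0 * s) / L"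
  define f where "f = (\<lambda>j t s. D 0 j t s - (if j = 0 then c\<^sub>0 * s + m else if j = 1 then c\<^sub>0 else 0))"
  define w where "w = (\<lambda>j t s. R 0 j t s - (if j = 0 then \<nu> else 0))"
  have dD: "(D i j t has_real_derivative D i (Suc j) t s) (at s within {0..L})"
    and dR: "(R i j t has_real_derivative R i (Suc j) t s) (at s within {0..L})"
    and tD: "((\<lambda>\<tau>. D i j \<tau> s) has_real_derivative D (Suc i) j t s) (at t)"
    and tR: "((\<lambda>\<tau>. R i j \<tau> s) has_real_derivative R (Suc i) j t s) (at t)"
    if "t > 0" "s \<in> {0..L}" for i j t s
    using D R that by (auto simp: spacetime_jet_def)
  have cD: "continuous_on ({0<..} \<times> {0..L}) (\<lambda>(t, s). D i j t s)"
    and cR: "continuous_on ({0<..} \<times> {0..L}) (\<lambda>(t, s). R i j t s)" for i j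
    using D R by (auto simp: spacetime_jet_def)
  have cDt: "continuous_on {0..L} (D i j t)" and cRt: "continuous_on {0..L} (R i j t)" if "t > 0" for i j t
    using continuous_on_slice[OF cD[of i j]] continuous_on_slice[OF cR[of i j]] that by auto
  have df: "(f j t has_real_derivative f (Suc j) t s) (at s within {0..L})" if "t > 0" "s \<in> {0..L}" for j t s
    using dD[OF that, of 0 j] unfolding f_def by (auto intro!: derivative_eq_intros)
  have dw: "(w j t has_real_derivative w (Suc j) t s) (at s within {0..L})" if "t > 0" "s \<in> {0..L}" for j t s
    using dR[OF that, of 0 j] unfolding w_def by (auto intro!: derivative_eq_intros)
  have cf: "continuous_on {0..L} (f j t)" and cw: "continuous_on {0..L} (w j t)" if "t > 0" for j t
  proof -
    have "continuous_on {0..L} (\<lambda>s. if j = 0 then c\<^sub>0 * s + m else if j = 1 then c\<^sub>0 else 0)"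
      by (cases "j = 0"; cases "j = 1") (auto intro!: continuous_intros)
    then show "continuous_on {0..L} (f j t)" unfolding f_def by (intro continuous_on_diff cDt that)
    show "continuous_on {0..L} (w j t)" unfolding w_def by (intro continuous_on_diff cRt that continuous_on_const)
  qed
  have perf: "f j t L = f j t 0" and perw: "w j t L = w j t 0" if "t > 0" for j t
    using perD[OF that, of j] perR[OF that, of j] by (auto simp: f_def w_def)
  \<comment> \<open>Subtracting the affine function turns the flux into \<beta>(\<rho>) times the
    derivative of \<open>f 0\<close>, linear in that unknown.\<close>
  have dflux: "((\<lambda>s. \<beta> (R 0 0 t s) * f 1 t s) has_real_derivative D 1 0 t s) (at s within {0..L})"
    if ts: "t > 0" "s \<in> {0..L}" for t s
  proof -
    have "((\<lambda>s. \<beta> (R 0 0 t s)) has_real_derivative deriv \<beta> (R 0 0 t s) * R 0 1 t s) (at s within {0..L})"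
      using dR[OF ts, of 0 0] by (intro DERIV_chain2[OF Cinf_real_DERIV(1)[OF \<beta>]]) simp
    from DERIV_mult'[OF this df[OF ts, of 1]] show ?thesis
      unfolding pdeD[OF ts] by (simp add: f_def numeral_2_eq_2 algebra_simps)
  qed
  have meanf: "integral {0..L} (f 0 t) = 0" if t: "t > 0" for t
  proof -
    have "((\<lambda>t. integral {0..L} (f 0 t)) has_real_derivative 0) (at t)" if t: "t > 0" for t
    proof -
      have "integral {0..L} (D 1 0 t) = 0"
        using L t dflux perf[OF t, of 1] perR[OF t, of 0]
        by (intro integral_Icc_derivative_periodic[where f = "\<lambda>s. \<beta> (R 0 0 t s) * f 1 t s"]) auto
      moreover have "((\<lambda>t. integral {0..L} (f 0 t)) has_real_derivative integral {0..L} (D 1 0 t)) (at t)"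
      proof (rule has_real_derivative_integral_Icc[OF _ _ cD[of 1 0] t])
        show "((\<lambda>\<tau>. f 0 \<tau> s) has_real_derivative D 1 0 t s) (at t)" if "t > 0" "s \<in> {0..L}" for t s
          using tD[OF that, of 0 0] unfolding f_def by (auto intro!: derivative_eq_intros)
      qed (use cf in auto)
      ultimately show ?thesis by simp
    qed
    then have "integral {0..L} (f 0 t) = integral {0..L} (f 0 1)"
      using t by (intro constant_on_positive[of "\<lambda>t. integral {0..L} (f 0 t)"]) auto
    also have "f 0 1 = (\<lambda>s. (D 0 0 1 s - c\<^sub>0 * s) - m)" by (auto simp: f_def)
    also have "integral {0..L} \<dots> = integral {0..L} (\<lambda>s. D 0 0 1 s - c\<^sub>0 * s) - m * L"
      using L cDt[of 1 0 0]
      by (subst integral_diff) (auto intro!: integrable_continuous_interval continuous_intros)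
    also have "\<dots> = 0" using L by (simp add: m_def)
    finally show ?thesis .
  qed
  have meanw: "integral {0..L} (w 0 t) = 0" if t: "t > 0" for t
  proof -
    have "integral {0..L} (w 0 t) = integral {0..L} (\<lambda>s. R 0 0 t s - \<nu>)" by (simp add: w_def)
    also have "\<dots> = integral {0..L} (R 0 0 t) - \<nu> * L"
      using L cRt[OF t, of 0 0] by (subst integral_diff) (auto intro!: integrable_continuous_interval)
    finally show ?thesis using mean[OF t] by simp
  qed

  \<comment> \<open>The pointwise inequality and Poincare bound the square of \<open>w 0\<close> by
    \<open>4 * L\<close> times the squared norm of \<open>w 1\<close>, and that norm is at most
    \<open>M\<close>.\<close>
  define K where "K = sqrt (4 * L * M\<^sup>2)"
  have K: "\<bar>w 0 t s\<bar> \<le> K" if t: "t \<ge> T" and s: "s \<in> {0..L}" for t s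
  proof -
    have t0: "t > 0" using t T by simp
    have w1: "w 1 t = R 0 1 t" by (auto simp: w_def)
    have p: "l2 0 L (w 0 t) \<le> 2 * (L - 0) * l2 0 L (w 1 t)"
      using L dw[OF t0, of _ 0] cw[OF t0, of 1] meanw[OF t0] by (intro Poincare_l2) auto
    have "(w 0 t s)\<^sup>2 \<le> 2 * l2 0 L (w 0 t) * l2 0 L (w 1 t)"
      using L dw[OF t0, of _ 0] cw[OF t0, of 1] meanw[OF t0] s by (intro power2_le_l2_mult) auto
    also have "\<dots> \<le> 2 * (2 * L * l2 0 L (w 1 t)) * l2 0 L (w 1 t)"
      using p l2_nonneg by (intro mult_right_mono) auto
    also have "\<dots> = 4 * L * (l2 0 L (w 1 t))\<^sup>2" by (simp add: power2_eq_square)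
    also have "\<dots> \<le> 4 * L * M\<^sup>2"
      using L MR[OF t, of 1] l2_nonneg unfolding w1 by (intro mult_left_mono power_mono) auto
    finally show ?thesis unfolding K_def by (metis real_sqrt_abs real_sqrt_le_iff)
  qed
  have inK: "R 0 0 t s \<in> {\<nu> - K..\<nu> + K}" if "t \<ge> T" "s \<in> {0..L}" for t s
    using K[OF that] by (auto simp: w_def)
  have K0: "K \<ge> 0" using L by (simp add: K_def)
  note c\<beta> = Cinf_real_DERIV(2,3)[OF \<beta>]
  \<comment> \<open>On this compact interval \<beta> attains its minimum, which is positive: the
    ellipticity constant of the angle equation.\<close>
  have "\<exists>x0\<in>{\<nu> - K..\<nu> + K}. \<forall>x\<in>{\<nu> - K..\<nu> + K}. \<beta> x0 \<le> \<beta> x"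
    using K0 by (intro continuous_attains_inf continuous_on_subset[OF c\<beta>(1)]) auto
  then obtain x0 where x0: "\<And>x. x \<in> {\<nu> - K..\<nu> + K} \<Longrightarrow> \<beta> x0 \<le> \<beta> x" by blast
  have "\<exists>B. \<forall>x\<in>{\<nu> - K..\<nu> + K}. \<bar>deriv \<beta> x\<bar> \<le> B"
    using bdd_above_abs_continuous_Icc[OF continuous_on_subset[OF c\<beta>(2)], of "\<nu> - K" "\<nu> + K"]
    unfolding bdd_above_def by auto
  then obtain B where B: "\<And>x. x \<in> {\<nu> - K..\<nu> + K} \<Longrightarrow> \<bar>deriv \<beta> x\<bar> \<le> B" by blast
  have B0: "B \<ge> 0" using B[of \<nu>] K0 by auto

  have decay_f: "exp_decay T (\<lambda>t. l2 0 L (f 0 t))"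
  proof (rule diffusion_exp_decay[where b = "\<beta> x0" and ux = "f 1" and k = "\<lambda>t s. \<beta> (R 0 0 t s)"
        and qx = "D 1 0" and h = "\<lambda>_ _. 0" and g = "\<lambda>_. 0", OF L T pos])
    show "((\<lambda>\<tau>. f 0 \<tau> s) has_real_derivative D 1 0 t s + 0) (at t)" if "t > 0" "s \<in> {0..L}" for t s
      using tD[OF that, of 0 0] unfolding f_def by (auto intro!: derivative_eq_intros)
    show "continuous_on ({0<..} \<times> {0..L}) (\<lambda>(t, s). f 0 t s)"
      using cD[of 0 0] unfolding f_def split_beta by (auto intro!: continuous_intros)
    show "continuous_on ({0<..} \<times> {0..L}) (\<lambda>(t, s). D 1 0 t s + 0)" using cD[of 1 0] by simp
    show "(f 0 t has_real_derivative f 1 t s) (at s within {0..L})" if "t > 0" "s \<in> {0..L}" for t s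
      using df[OF that, of 0] by simp
    show "continuous_on {0..L} (\<lambda>s. \<beta> (R 0 0 t s))" if "t > 0" for t
      using continuous_on_compose_UNIV[OF c\<beta>(1) cRt[OF that]] .
    show "f 0 t L * (\<beta> (R 0 0 t L) * f 1 t L) = f 0 t 0 * (\<beta> (R 0 0 t 0) * f 1 t 0)" if "t > 0" for t
      using perf[OF that] perR[OF that] by simp
  qed (use dflux cf cDt x0 inK meanf exp_decay_zero in auto)
  \<comment> \<open>Orders 2 and 3 are unaffected by subtracting an affine function.\<close>
  have Mf: "l2 0 L (f j t) \<le> M" if "t \<ge> T" "j = 2 \<or> j = 3" for t j
    using MD[OF that(1), of j] that by (auto simp: f_def)
  have fT: "\<And>t j s. t \<ge> T \<Longrightarrow> j < 3 \<Longrightarrow> s \<in> {0..L} \<Longrightarrow> (f j t has_real_derivative f (Suc j) t s) (at s within {0..L})"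
    "\<And>t. t \<ge> T \<Longrightarrow> continuous_on {0..L} (f 3 t)" "\<And>t j. t \<ge> T \<Longrightarrow> j < 3 \<Longrightarrow> f j t L = f j t 0"
    "\<And>t. t \<ge> T \<Longrightarrow> integral {0..L} (f 0 t) = 0"
    "\<And>t. t \<ge> T \<Longrightarrow> l2 0 L (f 2 t) \<le> M" "\<And>t. t \<ge> T \<Longrightarrow> l2 0 L (f 3 t) \<le> M"
    using df cf perf meanf Mf T by simp_all
  have If: "exp_decay T (\<lambda>t. l2 0 L (f 1 t))"
    by (rule interpolated_exp_decay(1)[where T = T and M = M and f = f];
        fact L fT(1) fT(2) fT(3) fT(4) fT(5) fT(6) decay_f)
  have "\<exists>g. exp_decay T g \<and> (\<forall>t\<ge>T. \<forall>s\<in>{0..L}. \<bar>f j t s\<bar> \<le> g t)" if "j \<le> 2" for j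
    by (rule interpolated_exp_decay(2)[where T = T and M = M and f = f];
        fact L fT(1) fT(2) fT(3) fT(4) fT(5) fT(6) decay_f that)
  then show "\<exists>m. \<forall>j\<le>2. \<exists>g. exp_decay T g \<and> (\<forall>t\<ge>T. \<forall>s\<in>{0..L}.
      \<bar>D 0 j t s - (if j = 0 then c\<^sub>0 * s + m else if j = 1 then c\<^sub>0 else 0)\<bar> \<le> g t)"
    by (intro exI[of _ m] allI impI) (simp only: f_def)

  \<comment> \<open>Everything in the density equation except the diffusion. Defined through the
    time derivative, it makes diffusion plus source equal to \<open>R 1 0\<close>, whose joint
    continuity is known.\<close>
  define h where "h = (\<lambda>t s. R 1 0 t s - \<mu> * R 0 2 t s)"
  have ch: "continuous_on {0..L} (h t)" if "t > 0" for t
    using cRt[OF that] unfolding h_def by (intro continuous_intros) auto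
  have decay_w: "exp_decay T (\<lambda>t. l2 0 L (w 0 t))"
  proof (rule diffusion_exp_decay[where b = \<mu> and ux = "w 1" and k = "\<lambda>_ _. \<mu>"
        and qx = "\<lambda>t s. \<mu> * R 0 2 t s" and h = h and g = "\<lambda>t. (K * B) * (l2 0 L (f 1 t) * l2 0 L (f 1 t))", OF L T mu])
    show "((\<lambda>\<tau>. w 0 \<tau> s) has_real_derivative \<mu> * R 0 2 t s + h t s) (at t)" if "t > 0" "s \<in> {0..L}" for t s
      using tR[OF that, of 0 0] unfolding w_def h_def by (auto intro!: derivative_eq_intros)
    show "continuous_on ({0<..} \<times> {0..L}) (\<lambda>(t, s). w 0 t s)"
      using cR[of 0 0] unfolding w_def split_beta by (auto intro!: continuous_intros)
    show "continuous_on ({0<..} \<times> {0..L}) (\<lambda>(t, s). \<mu> * R 0 2 t s + h t s)"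
      using cR[of 1 0] by (simp add: h_def)
    show "(w 0 t has_real_derivative w 1 t s) (at s within {0..L})" if "t > 0" "s \<in> {0..L}" for t s
      using dw[OF that, of 0] by simp
    show "((\<lambda>s. \<mu> * w 1 t s) has_real_derivative \<mu> * R 0 2 t s) (at s within {0..L})" if "t > 0" "s \<in> {0..L}" for t s
      using DERIV_cmult[OF dw[OF that, of 1], of \<mu>] by (simp add: w_def numeral_2_eq_2)
    show "continuous_on {0..L} (\<lambda>s. \<mu> * R 0 2 t s)" if "t > 0" for t
      using cRt[OF that] by (intro continuous_intros) auto
    show "exp_decay T (\<lambda>t. (K * B) * (l2 0 L (f 1 t) * l2 0 L (f 1 t)))"
      by (intro exp_decay_cmult exp_decay_mult If)
    \<comment> \<open>The factor 2 cancels the 1/2 of the forcing. Bounding \<open>w 0\<close> by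
      \<open>K\<close> and the derivative of \<beta> by \<open>B\<close> leaves the squared norm of
      \<open>f 1\<close>, already known to decay.\<close>
    show "2 * integral {0..L} (\<lambda>s. w 0 t s * h t s) \<le> (K * B) * (l2 0 L (f 1 t) * l2 0 L (f 1 t))"
      if t: "t \<ge> T" for t
    proof -
      have t0: "t > 0" using t T by simp
      have c\<rho>: "continuous_on {0..L} (\<lambda>s. deriv \<beta> (R 0 0 t s))"
        by (rule continuous_on_compose_UNIV[OF c\<beta>(2) cRt[OF t0]])
      note [continuous_intros] = cw[OF t0] cf[OF t0] c\<rho>
      \<comment> \<open>The multiplier factors out of its integral and meets the vanishing mean of
        \<open>w 0\<close>.\<close>
      have "integral {0..L} (\<lambda>s. w 0 t s * h t s)
          = integral {0..L} (\<lambda>s. (- (1/2)) * (w 0 t s * deriv \<beta> (R 0 0 t s) * (f 1 t s)\<^sup>2) + (- \<Lambda> t) * w 0 t s)"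
      proof (rule Henstock_Kurzweil_Integration.integral_cong)
        fix s assume s: "s \<in> {0..L}"
        show "w 0 t s * h t s = (- (1/2)) * (w 0 t s * deriv \<beta> (R 0 0 t s) * (f 1 t s)\<^sup>2) + (- \<Lambda> t) * w 0 t s"
          unfolding h_def pdeR[OF t0 s] f_def by (simp add: algebra_simps)
      qed
      also have "\<dots> = (- (1/2)) * integral {0..L} (\<lambda>s. w 0 t s * deriv \<beta> (R 0 0 t s) * (f 1 t s)\<^sup>2) + (- \<Lambda> t) * integral {0..L} (w 0 t)"
        by (intro integral_unique has_integral_add has_integral_mult_right integrable_integral
            integrable_continuous_interval continuous_intros)
      finally have "2 * integral {0..L} (\<lambda>s. w 0 t s * h t s) = - integral {0..L} (\<lambda>s. w 0 t s * deriv \<beta> (R 0 0 t s) * (f 1 t s)\<^sup>2)"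
        using meanw[OF t0] by simp
      also have "\<dots> \<le> \<bar>integral {0..L} (\<lambda>s. w 0 t s * deriv \<beta> (R 0 0 t s) * (f 1 t s)\<^sup>2)\<bar>" by simp
      also have "\<dots> \<le> integral {0..L} (\<lambda>s. (K * B) * (f 1 t s)\<^sup>2)"
        unfolding real_norm_def[symmetric]
      proof (intro integral_norm_bound_integral integrable_continuous_interval continuous_intros)
        fix s assume s: "s \<in> {0..L}"
        have "\<bar>w 0 t s * deriv \<beta> (R 0 0 t s)\<bar> \<le> K * B"
          unfolding abs_mult using K[OF t s] B[OF inK[OF t s]] K0 by (intro mult_mono) auto
        then show "norm (w 0 t s * deriv \<beta> (R 0 0 t s) * (f 1 t s)\<^sup>2) \<le> (K * B) * (f 1 t s)\<^sup>2"
          by (simp add: abs_mult mult_right_mono)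
      qed
      also have "\<dots> = (K * B) * (l2 0 L (f 1 t) * l2 0 L (f 1 t))"
        using l2_power2[of 0 L "f 1 t"] by (simp add: power2_eq_square)
      finally show ?thesis .
    qed
    show "w 0 t L * (\<mu> * w 1 t L) = w 0 t 0 * (\<mu> * w 1 t 0)" if "t > 0" for t
      using perw[OF that] by simp
  qed (use cw ch meanw in auto)
  have Mw: "l2 0 L (w j t) \<le> M" if "t \<ge> T" "j = 2 \<or> j = 3" for t j
    using MR[OF that(1), of j] that by (auto simp: w_def)
  have wT: "\<And>t j s. t \<ge> T \<Longrightarrow> j < 3 \<Longrightarrow> s \<in> {0..L} \<Longrightarrow> (w j t has_real_derivative w (Suc j) t s) (at s within {0..L})"
    "\<And>t. t \<ge> T \<Longrightarrow> continuous_on {0..L} (w 3 t)" "\<And>t j. t \<ge> T \<Longrightarrow> j < 3 \<Longrightarrow> w j t L = w j t 0"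
    "\<And>t. t \<ge> T \<Longrightarrow> integral {0..L} (w 0 t) = 0"
    "\<And>t. t \<ge> T \<Longrightarrow> l2 0 L (w 2 t) \<le> M" "\<And>t. t \<ge> T \<Longrightarrow> l2 0 L (w 3 t) \<le> M"
    using dw cw perw meanw Mw T by simp_all
  have "\<exists>g. exp_decay T g \<and> (\<forall>t\<ge>T. \<forall>s\<in>{0..L}. \<bar>w j t s\<bar> \<le> g t)" if "j \<le> 2" for j
    by (rule interpolated_exp_decay(2)[where T = T and M = M and f = w];
        fact L wT(1) wT(2) wT(3) wT(4) wT(5) wT(6) decay_w that)
  then show "\<forall>j\<le>2. \<exists>g. exp_decay T g \<and> (\<forall>t\<ge>T. \<forall>s\<in>{0..L}. \<bar>R 0 j t s - (if j = 0 then \<nu> else 0)\<bar> \<le> g t)"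
    by (simp only: w_def) blast
qed

section \<open>Return to norms, the limit circle and the initial time\<close>

lemma l2_le_W2_norm:
  assumes L: "L > 0" and F: "jet L m f F" and j: "j \<le> m"
  shows "l2 0 L (F j) \<le> W2_norm L m f"
proof -
  have "integral {0..L} (\<lambda>s. ((Ds L ^^ i) f s)\<^sup>2) = (l2 0 L (F i))\<^sup>2" if "i \<le> m" for i
    unfolding l2_power2
    by (intro Henstock_Kurzweil_Integration.integral_cong) (use jet_Ds[OF L F that] in simp)
  then have "W2_norm L m f = sqrt (\<Sum>i\<le>m. (l2 0 L (F i))\<^sup>2)" by (simp add: W2_norm_def)
  moreover have "(l2 0 L (F j))\<^sup>2 \<le> (\<Sum>i\<le>m. (l2 0 L (F i))\<^sup>2)"
    using j by (intro member_le_sum) auto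
  ultimately show ?thesis by (simp add: real_le_rsqrt)
qed

text \<open>With angle \<open>c * s + m\<close> the curve integrates to an arc of radius
  \<open>r = 1 / c\<close> about \<open>p + (- r * sin m, r * cos m)\<close>;
  \<open>c * L = 2 * pi\<close> is one full turn, so the arc is the whole circle.\<close>

lemma describes_circle_constant_curvature:
  assumes L: "L > 0"
  shows "describes_circle L (\<lambda>s. 2 * pi / L * s + m)"
proof -
  define c where "c = 2 * pi / L"
  have c: "c > 0" "c * L = 2 * pi" using L by (auto simp: c_def)
  define r where "r = 1 / c"
  have r: "r > 0" using c by (simp add: r_def)
  have curve: "angle_curve p (\<lambda>s. c * s + m) s
      = p + (r * (sin (c * s + m) - sin m), r * (cos m - cos (c * s + m)))" if "s \<in> {0..L}" for p s
  proof -
    have "((\<lambda>r. (cos (c * r + m), sin (c * r + m))) has_integral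
        (r * sin (c * s + m), - r * cos (c * s + m)) - (r * sin (c * 0 + m), - r * cos (c * 0 + m))) {0..s}"
    proof (rule fundamental_theorem_of_calculus)
      fix x assume "x \<in> {0..s}"
      have "((\<lambda>x. r * sin (c * x + m)) has_vector_derivative cos (c * x + m)) (at x within {0..s})"
        "((\<lambda>x. - r * cos (c * x + m)) has_vector_derivative sin (c * x + m)) (at x within {0..s})"
        unfolding has_real_derivative_iff_has_vector_derivative[symmetric]
        using c by (auto intro!: derivative_eq_intros simp: r_def)
      then show "((\<lambda>x. (r * sin (c * x + m), - r * cos (c * x + m))) has_vector_derivative
          (cos (c * x + m), sin (c * x + m))) (at x within {0..s})"
        by (rule has_vector_derivative_Pair)
    qed (use that in simp)
    then show ?thesis by (simp add: angle_curve_def integral_unique right_diff_distrib)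
  qed
  have "angle_curve p (\<lambda>s. c * s + m) ` {0..L} = sphere (p + (- r * sin m, r * cos m)) r" for p
  proof (intro subset_antisym subsetI)
    fix x assume "x \<in> angle_curve p (\<lambda>s. c * s + m) ` {0..L}"
    then obtain s where "x = p + (r * (sin (c * s + m) - sin m), r * (cos m - cos (c * s + m)))"
      using curve by auto
    then have "p + (- r * sin m, r * cos m) - x = (- r * sin (c * s + m), r * cos (c * s + m))"
      by (simp add: algebra_simps)
    moreover have "(r * sin (c * s + m))\<^sup>2 + (r * cos (c * s + m))\<^sup>2 = r\<^sup>2"
      by (simp add: power_mult_distrib distrib_left[symmetric])
    ultimately show "x \<in> sphere (p + (- r * sin m, r * cos m)) r"
      using r by (simp add: dist_norm norm_Pair)
  next
    fix x assume x: "x \<in> sphere (p + (- r * sin m, r * cos m)) r"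
    \<comment> \<open>The sine and cosine that the tangent angle must have for the curve to pass
      through \<open>x\<close>.\<close>
    define A B where "A = (fst x - fst p + r * sin m) / r" and "B = (snd p + r * cos m - snd x) / r"
    have xe: "x = p + (r * (A - sin m), r * (cos m - B))"
      using r by (auto simp: A_def B_def field_simps prod_eq_iff)
    have "sqrt ((r * A)\<^sup>2 + (r * B)\<^sup>2) = r"
    proof -
      have "p + (- r * sin m, r * cos m) - x = (- (r * A), r * B)"
        by (simp add: xe algebra_simps)
      then show ?thesis using x by (simp add: dist_norm norm_Pair)
    qed
    then have "(r * A)\<^sup>2 + (r * B)\<^sup>2 = r\<^sup>2"
      by (metis real_sqrt_pow2 sum_power2_ge_zero)
    then have "r\<^sup>2 * (A\<^sup>2 + B\<^sup>2) = r\<^sup>2 * 1" by (simp add: power_mult_distrib distrib_left)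
    then have AB: "A\<^sup>2 + B\<^sup>2 = 1" using r by (simp only: mult_cancel_left) auto
    \<comment> \<open>Turning \<open>(B, A)\<close> back by \<open>m\<close> yields an angle
      \<open>z\<close> from 0 up to \<open>2 * pi\<close>, so that \<open>z / c\<close> is a
      parameter in \<open>{0..L}\<close>.\<close>
    have "(B * cos m + A * sin m)\<^sup>2 + (A * cos m - B * sin m)\<^sup>2 = (A\<^sup>2 + B\<^sup>2) * ((sin m)\<^sup>2 + (cos m)\<^sup>2)"
      by (simp add: power2_eq_square algebra_simps del: sin_cos_squared_add sin_cos_squared_add2 sin_cos_squared_add3)
    then have "(B * cos m + A * sin m)\<^sup>2 + (A * cos m - B * sin m)\<^sup>2 = 1" using AB by simp
    from sincos_total_2pi[OF this] obtain z where z: "0 \<le> z" "z < 2 * pi"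
      "B * cos m + A * sin m = cos z" "A * cos m - B * sin m = sin z" by blast
    have "sin (z + m) = A * ((sin m)\<^sup>2 + (cos m)\<^sup>2)" "cos (z + m) = B * ((sin m)\<^sup>2 + (cos m)\<^sup>2)"
      unfolding sin_add cos_add z(3,4)[symmetric]
      by (simp_all add: power2_eq_square algebra_simps del: sin_cos_squared_add sin_cos_squared_add2 sin_cos_squared_add3)
    then have sc: "sin (z + m) = A" "cos (z + m) = B" by simp_all
    have s: "z / c \<in> {0..L}" using z c by (auto simp: field_simps)
    have "x = angle_curve p (\<lambda>s. c * s + m) (z / c)"
      unfolding curve[OF s] using c sc xe by simp
    then show "x \<in> angle_curve p (\<lambda>s. c * s + m) ` {0..L}" using s by blast
  qed
  then show ?thesis unfolding describes_circle_def c_def[symmetric] using r by blast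
qed

text \<open>On \<open>{0..T}\<close> the factor \<open>exp (\<delta> * (T - t))\<close> is at least
  1, so a plain bound is absorbed into the constant at an unchanged rate.\<close>

lemma exp_decay_extend:
  assumes N: "exp_decay T N" and B: "\<And>t. t \<in> {0..T} \<Longrightarrow> N t \<le> B"
  shows "\<exists>C \<delta>. \<delta> > 0 \<and> (\<forall>t\<ge>0. N t \<le> C * exp (- \<delta> * t))"
proof -
  obtain C \<delta> where C: "C \<ge> 0" "\<delta> > 0" "\<And>t. t \<ge> T \<Longrightarrow> \<bar>N t\<bar> \<le> C * exp (- \<delta> * t)"
    using N unfolding exp_decay_def by blast
  have "N t \<le> (C + \<bar>B\<bar> * exp (\<delta> * T)) * exp (- \<delta> * t)" if t: "t \<ge> 0" for t
  proof (cases "t \<le> T")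
    case True
    have "N t \<le> \<bar>B\<bar> * 1" using B[of t] t True by auto
    also have "\<dots> \<le> \<bar>B\<bar> * (exp (\<delta> * T) * exp (- \<delta> * t))"
      using C(2) True by (intro mult_left_mono) (auto simp: exp_add[symmetric] right_diff_distrib[symmetric])
    also have "\<dots> \<le> (C + \<bar>B\<bar> * exp (\<delta> * T)) * exp (- \<delta> * t)" using C(1) by (simp add: algebra_simps)
    finally show ?thesis .
  next
    case False
    then have "N t \<le> C * exp (- \<delta> * t)" using C(3)[of t] by auto
    also have "\<dots> \<le> (C + \<bar>B\<bar> * exp (\<delta> * T)) * exp (- \<delta> * t)" by (simp add: algebra_simps)
    finally show ?thesis .
  qed
  then show ?thesis using C(2) by blast
qed

lemma Ck_norm_exp_decay:
  assumes L: "L > 0" and T: "T > 0" and D: "spacetime_jet L f D" and G: "jet L 2 g G"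
    and e: "\<forall>j\<le>2. \<exists>h. exp_decay T h \<and> (\<forall>t\<ge>T. \<forall>s\<in>{0..L}. \<bar>D 0 j t s - G j s\<bar> \<le> h t)"
  shows "exp_decay T (\<lambda>t. Ck_norm L 2 (\<lambda>s. f t s - g s))"
proof -
  obtain h where h: "\<And>j. j \<le> 2 \<Longrightarrow> exp_decay T (h j)"
    "\<And>j t s. j \<le> 2 \<Longrightarrow> t \<ge> T \<Longrightarrow> s \<in> {0..L} \<Longrightarrow> \<bar>D 0 j t s - G j s\<bar> \<le> h j t"
    using e by metis
  have "exp_decay T (\<lambda>t. h 0 t + h 1 t + h 2 t)"
    using h(1) T by (intro exp_decay_add) auto
  then show ?thesis
  proof (rule exp_decay_mono)
    fix t assume t: "t \<ge> T"
    have J: "jet L 2 (\<lambda>s. f t s - g s) (\<lambda>j s. D 0 j t s - G j s)"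
      using t T by (intro jet_diff[OF spacetime_jet_jet[OF D] G]) auto
    have "Ck_norm L 2 (\<lambda>s. f t s - g s) \<le> (\<Sum>j\<le>2. h j t)"
      using h(2) t by (intro Ck_norm_le[OF L J]) auto
    moreover have "Ck_norm L 2 (\<lambda>s. f t s - g s) \<ge> 0" by (intro Ck_norm_nonneg[OF L] jet_Ck_on[OF L J])
    ultimately show "\<bar>Ck_norm L 2 (\<lambda>s. f t s - g s)\<bar> \<le> h 0 t + h 1 t + h 2 t"
      by (simp add: numeral_2_eq_2)
  qed
qed

text \<open>The supremum norm controls the integral. This links the equation, valid for positive
  times, with the mean prescribed at time 0.\<close>

lemma C0_Ck_integral_tendsto:
  assumes L: "L > 0" and f: "C0_Ck L m f"
  shows "((\<lambda>t. integral {0..L} (f t)) \<longlongrightarrow> integral {0..L} (f 0)) (at_right 0)"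
proof -
  have ck: "jet L m (f t) (\<lambda>j. (Ds L ^^ j) (f t))" if "t \<ge> 0" for t
    using f that by (auto simp: C0_Ck_def intro: Ck_on_jet)
  have i: "f t integrable_on {0..L}" if "t \<ge> 0" for t
    using ck[OF that] by (auto simp: jet_def intro!: integrable_continuous_interval dest!: spec[of _ 0])
  have "((\<lambda>t. integral {0..L} (f t) - integral {0..L} (f 0)) \<longlongrightarrow> 0) (at_right 0)"
  proof (rule Lim_null_comparison)
    have "((\<lambda>t. Ck_norm L m (\<lambda>s. f t s - f 0 s)) \<longlongrightarrow> 0) (at 0 within {0..})"
      using f by (auto simp: C0_Ck_def)
    then have "((\<lambda>t. Ck_norm L m (\<lambda>s. f t s - f 0 s)) \<longlongrightarrow> 0) (at_right 0)"
      by (simp add: at_within_Ici_at_right)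
    from tendsto_mult_right_zero[OF this, of L]
    show "((\<lambda>t. L * Ck_norm L m (\<lambda>s. f t s - f 0 s)) \<longlongrightarrow> 0) (at_right 0)" .
    show "\<forall>\<^sub>F t in at_right 0. norm (integral {0..L} (f t) - integral {0..L} (f 0)) \<le> L * Ck_norm L m (\<lambda>s. f t s - f 0 s)"
      unfolding eventually_at_filter
    proof (intro always_eventually allI impI)
      fix t :: real assume "t \<in> {0<..}"
      then have t: "t \<ge> 0" by simp
      have "integral {0..L} (f t) - integral {0..L} (f 0) = integral {0..L} (\<lambda>s. f t s - f 0 s)"
        using i t by (simp add: integral_diff)
      also have "norm \<dots> \<le> integral {0..L} (\<lambda>s. Ck_norm L m (\<lambda>s. f t s - f 0 s))"
        using abs_le_Ck_norm[OF L jet_diff[OF ck[OF t] ck], of 0 0] i t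
        by (intro integral_norm_bound_integral integrable_diff) auto
      finally show "norm (integral {0..L} (f t) - integral {0..L} (f 0)) \<le> L * Ck_norm L m (\<lambda>s. f t s - f 0 s)"
        using L by simp
    qed
  qed
  then show ?thesis by (simp add: LIM_zero_iff)
qed

theorem proposition4p1:
  fixes L \<nu> \<mu> c\<^sub>0 :: real and \<omega> :: int and k :: nat
    and \<beta> \<theta>\<^sub>0 \<rho>\<^sub>0 :: "real \<Rightarrow> real" and \<theta> \<rho> :: "real \<Rightarrow> real \<Rightarrow> real"
  assumes "L > 0" and "\<mu> > 0"
    and "Cinf_real \<beta>" and "\<And>x. \<beta> x > 0"
    and "\<omega> = 1" and "c\<^sub>0 = 2 * pi / L"
    and "flow_theory L \<nu> \<mu> \<omega> c\<^sub>0 \<beta>"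
    and "admissible L \<nu> \<omega> \<theta>\<^sub>0 \<rho>\<^sub>0"
    and "k \<ge> 2" and "rot_symmetric L k \<theta>\<^sub>0 \<rho>\<^sub>0"
    and "flow_solution L \<mu> \<omega> c\<^sub>0 \<beta> \<theta>\<^sub>0 \<rho>\<^sub>0 \<theta> \<rho>"
  shows "\<exists>\<theta>inf \<rho>inf.
     Ck_on L 2 \<theta>inf \<and> Ck_on L 2 \<rho>inf \<and>
     (\<exists>C \<delta>. \<delta> > 0 \<and> (\<forall>t\<ge>0.
        Ck_norm L 2 (\<lambda>s. \<theta> t s - \<theta>inf s) + Ck_norm L 2 (\<lambda>s. \<rho> t s - \<rho>inf s) \<le> C * exp (- \<delta> * t))) \<and>
     (\<forall>s\<in>{0..L}. Ds L \<theta>inf s = c\<^sub>0) \<and> (\<forall>s\<in>{0..L}. \<rho>inf s = \<nu>) \<and>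
     describes_circle L \<theta>inf"
proof -
  note L = assms(1) and mu = assms(2) and \<beta> = assms(3) and pos = assms(4) and c0 = assms(6)
  have th: "flow_theory L \<nu> \<mu> 1 c\<^sub>0 \<beta>" and adm: "admissible L \<nu> 1 \<theta>\<^sub>0 \<rho>\<^sub>0"
    and sol: "flow_solution L \<mu> 1 c\<^sub>0 \<beta> \<theta>\<^sub>0 \<rho>\<^sub>0 \<theta> \<rho>" using assms by auto
  note lam0 = lambda_theta_eq_0_of_symmetric[OF L \<beta> th adm assms(9,10) sol]
  obtain D where D: "spacetime_jet L \<theta> D" using sol by (auto simp: flow_solution_def Cinf_spacetime_iff)
  obtain R where R: "spacetime_jet L \<rho> R" using sol by (auto simp: flow_solution_def Cinf_spacetime_iff)
  note JD = spacetime_jet_jet[OF D] and JR = spacetime_jet_jet[OF R]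
  have C0: "C0_Ck L 2 \<theta>" "C0_Ck L 2 \<rho>" using sol by (auto simp: flow_solution_def)
  have per: "extends_smooth_periodic L (Ds L (\<theta> t))" "extends_smooth_periodic L (\<rho> t)" if "t > 0" for t
    using th adm sol that unfolding flow_theory_def by blast+
  have dD: "(D 0 j t has_real_derivative D 0 (Suc j) t s) (at s within {0..L})"
    "(R 0 j t has_real_derivative R 0 (Suc j) t s) (at s within {0..L})" if "t > 0" "s \<in> {0..L}" for j t s
    using D R that by (auto simp: spacetime_jet_def)
  have cR: "continuous_on {0..L} (R i j t)" "continuous_on {0..L} (D i j t)" if "t > 0" for i j t
    using R D that continuous_on_slice[of "{0<..}" "{0..L}" "R i j" t] continuous_on_slice[of "{0<..}" "{0..L}" "D i j" t]
    by (simp_all add: spacetime_jet_def)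
  have fD: "\<theta> t s = D 0 0 t s" "\<rho> t s = R 0 0 t s" "Ds L (\<theta> t) s = D 0 1 t s" "(Ds L ^^ 2) (\<rho> t) s = R 0 2 t s"
    if "t > 0" "s \<in> {0..L}" for t s
    using D R that jet_Ds[OF L JD[OF that(1)], of 1 1 s] jet_Ds[OF L JR[OF that(1)], of 2 2 s]
    by (auto simp: spacetime_jet_def)
  \<comment> \<open>The total turn \<open>2 * pi\<close> is written as \<open>c\<^sub>0 * L\<close>;
    this is where the value of \<open>c\<^sub>0\<close> enters the estimates.\<close>
  have perD: "D 0 j t L = D 0 j t 0 + (if j = 0 then c\<^sub>0 * L else 0)" if "t > 0" for j t
    using spacetime_jet_periodic[OF L D, of "c\<^sub>0 * L" t 0 j] per(1) sol that L c0
    by (auto simp: flow_solution_def algebra_simps)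
  have perR: "R 0 j t L = R 0 j t 0" if t: "t > 0" for j t
  proof (rule extends_smooth_periodic_derivatives[OF L, of "\<lambda>j. R 0 j t"])
    show "extends_smooth_periodic L (R 0 0 t)"
      using per(2)[OF t] fD(2)[OF t] unfolding extends_smooth_periodic_def by simp
  qed (use dD t in auto)
  define \<Lambda> where "\<Lambda> = (\<lambda>t. lambda_rho L c\<^sub>0 \<beta> (\<theta> t) (\<rho> t))"
  have \<Lambda>: "\<Lambda> t = - (1 / (2 * L)) * integral {0..L} (\<lambda>s. deriv \<beta> (R 0 0 t s) * (D 0 1 t s - c\<^sub>0)\<^sup>2)" if "t > 0" for t
  proof -
    have "integral {0..L} (\<lambda>s. deriv \<beta> (\<rho> t s) * (Ds L (\<theta> t) s - c\<^sub>0)\<^sup>2) = integral {0..L} (\<lambda>s. deriv \<beta> (R 0 0 t s) * (D 0 1 t s - c\<^sub>0)\<^sup>2)"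
      using fD[OF that] by (intro Henstock_Kurzweil_Integration.integral_cong) simp
    then show ?thesis by (simp add: \<Lambda>_def lambda_rho_def)
  qed
  have pdeD: "D 1 0 t s = deriv \<beta> (R 0 0 t s) * R 0 1 t s * (D 0 1 t s - c\<^sub>0) + \<beta> (R 0 0 t s) * D 0 2 t s"
    if ts: "t > 0" "s \<in> {0..L}" for t s
  proof -
    have "D 1 0 t s = deriv (\<lambda>\<tau>. \<theta> \<tau> s) t"
      using spacetime_jet_time_derivative[OF D ts] by (simp add: DERIV_imp_deriv)
    \<comment> \<open>Symmetry removes both multiplier terms.\<close>
    also have "\<dots> = Ds L (\<lambda>\<sigma>. \<beta> (\<rho> t \<sigma>) * (Ds L (\<theta> t) \<sigma> - c\<^sub>0)) s"
      using sol ts lam0[OF ts(1)] by (simp add: flow_solution_def)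
    also note Ds_flux[OF L \<beta> JD[OF ts(1)] JR[OF ts(1)] ts(2)]
    finally show ?thesis .
  qed
  have pdeR: "R 1 0 t s = \<mu> * R 0 2 t s - (1/2) * deriv \<beta> (R 0 0 t s) * (D 0 1 t s - c\<^sub>0)\<^sup>2 - \<Lambda> t"
    if ts: "t > 0" "s \<in> {0..L}" for t s
  proof -
    have "R 1 0 t s = deriv (\<lambda>\<tau>. \<rho> \<tau> s) t"
      using spacetime_jet_time_derivative[OF R ts] by (simp add: DERIV_imp_deriv)
    also have "\<dots> = \<mu> * (Ds L ^^ 2) (\<rho> t) s - (1/2) * deriv \<beta> (\<rho> t s) * (Ds L (\<theta> t) s - c\<^sub>0)\<^sup>2 - \<Lambda> t"
      using sol ts by (simp add: flow_solution_def \<Lambda>_def)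
    finally show ?thesis using fD[OF ts] by simp
  qed
  have mean: "integral {0..L} (R 0 0 t) = \<nu> * L" if t: "t > 0" for t
  proof -
    \<comment> \<open>The multiplier is normalised so that its integral cancels that of the
      quadratic term; the diffusion integrates to 0 by periodicity.\<close>
    have "((\<lambda>t. integral {0..L} (R 0 0 t)) has_real_derivative 0) (at t)" if t: "t > 0" for t
    proof -
      have "continuous_on {0..L} (\<lambda>s. deriv \<beta> (R 0 0 t s))"
        by (rule continuous_on_compose_UNIV[OF Cinf_real_DERIV(3)[OF \<beta>] cR(1)[OF t]])
      note [continuous_intros] = this cR[OF t]
      have "integral {0..L} (R 1 0 t) = integral {0..L} (\<lambda>s. \<mu> * R 0 2 t s
          + (- (1/2)) * (deriv \<beta> (R 0 0 t s) * (D 0 1 t s - c\<^sub>0)\<^sup>2) + - \<Lambda> t)"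
        using pdeR[OF t] by (intro Henstock_Kurzweil_Integration.integral_cong) simp
      also have "\<dots> = \<mu> * integral {0..L} (R 0 2 t)
          + (- (1/2)) * integral {0..L} (\<lambda>s. deriv \<beta> (R 0 0 t s) * (D 0 1 t s - c\<^sub>0)\<^sup>2) + integral {0..L} (\<lambda>s. - \<Lambda> t)"
        by (intro integral_unique has_integral_add has_integral_mult_right integrable_integral
            integrable_continuous_interval continuous_intros)
      also have "integral {0..L} (R 0 2 t) = 0"
        using L t dD(2)[OF t, of _ 1] perR[OF t, of 1]
        by (intro integral_Icc_derivative_periodic[where f = "R 0 1 t"]) (auto simp: numeral_2_eq_2)
      also have "\<mu> * 0 + (- (1/2)) * integral {0..L} (\<lambda>s. deriv \<beta> (R 0 0 t s) * (D 0 1 t s - c\<^sub>0)\<^sup>2) + integral {0..L} (\<lambda>s. - \<Lambda> t) = 0"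
        using L \<Lambda>[OF t] by simp
      finally have z: "integral {0..L} (R 1 0 t) = 0" .
      have "((\<lambda>t. integral {0..L} (R 0 0 t)) has_real_derivative integral {0..L} (R 1 0 t)) (at t)"
        using R t cR by (intro has_real_derivative_integral_Icc) (auto simp: spacetime_jet_def)
      then show ?thesis using z by simp
    qed
    then have const: "integral {0..L} (\<rho> t') = integral {0..L} (R 0 0 t)" if "t' > 0" for t'
      using constant_on_positive[of "\<lambda>t. integral {0..L} (R 0 0 t)" t' t] that t fD(2)[OF that]
        Henstock_Kurzweil_Integration.integral_cong[of "{0..L}" "\<rho> t'" "R 0 0 t'"] by simp
    \<comment> \<open>For positive times the integral is constant, and it also tends to its initial
      value; uniqueness of limits identifies the two.\<close>
    have "((\<lambda>t. integral {0..L} (\<rho> t)) \<longlongrightarrow> integral {0..L} (R 0 0 t)) (at_right 0)"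
      using const by (intro tendsto_eventually) (auto simp: eventually_at_filter)
    from tendsto_unique[OF _ this C0_Ck_integral_tendsto[OF L C0(2)]]
    have "integral {0..L} (R 0 0 t) = integral {0..L} (\<rho> 0)" by simp
    also have "\<dots> = integral {0..L} \<rho>\<^sub>0"
      using sol by (intro Henstock_Kurzweil_Integration.integral_cong) (auto simp: flow_solution_def)
    finally show ?thesis using adm by (simp add: admissible_def)
  qed
  have "Limsup at_top (\<lambda>t. ereal (W2_norm L 3 (\<theta> t) + W2_norm L 3 (\<rho> t))) < \<infinity>"
    using th adm sol unfolding flow_theory_def by blast
  then obtain M where "Limsup at_top (\<lambda>t. ereal (W2_norm L 3 (\<theta> t) + W2_norm L 3 (\<rho> t))) < ereal M"
    using less_PInf_Ex_of_nat by (metis ereal_dense2)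
  from Limsup_lessD[OF this] obtain T0 where T0: "\<And>t. t \<ge> T0 \<Longrightarrow> W2_norm L 3 (\<theta> t) + W2_norm L 3 (\<rho> t) < M"
    by (auto simp: eventually_at_top_linorder)
  \<comment> \<open>The finite limsup bounds the norms from \<open>T0\<close> on; the maximum with 1
    makes the starting time positive, where the derivative families live.\<close>
  define T where "T = max T0 1"
  have T: "T > 0" "T \<ge> T0" by (auto simp: T_def)
  have M: "l2 0 L (D 0 j t) \<le> M \<and> l2 0 L (R 0 j t) \<le> M" if "t \<ge> T" "j \<in> {1..3}" for j t
  proof -
    have t: "t > 0" "t \<ge> T0" using that T by auto
    show ?thesis
      using l2_le_W2_norm[OF L JD[OF t(1)], of j 3] l2_le_W2_norm[OF L JR[OF t(1)], of j 3] T0[OF t(2)] that(2)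
        l2_nonneg[of 0 L "D 0 j t"] l2_nonneg[of 0 L "R 0 j t"] by auto
  qed
  note decay = reduced_flow_exp_decay[OF L mu \<beta> pos D R pdeD pdeR perD perR mean T(1), of M]
  obtain m where m: "\<forall>j\<le>2. \<exists>g. exp_decay T g \<and> (\<forall>t\<ge>T. \<forall>s\<in>{0..L}.
      \<bar>D 0 j t s - (if j = 0 then c\<^sub>0 * s + m else if j = 1 then c\<^sub>0 else 0)\<bar> \<le> g t)"
    using decay(1) M by blast
  have decR: "\<forall>j\<le>2. \<exists>g. exp_decay T g \<and> (\<forall>t\<ge>T. \<forall>s\<in>{0..L}. \<bar>R 0 j t s - (if j = 0 then \<nu> else 0)\<bar> \<le> g t)"
    using decay(2) M by blast
  define \<theta>inf \<rho>inf :: "real \<Rightarrow> real" where "\<theta>inf = (\<lambda>s. c\<^sub>0 * s + m)" and "\<rho>inf = (\<lambda>s. \<nu>)"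
  have J\<theta>: "jet L 2 \<theta>inf (\<lambda>j s. if j = 0 then c\<^sub>0 * s + m else if j = 1 then c\<^sub>0 else 0)"
    unfolding jet_def \<theta>inf_def
  proof (intro conjI ballI allI impI)
    fix j :: nat
    show "continuous_on {0..L} (\<lambda>s. if j = 0 then c\<^sub>0 * s + m else if j = 1 then c\<^sub>0 else 0)"
      by (cases "j = 0"; cases "j = 1") (auto intro!: continuous_intros)
  qed (auto intro!: derivative_eq_intros)
  have J\<rho>: "jet L 2 \<rho>inf (\<lambda>j s. if j = 0 then \<nu> else 0)"
    unfolding jet_def \<rho>inf_def by (auto intro!: derivative_eq_intros continuous_intros)
  have ck: "Ck_on L 2 \<theta>inf" "Ck_on L 2 \<rho>inf" using jet_Ck_on[OF L] J\<theta> J\<rho> by blast+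
  have dec: "exp_decay T (\<lambda>t. Ck_norm L 2 (\<lambda>s. \<theta> t s - \<theta>inf s) + Ck_norm L 2 (\<lambda>s. \<rho> t s - \<rho>inf s))"
    using T(1) Ck_norm_exp_decay[OF L T(1) D J\<theta> m] Ck_norm_exp_decay[OF L T(1) R J\<rho> decR]
    by (intro exp_decay_add) auto
  \<comment> \<open>Before \<open>T\<close> boundedness comes from continuity in time with values in
    C^2.\<close>
  obtain B1 where B1: "\<forall>t\<in>{0..T}. Ck_norm L 2 (\<lambda>s. \<theta> t s - \<theta>inf s) \<le> B1"
    using C0_Ck_bounded[OF L C0(1) ck(1)] by blast
  obtain B2 where B2: "\<forall>t\<in>{0..T}. Ck_norm L 2 (\<lambda>s. \<rho> t s - \<rho>inf s) \<le> B2"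
    using C0_Ck_bounded[OF L C0(2) ck(2)] by blast
  have "\<exists>C \<delta>. \<delta> > 0 \<and> (\<forall>t\<ge>0.
      Ck_norm L 2 (\<lambda>s. \<theta> t s - \<theta>inf s) + Ck_norm L 2 (\<lambda>s. \<rho> t s - \<rho>inf s) \<le> C * exp (- \<delta> * t))"
    using B1 B2 by (intro exp_decay_extend[OF dec, of "B1 + B2"]) (auto intro: add_mono)
  moreover have "Ds L \<theta>inf s = c\<^sub>0" if "s \<in> {0..L}" for s
    using jet_Ds[OF L J\<theta>, of 1 s] that by simp
  moreover have "describes_circle L \<theta>inf"
    using describes_circle_constant_curvature[OF L, of m] by (simp add: \<theta>inf_def c0)
  ultimately show ?thesis using ck unfolding \<rho>inf_def by blast
qed

end
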